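(* Let $\xi=(\xi_1\ge\dots\ge\xi_r\ge0)$ be a partition, $n=|\xi|$, and let $\rho=(1^{\xi^t_1}2^{\xi^t_2}\cdots)$ be the partition in which each $j\ge1$ appears exactly $\xi^t_j$ times, where $\xi^t$ is the transposed partition of $\xi$. Then $$\mathrm{ch}_xV(\xi)=\sum_mx^m\cdot\mathrm{ch}\left(V_r^{\otimes n}\otimes\mathbb{C}\mathrm{PF}_n^m(\rho)\otimes\mathrm{Sign}\right)^{\Sigma_n},$$ or equivalently $$\mathrm{ch}_xV(\xi)=\sum_mx^m\cdot\mathrm{ch}\,\mathcal{F}_n^r\left(\mathbb{C}\mathrm{PF}_n^m(\rho)\otimes\mathrm{Sign}\right).$$
   Context: Parking functions: for a partition $\rho=(\rho_1\ge\dots\ge\rho_k\ge0)$, a function $f:\{1,\dots,n\}\to\{1,\dots,n\}$ is a $\rho$-parking function if $|f^{-1}(\{1,\dots,\rho_{k-s+1}\})|\ge s$ for $s=1,\dots,k$. $\mathrm{PF}_n(\rho)$ is the set of these; the symmetric group $\Sigma_n$ acts on it by permuting the domain, and $\mathbb{C}\mathrm{PF}_n(\rho)$ is the complex permutation representation. For $f\in\mathrm{PF}_n(\rho)$ put $|f|=|\rho|-\sum_{i=1}^nf(i)$, where $|\rho|=\sum\rho_i$; $\mathbb{C}\mathrm{PF}_n^m(\rho)$ is the $\Sigma_n$-subrepresentation spanned by the $f$ with $|f|=m$. $\mathrm{Sign}$ is the sign representation of $\Sigma_n$; $V_r=\mathbb{C}^r$ is the vector representation of $\mathfrak{gl}_r$;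 $\mathfrak{gl}_r$ acts on $V_r^{\otimes n}$ and $\Sigma_n$ permutes the tensor factors. $\mathrm{ch}$ denotes the usual character of a finite-dimensional $\mathfrak{gl}_r$-module. Frobenius map: $\mathcal{F}_n^r$ is the additive map from the Grothendieck ring of $\Sigma_n$ to that of $\mathfrak{gl}_r$ sending the irreducible representation $\pi_\eta$ (for a partition $\eta$ of $n$) to the irreducible $\mathfrak{gl}_r$-module $\pi^\eta$ with highest weight $\eta$ if $\eta_{r+1}=0$, and to $0$ otherwise. Module $V(\xi)$ and its bigrading: $\mathbb{C}\langle\mathcal{X},\mathcal{Y}\rangle$ is the associative algebra generated by $\mathcal{X},\mathcal{Y}$ with $\mathcal{Y}\mathcal{X}-\mathcal{X}\mathcal{Y}=\mathcal{X}$, acting on $\mathbb{C}[x,x^{-1}]$ by $\mathcal{X}=x$, $\mathcal{Y}=x\,\partial/\partial x$ and preserving each $x^N\mathbb{C}[x]$. $\mathcal{G}_r=\mathfrak{gl}_r\otimes\mathbb{C}\langle\mathcal{X},\mathcal{Y}\rangle$. $V_r^{(N)}=V_r\otimes(\mathbb{C}[x,x^{-1}]/x^N\mathbb{C}[x])$ is a $\mathcal{G}_r$-module with basis $u_j^i=u_j\otimes x^i$, $i<N$. $v_\xi^{(N)}=\bigwedge_{j=1}^r\bigwedge_{i=N-\xi_j}^{N-1}u_j^i$, $\mathcal{V}(\xi,N)=U(\mathcal{G}_r)v_\xi^{(N)}\subset\bigwedge^{|\xi|}V_r^{(N)}$. It is graded by the $\mathcal{X}$-degree: $\mathcal{V}(\xi,N)=\bigoplus_i\mathcal{V}^i(\xi,N)$,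 where $v_\xi^{(N)}\in\mathcal{V}^0$ and $g\otimes\mathcal{X}^k\mathcal{Y}^l$ maps $\mathcal{V}^i$ to $\mathcal{V}^{i+k}$. $F^n\mathcal{G}_r$ is the span of $g\otimes\mathcal{X}^i\mathcal{Y}^j$, $j\le n$; $U^{\le m}(\mathcal{G}_r)$ is the span of products $a_1\cdots a_k$ with $a_i\in F^{m_i}\mathcal{G}_r$, $\sum m_i\le m$; $F^m\mathcal{V}(\xi,N)=U^{\le m}(\mathcal{G}_r)v_\xi^{(N)}$, and $F^m\mathcal{V}^i=\mathcal{V}^i\cap F^m\mathcal{V}$. $V(\xi)=\bigoplus_mF^m\mathcal{V}(\xi,N)/F^{m-1}\mathcal{V}(\xi,N)$, a module over $\operatorname{gr}\mathcal{G}_r=\mathfrak{gl}_r\otimes\mathbb{C}[x,y]$, independent of $N$ up to isomorphism, bigraded by $V^{ij}(\xi)=F^j\mathcal{V}^i(\xi,N)/F^{j-1}\mathcal{V}^i(\xi,N)$. Each $V^{ij}(\xi)$ is a $\mathfrak{gl}_r$-module via $\mathfrak{gl}_r\otimes1$. Put $\mathrm{ch}_{x,y}V(\xi)=\sum_{i,j}x^iy^j\,\mathrm{ch}\,V^{ij}(\xi)$, and let $\mathrm{ch}_xV(\xi)$ be its specialization at $y=1$. *)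

theory Defs
  imports
    Complex_Main
    "HOL-Library.Function_Algebras"
    "HOL-Library.FuncSet"
    "HOL-Library.Groups_Big_Fun"
    "HOL-Combinatorics.Permutations"
begin

section \<open>Vectors, dimensions and characters\<close>

text \<open>
  All representation spaces are subspaces of a space of functions from a set of basis labels
  to the complex numbers; the function T stands for the combination of basis vectors in
  which the basis vector with label x has coefficient T x.
\<close>

type_synonym 'x vec = "'x \<Rightarrow> complex"

definition vscale :: "complex \<Rightarrow> 'x vec \<Rightarrow> 'x vec" where
  "vscale c T = (\<lambda>x. c * T x)"

definition homscale :: "complex \<Rightarrow> ('v \<Rightarrow> 'x vec) \<Rightarrow> 'v \<Rightarrow> 'x vec" where
  "homscale c \<phi> = (\<lambda>v. vscale c (\<phi> v))"

lemma vector_space_vscale: "vector_space vscale"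
  unfolding vector_space_def vscale_def
  by (simp add: fun_eq_iff distrib_left distrib_right mult.assoc)

lemma vector_space_homscale: "vector_space homscale"
  unfolding vector_space_def homscale_def vscale_def
  by (simp add: fun_eq_iff distrib_left distrib_right mult.assoc)

interpretation cvec: vector_space vscale
  by (rule vector_space_vscale)

interpretation homvec: vector_space homscale
  by (rule vector_space_homscale)

definition free_space :: "'x set \<Rightarrow> 'x vec set" where
  "free_space S = {T. finite {x. T x \<noteq> 0} \<and> (\<forall>x. x \<notin> S \<longrightarrow> T x = 0)}"

text \<open>
  Elements of gl\<open>\<^sub>r\<close> are matrices indexed from 1; entries outside \<open>{1..r}\<close> are ignored by
  every action below.
\<close>

type_synonym glmat = "nat \<Rightarrow> nat \<Rightarrow> complex"

definition Emat :: "nat \<Rightarrow> nat \<Rightarrow> glmat" where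
  "Emat p q = (\<lambda>p' q'. if p' = p \<and> q' = q then 1 else 0)"

text \<open>
  The character of the finite-dimensional gl\<open>\<^sub>r\<close>-module \<open>W / W'\<close> (for submodules
  \<open>W' \<subseteq> W\<close>), as the function sending a weight \<open>\<mu>\<close> to the multiplicity of \<open>\<mu>\<close>. A weight is
  given by the eigenvalues \<open>\<mu> 1, \<dots>, \<mu> r\<close> of the diagonal matrix units. The set \<open>K\<close> below is the
  preimage in \<open>W\<close> of the weight space of \<open>W / W'\<close>, so that \<open>dim K - dim W'\<close> is the dimension
  of that weight space.
\<close>

definition ch_quot ::
  "nat \<Rightarrow> (glmat \<Rightarrow> 'x vec \<Rightarrow> 'x vec) \<Rightarrow> 'x vec set \<Rightarrow> 'x vec set \<Rightarrow> (nat \<Rightarrow> complex) \<Rightarrow> int" where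
  "ch_quot r act W W' \<mu> =
     (let K = {T \<in> W. \<forall>p\<in>{1..r}. act (Emat p p) T - vscale (\<mu> p) T \<in> W'}
      in int (cvec.dim K) - int (cvec.dim W'))"

definition ch ::
  "nat \<Rightarrow> (glmat \<Rightarrow> 'x vec \<Rightarrow> 'x vec) \<Rightarrow> 'x vec set \<Rightarrow> (nat \<Rightarrow> complex) \<Rightarrow> int" where
  "ch r act W = ch_quot r act W {0}"


section \<open>Partitions and parking functions\<close>

text \<open>Partitions are weakly decreasing lists; \<open>part \<eta> j\<close> is the part \<open>\<eta>\<^sub>j\<close>, with \<open>j\<close> counted from 1.\<close>

definition part :: "nat list \<Rightarrow> nat \<Rightarrow> nat" where
  "part \<eta> j = (if 1 \<le> j \<and> j \<le> length \<eta> then \<eta> ! (j - 1) else 0)"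

definition partitions_of :: "nat \<Rightarrow> nat list set" where
  "partitions_of n = {\<eta>. sorted_wrt (\<ge>) \<eta> \<and> 0 \<notin> set \<eta> \<and> sum_list \<eta> = n}"

definition transposed_part :: "nat list \<Rightarrow> nat \<Rightarrow> nat" where
  "transposed_part \<xi> j = card {i \<in> {1..length \<xi>}. j \<le> part \<xi> i}"

definition rho_of :: "nat list \<Rightarrow> nat list" where
  "rho_of \<xi> =
     rev (concat (map (\<lambda>j. replicate (transposed_part \<xi> j) j) [1..<Suc (sum_list \<xi>)]))"

definition PF :: "nat \<Rightarrow> nat list \<Rightarrow> (nat \<Rightarrow> nat) set" where
  "PF n \<rho> = {f \<in> {1..n} \<rightarrow>\<^sub>E {1..n}.
     \<forall>s\<in>{1..length \<rho>}. s \<le> card {i \<in> {1..n}. f i \<in> {1..part \<rho> (length \<rho> - s + 1)}}}"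

definition pf_deg :: "nat \<Rightarrow> nat list \<Rightarrow> (nat \<Rightarrow> nat) \<Rightarrow> int" where
  "pf_deg n \<rho> f = int (sum_list \<rho>) - int (\<Sum>i=1..n. f i)"

definition PFm :: "nat \<Rightarrow> nat list \<Rightarrow> int \<Rightarrow> (nat \<Rightarrow> nat) set" where
  "PFm n \<rho> m = {f \<in> PF n \<rho>. pf_deg n \<rho> f = m}"


section \<open>Invariants in the tensor product\<close>

text \<open>
  The vector spaces of \<open>\<complex>PF\<close> and of \<open>\<complex>PF \<otimes> Sign\<close> coincide. A permutation \<open>\<sigma>\<close> sends the basis
  vector of \<open>f\<close> to that of \<open>f \<circ> \<sigma>\<^sup>-\<^sup>1\<close> (times its sign), hence the coefficient function \<open>T\<close> to
  \<open>\<lambda>f. T (f \<circ> \<sigma>)\<close> (times the sign).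
\<close>

definition CPFm :: "nat \<Rightarrow> nat list \<Rightarrow> int \<Rightarrow> (nat \<Rightarrow> nat) vec set" where
  "CPFm n \<rho> m = free_space (PFm n \<rho> m)"

definition pf_sign_act ::
  "(nat \<Rightarrow> nat) \<Rightarrow> (nat \<Rightarrow> nat) vec \<Rightarrow> (nat \<Rightarrow> nat) vec" where
  "pf_sign_act \<sigma> T = (\<lambda>f. of_int (sign \<sigma>) * T (f \<circ> \<sigma>))"

text \<open>
  The space \<open>V\<^sub>r\<^sup>\<otimes>\<^sup>n \<otimes> \<complex>PF \<otimes> Sign\<close> has a basis labelled by the pairs \<open>(w, f)\<close>, where \<open>w\<close> labels
  the tensor \<open>u\<^bsub>w 1\<^esub> \<otimes> \<dots> \<otimes> u\<^bsub>w n\<^esub>\<close>.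
\<close>

definition tensor_CPFm ::
  "nat \<Rightarrow> nat \<Rightarrow> nat list \<Rightarrow> int \<Rightarrow> ((nat \<Rightarrow> nat) \<times> (nat \<Rightarrow> nat)) vec set" where
  "tensor_CPFm r n \<rho> m = free_space (({1..n} \<rightarrow>\<^sub>E {1..r}) \<times> PFm n \<rho> m)"

definition tensor_sign_act ::
  "(nat \<Rightarrow> nat) \<Rightarrow> ((nat \<Rightarrow> nat) \<times> (nat \<Rightarrow> nat)) vec \<Rightarrow> ((nat \<Rightarrow> nat) \<times> (nat \<Rightarrow> nat)) vec" where
  "tensor_sign_act \<sigma> T = (\<lambda>(w, f). of_int (sign \<sigma>) * T (w \<circ> \<sigma>, f \<circ> \<sigma>))"

definition tensor_gl_act ::
  "nat \<Rightarrow> nat \<Rightarrow> glmat \<Rightarrow> ((nat \<Rightarrow> nat) \<times> (nat \<Rightarrow> nat)) vec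
     \<Rightarrow> ((nat \<Rightarrow> nat) \<times> (nat \<Rightarrow> nat)) vec" where
  "tensor_gl_act r n g T = (\<lambda>(w, f).
     if w \<in> {1..n} \<rightarrow>\<^sub>E {1..r}
     then \<Sum>t=1..n. \<Sum>q=1..r. g (w t) q * T (w(t := q), f) else 0)"

definition invariants ::
  "nat \<Rightarrow> ((nat \<Rightarrow> nat) \<Rightarrow> 'x vec \<Rightarrow> 'x vec) \<Rightarrow> 'x vec set \<Rightarrow> 'x vec set" where
  "invariants n A M = {T \<in> M. \<forall>\<sigma>. \<sigma> permutes {1..n} \<longrightarrow> A \<sigma> T = T}"


section \<open>The modules V(xi)\<close>

text \<open>
  By the relation \<open>\<Y>\<X> - \<X>\<Y> = \<X>\<close>, the algebra \<open>\<complex>\<langle>\<X>,\<Y>\<rangle>\<close> has the basis \<open>\<X>\<^sup>k\<Y>\<^sup>l\<close>. An element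
  \<open>\<Sum> g\<^sub>k\<^sub>l \<otimes> \<X>\<^sup>k\<Y>\<^sup>l\<close> of \<open>\<G>\<^sub>r\<close> is encoded as the finitely supported function \<open>\<lambda>k l. g\<^sub>k\<^sub>l\<close>.
\<close>

type_synonym gelt = "nat \<Rightarrow> nat \<Rightarrow> glmat"

definition gelt_supp :: "gelt \<Rightarrow> (nat \<times> nat) set" where
  "gelt_supp a = {(k, l). a k l \<noteq> 0}"

definition Gr :: "gelt set" where
  "Gr = {a. finite (gelt_supp a)}"

definition Gr_deg :: "nat \<Rightarrow> gelt set" where
  "Gr_deg i = {a \<in> Gr. \<forall>(k, l) \<in> gelt_supp a. k = i}"

definition Gr_filt :: "nat \<Rightarrow> gelt set" where
  "Gr_filt m = {a \<in> Gr. \<forall>(k, l) \<in> gelt_supp a. l \<le> m}"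

definition gelt_of :: "glmat \<Rightarrow> nat \<Rightarrow> nat \<Rightarrow> gelt" where
  "gelt_of g k l = (\<lambda>k' l'. if k' = k \<and> l' = l then g else 0)"

text \<open>
  The label \<open>(j, i)\<close> stands for \<open>u\<^sub>j\<^sup>i = u\<^sub>j \<otimes> x\<^sup>i\<close>. The exterior power of \<open>V\<^sub>r\<^sup>(\<^sup>N\<^sup>)\<close> is realized
  as the space of antisymmetric tensors in the tensor power, with basis labels
  \<open>{1..n} \<rightarrow>\<^sub>E Vbasis r N\<close> for the latter, and with
  \<open>b\<^sub>1 \<and> \<dots> \<and> b\<^sub>n = \<Sum>\<^sub>\<sigma> sign \<sigma> \<cdot> b\<^bsub>\<sigma> 1\<^esub> \<otimes> \<dots> \<otimes> b\<^bsub>\<sigma> n\<^esub>\<close>.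
\<close>

type_synonym tens = "(nat \<Rightarrow> nat \<times> int) vec"

definition Vbasis :: "nat \<Rightarrow> int \<Rightarrow> (nat \<times> int) set" where
  "Vbasis r N = {1..r} \<times> {..<N}"

text \<open>
  The action is the derivation extension of
  \<open>(g \<otimes> \<X>\<^sup>k\<Y>\<^sup>l) u\<^sub>q\<^sup>i = \<Sum>\<^sub>p g\<^sub>p\<^sub>q i\<^sup>l u\<^sub>p\<^bsup>i+k\<^esup>\<close>, where \<open>u\<^sub>p\<^bsup>i+k\<^esup> = 0\<close> if \<open>i + k \<ge> N\<close>.
\<close>

definition gact :: "nat \<Rightarrow> int \<Rightarrow> nat \<Rightarrow> gelt \<Rightarrow> tens \<Rightarrow> tens" where
  "gact r N n a T = (\<lambda>b.
     if b \<in> {1..n} \<rightarrow>\<^sub>E Vbasis r N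
     then \<Sum>t=1..n. \<Sum>(k, l)\<in>gelt_supp a. \<Sum>q=1..r.
            a k l (fst (b t)) q * of_int (snd (b t) - int k) ^ l
              * T (b(t := (q, snd (b t) - int k)))
     else 0)"

definition wedge :: "(nat \<times> int) list \<Rightarrow> tens" where
  "wedge bs = (let n = length bs in (\<lambda>b. \<Sum>\<sigma> | \<sigma> permutes {1..n}.
     if b = (\<lambda>t\<in>{1..n}. bs ! (\<sigma> t - 1)) then of_int (sign \<sigma>) else 0))"

definition vxi :: "nat \<Rightarrow> nat list \<Rightarrow> int \<Rightarrow> tens" where
  "vxi r \<xi> N = wedge (concat
     (map (\<lambda>j. map (\<lambda>i. (j, i)) [N - int (part \<xi> j)..N - 1]) [1..<Suc r]))"

text \<open>
  The graded pieces \<open>\<V>\<^sup>i(\<xi>, N)\<close> and the filtration \<open>F\<^sup>m\<V>(\<xi>, N)\<close> of \<open>\<V>(\<xi>, N) = U(\<G>\<^sub>r) v\<^sub>\<xi>\<^sup>(\<^sup>N\<^sup>)\<close>.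
  The condition that \<open>v\<^sub>\<xi>\<^sup>(\<^sup>N\<^sup>)\<close> has degree 0 and \<open>g \<otimes> \<X>\<^sup>k\<Y>\<^sup>l\<close> raises the degree by \<open>k\<close> determines
  the grading. The index of the filtration is an integer in order to include \<open>F\<^sup>-\<^sup>1 = 0\<close>.
\<close>

definition calV_deg :: "nat \<Rightarrow> nat list \<Rightarrow> int \<Rightarrow> int \<Rightarrow> tens set" where
  "calV_deg r \<xi> N i = cvec.span
     {foldr (gact r N (sum_list \<xi>)) as (vxi r \<xi> N) | as ks.
        list_all2 (\<lambda>a k. a \<in> Gr_deg k) as ks \<and> int (sum_list ks) = i}"

definition calV_filt :: "nat \<Rightarrow> nat list \<Rightarrow> int \<Rightarrow> int \<Rightarrow> tens set" where
  "calV_filt r \<xi> N m = cvec.span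
     {foldr (gact r N (sum_list \<xi>)) as (vxi r \<xi> N) | as ms.
        list_all2 (\<lambda>a k. a \<in> Gr_filt k) as ms \<and> int (sum_list ms) \<le> m}"

definition calV_bi :: "nat \<Rightarrow> nat list \<Rightarrow> int \<Rightarrow> int \<Rightarrow> int \<Rightarrow> tens set" where
  "calV_bi r \<xi> N i j = calV_deg r \<xi> N i \<inter> calV_filt r \<xi> N j"

definition gl_act_calV :: "nat \<Rightarrow> int \<Rightarrow> nat \<Rightarrow> glmat \<Rightarrow> tens \<Rightarrow> tens" where
  "gl_act_calV r N n g = gact r N n (gelt_of g 0 0)"

text \<open>
  The generating functions: \<open>ch_xy r \<xi> N i j\<close> is the coefficient \<open>ch V\<^sup>i\<^sup>j(\<xi>)\<close> of \<open>x\<^sup>i y\<^sup>j\<close>, and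
  \<open>ch_x r \<xi> N i\<close> is the coefficient of \<open>x\<^sup>i\<close> after putting \<open>y = 1\<close>.
\<close>

definition ch_xy :: "nat \<Rightarrow> nat list \<Rightarrow> int \<Rightarrow> int \<Rightarrow> int \<Rightarrow> (nat \<Rightarrow> complex) \<Rightarrow> int" where
  "ch_xy r \<xi> N i j = ch_quot r (gl_act_calV r N (sum_list \<xi>))
     (calV_bi r \<xi> N i j) (calV_bi r \<xi> N i (j - 1))"

definition ch_x :: "nat \<Rightarrow> nat list \<Rightarrow> int \<Rightarrow> int \<Rightarrow> (nat \<Rightarrow> complex) \<Rightarrow> int" where
  "ch_x r \<xi> N i \<mu> = Sum_any (\<lambda>j. ch_xy r \<xi> N i j \<mu>)"


section \<open>The Frobenius map\<close>

text \<open>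
  The irreducible representation \<open>\<pi>\<^sub>\<eta>\<close> of the symmetric group is the left ideal \<open>\<complex>[\<Sigma>\<^sub>n] c\<^sub>\<eta>\<close>
  generated by the Young symmetrizer
  \<open>c\<^sub>\<eta> = (\<Sum>\<^sub>p p) (\<Sum>\<^sub>q sign q \<cdot> q)\<close>, with \<open>p\<close> preserving the rows and \<open>q\<close> preserving the
  columns of the tableau of shape \<open>\<eta>\<close> filled with \<open>1, \<dots>, n\<close> row by row. In particular
  \<open>\<pi>\<close> is trivial for \<open>\<eta> = (n)\<close> and is the sign representation for \<open>\<eta> = (1\<^sup>n)\<close>.
\<close>

definition tab_row :: "nat list \<Rightarrow> nat \<Rightarrow> nat" where
  "tab_row \<eta> t = (LEAST i. t \<le> (\<Sum>j=1..i. part \<eta> j))"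

definition tab_col :: "nat list \<Rightarrow> nat \<Rightarrow> nat" where
  "tab_col \<eta> t = t - (\<Sum>j=1..<tab_row \<eta> t. part \<eta> j)"

definition row_group :: "nat list \<Rightarrow> (nat \<Rightarrow> nat) set" where
  "row_group \<eta> = {p. p permutes {1..sum_list \<eta>} \<and>
     (\<forall>t\<in>{1..sum_list \<eta>}. tab_row \<eta> (p t) = tab_row \<eta> t)}"

definition col_group :: "nat list \<Rightarrow> (nat \<Rightarrow> nat) set" where
  "col_group \<eta> = {q. q permutes {1..sum_list \<eta>} \<and>
     (\<forall>t\<in>{1..sum_list \<eta>}. tab_col \<eta> (q t) = tab_col \<eta> t)}"

definition young_symmetrizer :: "nat list \<Rightarrow> (nat \<Rightarrow> nat) vec" where
  "young_symmetrizer \<eta> =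
     (\<lambda>\<tau>. \<Sum>p\<in>row_group \<eta>. \<Sum>q\<in>col_group \<eta>. if p \<circ> q = \<tau> then of_int (sign q) else 0)"

definition left_act :: "(nat \<Rightarrow> nat) \<Rightarrow> (nat \<Rightarrow> nat) vec \<Rightarrow> (nat \<Rightarrow> nat) vec" where
  "left_act \<sigma> T = (\<lambda>\<tau>. T (inv \<sigma> \<circ> \<tau>))"

definition specht :: "nat list \<Rightarrow> (nat \<Rightarrow> nat) vec set" where
  "specht \<eta> = cvec.span
     {left_act \<sigma> (young_symmetrizer \<eta>) | \<sigma>. \<sigma> permutes {1..sum_list \<eta>}}"

text \<open>Equivariant linear maps \<open>M \<rightarrow> M'\<close>, extended by 0 outside \<open>M\<close>.\<close>

definition sym_hom ::
  "nat \<Rightarrow> ((nat \<Rightarrow> nat) \<Rightarrow> 'x vec \<Rightarrow> 'x vec) \<Rightarrow> 'x vec set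
     \<Rightarrow> ((nat \<Rightarrow> nat) \<Rightarrow> 'y vec \<Rightarrow> 'y vec) \<Rightarrow> 'y vec set \<Rightarrow> ('x vec \<Rightarrow> 'y vec) set" where
  "sym_hom n A M A' M' = {\<phi>.
     (\<forall>S\<in>M. \<phi> S \<in> M') \<and> (\<forall>S. S \<notin> M \<longrightarrow> \<phi> S = 0) \<and>
     (\<forall>S\<in>M. \<forall>T\<in>M. \<phi> (S + T) = \<phi> S + \<phi> T) \<and>
     (\<forall>c. \<forall>S\<in>M. \<phi> (vscale c S) = vscale c (\<phi> S)) \<and>
     (\<forall>\<sigma>. \<sigma> permutes {1..n} \<longrightarrow> (\<forall>S\<in>M. \<phi> (A \<sigma> S) = A' \<sigma> (\<phi> S)))}"

text \<open>
  Both Grothendieck groups are free on the classes of irreducible modules. The class of \<open>M\<close> is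
  given by the multiplicities \<open>dim Hom(\<pi>\<^sub>\<eta>, M)\<close> of the \<open>\<pi>\<^sub>\<eta>\<close>; on the gl\<open>\<^sub>r\<close> side only the
  modules \<open>\<pi>\<^sup>\<eta>\<close> for partitions \<open>\<eta>\<close> are needed, and a class is again a function of \<open>\<eta>\<close>.
\<close>

definition sym_class ::
  "nat \<Rightarrow> ((nat \<Rightarrow> nat) \<Rightarrow> 'x vec \<Rightarrow> 'x vec) \<Rightarrow> 'x vec set \<Rightarrow> nat list \<Rightarrow> int" where
  "sym_class n A M \<eta> =
     (if \<eta> \<in> partitions_of n then int (homvec.dim (sym_hom n left_act (specht \<eta>) A M)) else 0)"

definition frobenius :: "nat \<Rightarrow> (nat list \<Rightarrow> int) \<Rightarrow> nat list \<Rightarrow> int" where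
  "frobenius r c \<eta> = (if part \<eta> (r + 1) = 0 then c \<eta> else 0)"

text \<open>
  For \<open>\<eta>\<close> with at most \<open>r\<close> parts, \<open>v\<^sub>\<eta>\<^sup>(\<^sup>0\<^sup>)\<close> is a highest weight vector of weight \<open>\<eta>\<close> for
  \<open>gl\<^sub>r \<otimes> 1\<close>, so the \<open>gl\<^sub>r\<close>-submodule it generates in the (semisimple) exterior power is the
  irreducible module \<open>\<pi>\<^sup>\<eta>\<close>.
\<close>

definition gl_irrep :: "nat \<Rightarrow> nat list \<Rightarrow> tens set" where
  "gl_irrep r \<eta> = cvec.span
     {foldr (gl_act_calV r 0 (sum_list \<eta>)) gs (vxi r \<eta> 0) | gs. True}"

definition ch_class :: "nat \<Rightarrow> nat \<Rightarrow> (nat list \<Rightarrow> int) \<Rightarrow> (nat \<Rightarrow> complex) \<Rightarrow> int" where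
  "ch_class r n c \<mu> = (\<Sum>\<eta>\<in>partitions_of n.
     c \<eta> * ch r (gl_act_calV r 0 n) (gl_irrep r \<eta>) \<mu>)"

end

theory Submission
  imports Defs "HOL-Combinatorics.Cycles" "HOL-Computational_Algebra.Polynomial"
begin

text \<open>
  All three characters in the theorem are compared, weight by weight and degree by degree, with one number: the average
  over the symmetric group of the product of the permutation character of words of content \<open>\<mu>\<close> and the
  sign-twisted permutation character of parking functions of degree \<open>m\<close>.

  For the module \<open>V(\<xi>)\<close>, putting \<open>y = 1\<close> forgets the filtration, and what remains is the graded piece of
  \<open>\<V>(\<xi>, N)\<close> itself (\<open>ch_x_eq_dim\<close>). The operator \<open>\<Y>\<close> is diagonal with distinct eigenvalues on the
  powers of \<open>x\<close>, so by interpolation the Lie algebra \<open>\<G>\<^sub>r\<close> acts through all matrix units that do not lower the exponent,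
  here called the level. The module generated from \<open>v\<^sub>\<xi>\<close> is therefore spanned by all wedges of basis vectors that lie
  above \<open>v\<^sub>\<xi>\<close> in the sense that for every \<open>s\<close> they have at least as many factors of level \<open>\<ge> s\<close>
  (\<open>calV_deg_eq_alt_space\<close>). Measuring levels from the top turns this dominance condition into
  the parking condition for \<open>\<rho>\<close> and the degree in \<open>\<X>\<close> into \<open>|f|\<close> (\<open>reachable_label_of\<close>). Hence the graded piece consists of
  antisymmetric functions on pairs of a word and a parking function, which are exactly the invariants in
  \<open>V\<^sub>r\<^sup>\<otimes>\<^sup>n \<otimes> \<complex>PF \<otimes> Sign\<close>.

  The form with the Frobenius map is Schur--Weyl duality, proved here through characters. For the Young symmetrizer
  \<open>c\<^sub>\<eta>\<close> with \<open>c\<^sub>\<eta> c\<^sub>\<eta> = k\<^sub>\<eta> c\<^sub>\<eta>\<close>, the multiplicity of \<open>\<pi>\<^sub>\<eta>\<close> in a representation is the dimension of the image of \<open>c\<^sub>\<eta>\<close>, which is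
  the pairing of the character with \<open>c\<^sub>\<eta>\<close> divided by \<open>k\<^sub>\<eta>\<close> (\<open>dim_hom_specht_character\<close>). The weight multiplicities of
  \<open>\<pi>\<^sup>\<eta>\<close> are given by the same expression for the character of words (\<open>ch_gl_irrep\<close>): restricted to fixed levels, the
  generating vector becomes a column-antisymmetrized word, and the Lie algebra generates from a word
  all vectors with its row symmetry. Finally the conjugate sums of the Young symmetrizers are orthogonal by von Neumann's lemma
  and complete because there are no more conjugacy classes than partitions, and the resulting Parseval identity
  (\<open>young_parseval\<close>) sums the products of the two multiplicities over \<open>\<eta>\<close>.
\<close>

section \<open>Dimensions and traces\<close>

context vector_space_pair
begin

lemma dim_linear_image_inj:
  assumes f: "Vector_Spaces.linear s1 s2 f" and V: "vs1.subspace V" and inj: "inj_on f V"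
  shows "vs2.dim (f ` V) = vs1.dim V"
proof -
  interpret f: Vector_Spaces.linear s1 s2 f by (rule f)
  obtain B where B: "B \<subseteq> V" "vs1.independent B" "V \<subseteq> vs1.span B" "card B = vs1.dim V"
    using vs1.basis_exists by blast
  have sp: "vs1.span B = V"
    using B V by (meson subset_antisym vs1.span_minimal)
  have "vs2.independent (f ` B)"
    using B(2) inj sp by (intro f.independent_injective_image) auto
  moreover have "vs2.span (f ` B) = f ` V"
    using f.span_image[of B] sp by simp
  ultimately have "vs2.dim (f ` V) = card (f ` B)"
    using vs2.dim_span_eq_card_independent by metis
  also have "\<dots> = card B"
    using inj B(1) by (meson card_image inj_on_subset)
  finally show ?thesis using B by simp
qed

lemma rank_nullity_subspace:
  assumes f: "Vector_Spaces.linear s1 s2 f" and V: "vs1.subspace V" and fin: "finite F" "V \<subseteq> vs1.span F"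
  shows "vs1.dim V = vs2.dim (f ` V) + vs1.dim (V \<inter> {x. f x = 0})"
proof -
  interpret f: Vector_Spaces.linear s1 s2 f by (rule f)
  let ?K = "V \<inter> {x. f x = 0}"
  have K: "vs1.subspace ?K"
    using V f.subspace_kernel by (rule vs1.subspace_inter)
  obtain A where A: "A \<subseteq> ?K" "vs1.independent A" "?K \<subseteq> vs1.span A" "card A = vs1.dim ?K"
    using vs1.basis_exists by blast
  obtain B where B: "A \<subseteq> B" "B \<subseteq> V" "vs1.independent B" "V \<subseteq> vs1.span B"
    using vs1.maximal_independent_subset_extend[of A V] A by auto
  have finB: "finite B"
    using vs1.independent_span_bound[OF fin(1) B(3)] B fin(2) by blast
  have spA: "vs1.span A = ?K"
    using A K by (meson subset_antisym vs1.span_minimal)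
  have spB: "vs1.span B = V"
    using B V by (meson subset_antisym vs1.span_minimal)
  let ?C = "B - A"
  have indC: "vs1.independent ?C" using B(3) vs1.independent_mono by blast
  have spC: "vs1.span ?C \<subseteq> V" using spB vs1.span_mono by blast
  have zero: "x = 0" if x: "x \<in> vs1.span ?C" "f x = 0" for x
  proof -
    have xA: "x \<in> vs1.span A" using x spC spA by auto
    have "vs1.representation B x = vs1.representation A x"
      using vs1.representation_extend[OF B(3) xA B(1)] .
    moreover have "vs1.representation B x = vs1.representation ?C x"
      using vs1.representation_extend[OF B(3) x(1)] by auto
    ultimately have "vs1.representation B x b = 0" for b
      using vs1.representation_ne_zero by (metis Diff_iff)
    moreover have "x \<in> vs1.span B" using x spC spB by auto
    ultimately show "x = 0"
      using vs1.sum_nonzero_representation_eq[OF B(3), of x] by simp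
  qed
  have injC: "inj_on f (vs1.span ?C)"
  proof (rule inj_onI)
    fix x y assume xy: "x \<in> vs1.span ?C" "y \<in> vs1.span ?C" "f x = f y"
    then have "x - y = 0" by (intro zero) (auto simp: vs1.span_diff f.diff)
    then show "x = y" by simp
  qed
  have im: "f ` V = f ` vs1.span ?C"
  proof
    show "f ` vs1.span ?C \<subseteq> f ` V" using spC by auto
    show "f ` V \<subseteq> f ` vs1.span ?C"
    proof
      fix y assume "y \<in> f ` V"
      then obtain v where v: "v \<in> V" "y = f v" by auto
      have "A \<union> ?C = B" using B(1) by auto
      then have "v \<in> vs1.span (A \<union> ?C)" using v spB by simp
      then obtain a c where "v = a + c" "a \<in> vs1.span A" "c \<in> vs1.span ?C"
        unfolding vs1.span_Un by blast
      then show "y \<in> f ` vs1.span ?C" using v spA by (auto simp: f.add)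
    qed
  qed
  have "vs2.dim (f ` V) = card ?C"
    unfolding im using dim_linear_image_inj[OF f vs1.subspace_span injC]
      vs1.dim_span_eq_card_independent[OF indC] by simp
  moreover have "card B = card ?C + card A"
    using finB B(1) by (metis add.commute card_mono card_Diff_subset finite_subset le_add_diff_inverse)
  moreover have "card B = vs1.dim V"
    using B vs1.basis_card_eq_dim by blast
  ultimately show ?thesis using A by simp
qed

end

interpretation cpair: vector_space_pair vscale vscale
  by (intro vector_space_pair.intro vector_space_vscale)

interpretation hpair: vector_space_pair homscale vscale
  by (intro vector_space_pair.intro vector_space_vscale vector_space_homscale)

abbreviation clinear :: "('x vec \<Rightarrow> 'y vec) \<Rightarrow> bool" where
  "clinear \<equiv> Vector_Spaces.linear vscale vscale"

lemma clinearI: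
  assumes "\<And>S T. f (S + T) = f S + f T" "\<And>c T. f (vscale c T) = vscale c (f T)"
  shows "clinear f"
  using assms by (simp add: Vector_Spaces.linear_iff vector_space_vscale)

lemma vscale_apply [simp]: "vscale c T x = c * T x"
  by (simp add: vscale_def)

lemma csubspaceI:
  assumes "0 \<in> V" "\<And>S T. S \<in> V \<Longrightarrow> T \<in> V \<Longrightarrow> S + T \<in> V" "\<And>c T. T \<in> V \<Longrightarrow> vscale c T \<in> V"
  shows "cvec.subspace V"
  using assms by (simp add: cvec.subspace_def)

lemma sum_fun_apply: "(\<Sum>i\<in>I. f i) x = (\<Sum>i\<in>I. f i x)"
  by (induction I rule: infinite_finite_induct) auto

definition unit_vec :: "'x \<Rightarrow> 'x vec" where
  "unit_vec x = (\<lambda>y. if y = x then 1 else 0)"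

definition supp_on :: "'x set \<Rightarrow> 'x vec set" where
  "supp_on X = {T. \<forall>x. x \<notin> X \<longrightarrow> T x = 0}"

lemma supp_onD: "T \<in> supp_on X \<Longrightarrow> x \<notin> X \<Longrightarrow> T x = 0"
  by (simp add: supp_on_def)

lemma subspace_supp_on: "cvec.subspace (supp_on X)"
  by (rule csubspaceI) (auto simp: supp_on_def)

lemma free_space_finite: "finite X \<Longrightarrow> free_space X = supp_on X"
  unfolding free_space_def supp_on_def
  by (auto intro: finite_subset[of _ X])

lemma vec_expand:
  assumes "finite X" "T \<in> supp_on X"
  shows "T = (\<Sum>x\<in>X. vscale (T x) (unit_vec x))"
proof
  fix y
  have "(\<Sum>x\<in>X. vscale (T x) (unit_vec x)) y = (\<Sum>x\<in>X. if x = y then T x else 0)"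
    unfolding sum_fun_apply by (rule sum.cong) (auto simp: unit_vec_def)
  also have "\<dots> = T y"
    using assms by (auto simp: supp_on_def)
  finally show "T y = (\<Sum>x\<in>X. vscale (T x) (unit_vec x)) y" by simp
qed

lemma supp_on_span:
  assumes "finite X"
  shows "supp_on X \<subseteq> cvec.span (unit_vec ` X)"
proof
  fix T :: "'a vec" assume T: "T \<in> supp_on X"
  show "T \<in> cvec.span (unit_vec ` X)"
    by (subst vec_expand[OF assms T])
       (intro cvec.span_sum cvec.span_scale cvec.span_base imageI)
qed

text \<open>
  An operator \<open>E\<close> with \<open>E E = k E\<close> acts on its image as the scalar \<open>k\<close>. Writing \<open>E T\<close> in a basis of the
  image, the coordinates of \<open>E T\<close> are linear in \<open>T\<close>, and the trace computed in the standard basis becomes the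
  sum of the diagonal coordinates, each of which is \<open>k\<close>. Every dimension below that is not compared by an
  explicit isomorphism is computed by this lemma.
\<close>

lemma trace_quasi_idempotent:
  fixes E :: "'x vec \<Rightarrow> 'x vec"
  assumes X: "finite X" and E: "clinear E"
    and maps: "\<And>T. T \<in> supp_on X \<Longrightarrow> E T \<in> supp_on X"
    and idem: "\<And>T. T \<in> supp_on X \<Longrightarrow> E (E T) = vscale k (E T)"
    and k: "k \<noteq> 0"
  shows "k * of_nat (cvec.dim (E ` supp_on X)) = (\<Sum>x\<in>X. E (unit_vec x) x)"
proof -
  interpret E: Vector_Spaces.linear vscale vscale E by (rule E)
  let ?V = "E ` supp_on X"
  have V: "cvec.subspace ?V" by (rule E.subspace_image[OF subspace_supp_on])
  obtain B where B: "B \<subseteq> ?V" "cvec.independent B" "?V \<subseteq> cvec.span B" "card B = cvec.dim ?V"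
    using cvec.basis_exists by blast
  have BX: "B \<subseteq> supp_on X" using B maps by auto
  have "finite B"
    using cvec.independent_span_bound[of "unit_vec ` X" B] B(2) BX supp_on_span[OF X] X by blast
  note finB = this
  define \<phi> where "\<phi> T b = cvec.representation B (E T) b" for T b
  have inB: "E T \<in> cvec.span B" if "T \<in> supp_on X" for T using B that by blast
  have ET: "E T x = (\<Sum>b\<in>B. \<phi> T b * b x)" if "T \<in> supp_on X" for T x
  proof -
    have "E T = (\<Sum>b\<in>B. vscale (\<phi> T b) b)"
      unfolding \<phi>_def using cvec.sum_representation_eq[OF B(2) inB[OF that] finB] by simp
    then show ?thesis by (metis (mono_tags, lifting) sum.cong sum_fun_apply vscale_apply)
  qed
  have ux: "unit_vec x \<in> supp_on X" if "x \<in> X" for x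
    using that by (auto simp: unit_vec_def supp_on_def)
  have expand: "\<phi> T b = (\<Sum>x\<in>X. T x * \<phi> (unit_vec x) b)" if T: "T \<in> supp_on X" for T b
  proof -
    have "E T = (\<Sum>x\<in>X. vscale (T x) (E (unit_vec x)))"
      by (subst vec_expand[OF X T]) (simp add: E.sum E.scale)
    then have "\<phi> T b = cvec.representation B (\<Sum>x\<in>X. vscale (T x) (E (unit_vec x))) b"
      by (simp add: \<phi>_def)
    also have "\<dots> = (\<Sum>x\<in>X. cvec.representation B (vscale (T x) (E (unit_vec x))) b)"
      by (subst cvec.representation_sum[OF B(2)]) (auto intro!: cvec.span_scale inB ux)
    also have "\<dots> = (\<Sum>x\<in>X. T x * \<phi> (unit_vec x) b)"
      by (rule sum.cong) (auto simp: \<phi>_def cvec.representation_scale[OF B(2) inB[OF ux]])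
    finally show ?thesis .
  qed
  have diag: "\<phi> b b = k" if b: "b \<in> B" for b
  proof -
    obtain T where T: "T \<in> supp_on X" "b = E T" using B b by auto
    have "E b = vscale k b" using idem T by simp
    then have "\<phi> b b = k * cvec.representation B b b"
      unfolding \<phi>_def using cvec.representation_scale[OF B(2) cvec.span_base[OF b]] by simp
    then show ?thesis using cvec.representation_basis[OF B(2) b] by simp
  qed
  have "(\<Sum>x\<in>X. E (unit_vec x) x) = (\<Sum>x\<in>X. \<Sum>b\<in>B. \<phi> (unit_vec x) b * b x)"
    by (rule sum.cong) (auto simp: ET ux)
  also have "\<dots> = (\<Sum>b\<in>B. \<Sum>x\<in>X. b x * \<phi> (unit_vec x) b)"
    by (subst sum.swap) (simp add: mult.commute)
  also have "\<dots> = (\<Sum>b\<in>B. \<phi> b b)"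
    using expand BX by (intro sum.cong) auto
  also have "\<dots> = (\<Sum>b\<in>B. k)"
    using diag by (intro sum.cong) auto
  finally show ?thesis using B by (simp add: mult.commute)
qed

section \<open>The group algebra of the symmetric group\<close>

type_synonym perm = "nat \<Rightarrow> nat"

abbreviation Sn :: "nat \<Rightarrow> perm set" where
  "Sn n \<equiv> {\<sigma>. \<sigma> permutes {1..n}}"

text \<open>Intervals \<open>{1..n}\<close> stay in this form, which the facts about permutations use.\<close>

declare One_nat_def [simp del]

lemma finite_Sn [simp]: "finite (Sn n)"
  by (rule finite_permutations) simp

lemma permutes_cancel:
  assumes "\<sigma> permutes S"
  shows "inv \<sigma> \<circ> \<sigma> = id" "\<sigma> \<circ> inv \<sigma> = id"
    "inv \<sigma> \<circ> (\<sigma> \<circ> \<tau>) = \<tau>" "\<sigma> \<circ> (inv \<sigma> \<circ> \<tau>) = \<tau>"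
    "(\<tau> \<circ> inv \<sigma>) \<circ> \<sigma> = \<tau>" "(\<tau> \<circ> \<sigma>) \<circ> inv \<sigma> = \<tau>" "inv (inv \<sigma>) = \<sigma>"
  using permutes_inv_o[OF assms] permutes_inv_inv[OF assms]
  by (metis comp_assoc comp_id id_comp)+

lemma permutes_comp:
  "\<sigma> permutes S \<Longrightarrow> \<tau> permutes S \<Longrightarrow> \<sigma> \<circ> \<tau> permutes S"
  by (rule permutes_compose)

lemma permutes_in: "\<sigma> permutes S \<Longrightarrow> t \<in> S \<Longrightarrow> \<sigma> t \<in> S"
  by (simp add: permutes_in_image)

lemmas permutes_intros = permutes_comp permutes_inv permutes_id

lemma permutes_inv_comp:
  assumes "\<sigma> permutes S" "\<tau> permutes S"
  shows "inv (\<sigma> \<circ> \<tau>) = inv \<tau> \<circ> inv \<sigma>"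
  using assms by (simp add: o_inv_distrib permutes_bij)

lemma permutes_sign_comp:
  assumes "\<sigma> permutes {1..n}" "\<tau> permutes {1..n::nat}"
  shows "sign (\<sigma> \<circ> \<tau>) = sign \<sigma> * sign \<tau>"
  using assms by (intro sign_compose) (auto intro: permutation_permutes[THEN iffD2])

lemma permutes_sign_inv:
  "\<sigma> permutes {1..n::nat} \<Longrightarrow> sign (inv \<sigma>) = sign \<sigma>"
  by (intro sign_inverse) (auto intro: permutation_permutes[THEN iffD2])

lemma of_int_sign_square [simp]: "of_int (sign \<sigma>) * (of_int (sign \<sigma>) * x) = (x :: complex)"
  by (metis mult.assoc mult_1 of_int_1 of_int_mult sign_idempotent)

lemma sum_Sn_left:
  assumes "g permutes {1..n}"
  shows "(\<Sum>\<sigma>\<in>Sn n. F (g \<circ> \<sigma>)) = (\<Sum>\<sigma>\<in>Sn n. F \<sigma>)"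
  using setum_permutations_compose_left[OF assms, of F] by simp

lemma sum_Sn_right:
  assumes "g permutes {1..n}"
  shows "(\<Sum>\<sigma>\<in>Sn n. F (\<sigma> \<circ> g)) = (\<Sum>\<sigma>\<in>Sn n. F \<sigma>)"
  using sum_permutations_compose_right[OF assms, of F] by simp

lemma sum_Sn_inv: "(\<Sum>\<sigma>\<in>Sn n. F (inv \<sigma>)) = (\<Sum>\<sigma>\<in>Sn n. F \<sigma>)"
  using sum_permutations_inverse[of F] by simp

text \<open>
  The product of the group algebra. Its elements are functions on all of \<open>nat \<Rightarrow> nat\<close>; the product vanishes
  off the symmetric group, so that equality of functions is equality in the group algebra.
\<close>

definition conv :: "nat \<Rightarrow> perm vec \<Rightarrow> perm vec \<Rightarrow> perm vec" where
  "conv n x y = (\<lambda>\<tau>. if \<tau> permutes {1..n} then \<Sum>\<sigma>\<in>Sn n. x \<sigma> * y (inv \<sigma> \<circ> \<tau>) else 0)"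

lemma conv_apply:
  "\<tau> permutes {1..n} \<Longrightarrow> conv n x y \<tau> = (\<Sum>\<sigma>\<in>Sn n. x \<sigma> * y (inv \<sigma> \<circ> \<tau>))"
  by (simp add: conv_def)

lemma conv_outside: "\<not> \<tau> permutes {1..n} \<Longrightarrow> conv n x y \<tau> = 0"
  unfolding conv_def by (rule if_not_P)

lemma conv_apply': 
  assumes "\<tau> permutes {1..n}"
  shows "conv n x y \<tau> = (\<Sum>\<sigma>\<in>Sn n. x (\<tau> \<circ> inv \<sigma>) * y \<sigma>)"
proof -
  have "conv n x y \<tau> = (\<Sum>\<sigma>\<in>Sn n. x (inv \<sigma>) * y (inv (inv \<sigma>) \<circ> \<tau>))"
    unfolding conv_apply[OF assms] by (rule sum_Sn_inv[symmetric])
  also have "\<dots> = (\<Sum>\<sigma>\<in>Sn n. x (inv \<sigma>) * y (\<sigma> \<circ> \<tau>))"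
    by (rule sum.cong) (auto simp: permutes_cancel)
  also have "\<dots> = (\<Sum>\<sigma>\<in>Sn n. (\<lambda>\<sigma>. x (inv \<sigma>) * y (\<sigma> \<circ> \<tau>)) (\<sigma> \<circ> inv \<tau>))"
    by (rule sum_Sn_right[symmetric]) (rule permutes_inv[OF assms])
  also have "\<dots> = (\<Sum>\<sigma>\<in>Sn n. x (\<tau> \<circ> inv \<sigma>) * y \<sigma>)"
    by (rule sum.cong) (auto simp: permutes_inv_comp[OF _ permutes_inv[OF assms]] permutes_cancel[OF assms])
  finally show ?thesis .
qed

lemma conv_assoc: "conv n (conv n x y) z = conv n x (conv n y z)"
proof
  fix \<tau>
  show "conv n (conv n x y) z \<tau> = conv n x (conv n y z) \<tau>"
  proof (cases "\<tau> permutes {1..n}")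
    case True
    have "conv n x (conv n y z) \<tau>
        = (\<Sum>\<sigma>\<in>Sn n. x \<sigma> * (\<Sum>\<rho>\<in>Sn n. y (inv \<sigma> \<circ> (\<tau> \<circ> inv \<rho>)) * z \<rho>))"
      unfolding conv_apply[OF True]
      by (rule sum.cong) (auto simp: conv_apply' permutes_intros True comp_assoc)
    also have "\<dots> = (\<Sum>\<rho>\<in>Sn n. (\<Sum>\<sigma>\<in>Sn n. x \<sigma> * y (inv \<sigma> \<circ> (\<tau> \<circ> inv \<rho>))) * z \<rho>)"
      unfolding sum_distrib_left sum_distrib_right mult.assoc by (rule sum.swap)
    also have "\<dots> = conv n (conv n x y) z \<tau>"
      unfolding conv_apply'[OF True]
      by (rule sum.cong) (auto simp: conv_apply permutes_intros True)
    finally show ?thesis by simp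
  qed (simp add: conv_outside)
qed

lemma conv_vscale [simp]:
  "conv n (vscale k x) y = vscale k (conv n x y)" "conv n x (vscale k y) = vscale k (conv n x y)"
  by (auto simp: conv_def fun_eq_iff sum_distrib_left algebra_simps)

lemma conv_zero [simp]: "conv n 0 y = 0" "conv n x 0 = 0"
  by (auto simp: conv_def fun_eq_iff)

lemma conv_id: "conv n x y id = (\<Sum>\<sigma>\<in>Sn n. x \<sigma> * y (inv \<sigma>))"
  by (simp add: conv_apply permutes_id)

lemma conv_unit_left:
  assumes "g permutes {1..n}" "\<tau> permutes {1..n}"
  shows "conv n (unit_vec g) x \<tau> = x (inv g \<circ> \<tau>)"
proof -
  have "conv n (unit_vec g) x \<tau> = (\<Sum>\<sigma>\<in>Sn n. if \<sigma> = g then x (inv \<sigma> \<circ> \<tau>) else 0)"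
    unfolding conv_apply[OF assms(2)] by (rule sum.cong) (auto simp: unit_vec_def)
  also have "\<dots> = x (inv g \<circ> \<tau>)"
    using assms by (subst sum.delta) auto
  finally show ?thesis .
qed

text \<open>
  The antilinear anti-automorphism extending \<open>\<sigma> \<mapsto> \<sigma>\<^sup>-\<^sup>1\<close>, that is, the adjoint for the standard Hermitian form.
\<close>

definition star :: "nat \<Rightarrow> perm vec \<Rightarrow> perm vec" where
  "star n x = (\<lambda>\<sigma>. if \<sigma> permutes {1..n} then cnj (x (inv \<sigma>)) else 0)"

lemma star_conv: "star n (conv n x y) = conv n (star n y) (star n x)"
proof
  fix \<tau> show "star n (conv n x y) \<tau> = conv n (star n y) (star n x) \<tau>"
  proof (cases "\<tau> permutes {1..n}")
    case True
    have "star n (conv n x y) \<tau> = (\<Sum>\<sigma>\<in>Sn n. cnj (x (inv \<tau> \<circ> inv \<sigma>)) * cnj (y \<sigma>))"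
      using True by (simp add: star_def conv_apply'[OF permutes_inv])
    also have "\<dots> = (\<Sum>\<sigma>\<in>Sn n. cnj (x (inv \<tau> \<circ> inv (inv \<sigma>))) * cnj (y (inv \<sigma>)))"
      by (rule sum_Sn_inv[symmetric])
    also have "\<dots> = (\<Sum>\<sigma>\<in>Sn n. star n y \<sigma> * star n x (inv \<sigma> \<circ> \<tau>))"
      by (rule sum.cong)
         (auto simp: permutes_inv_comp[OF permutes_inv True] star_def
            permutes_intros True mult.commute)
    finally show ?thesis by (simp add: conv_apply[OF True])
  qed (simp add: star_def conv_outside)
qed

lemma star_zero [simp]: "star n 0 = 0"
  by (auto simp: star_def fun_eq_iff)

lemma star_star:
  assumes "\<And>\<tau>. \<not> \<tau> permutes {1..n} \<Longrightarrow> x \<tau> = 0"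
  shows "star n (star n x) = x"
proof
  fix \<tau> show "star n (star n x) \<tau> = x \<tau>"
    using assms[of \<tau>] by (cases "\<tau> permutes {1..n}") (simp_all add: star_def permutes_inv permutes_cancel)
qed

text \<open>
  The row group and the column group of a tableau are the stabilizers of its row function and of its column function.
\<close>

definition stab :: "nat \<Rightarrow> (nat \<Rightarrow> nat) \<Rightarrow> perm set" where
  "stab n f = {p. p permutes {1..n} \<and> (\<forall>t\<in>{1..n}. f (p t) = f t)}"

definition sym_elt :: "nat \<Rightarrow> (nat \<Rightarrow> nat) \<Rightarrow> perm vec" where
  "sym_elt n f = (\<lambda>\<sigma>. if \<sigma> \<in> stab n f then 1 else 0)"

definition alt_elt :: "nat \<Rightarrow> (nat \<Rightarrow> nat) \<Rightarrow> perm vec" where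
  "alt_elt n f = (\<lambda>\<sigma>. if \<sigma> \<in> stab n f then of_int (sign \<sigma>) else 0)"

lemma stab_permutes: "p \<in> stab n f \<Longrightarrow> p permutes {1..n}"
  by (simp add: stab_def)

lemma id_stab: "id \<in> stab n f"
  by (simp add: stab_def permutes_id)

lemma comp_stab: "p \<in> stab n f \<Longrightarrow> q \<in> stab n f \<Longrightarrow> p \<circ> q \<in> stab n f"
  using permutes_in[of q "{1..n}"] by (auto simp: stab_def permutes_compose)

lemma inv_stab:
  assumes "p \<in> stab n f"
  shows "inv p \<in> stab n f"
proof -
  have p: "p permutes {1..n}" using assms by (rule stab_permutes)
  have "f (inv p t) = f t" if "t \<in> {1..n}" for t
  proof -
    have "inv p t \<in> {1..n}" using that permutes_in[OF permutes_inv[OF p]] by blast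
    then have "f (p (inv p t)) = f (inv p t)" using assms by (simp add: stab_def)
    then show ?thesis using permutes_inverses(1)[OF p] by simp
  qed
  then show ?thesis using permutes_inv[OF p] by (simp add: stab_def)
qed

lemma comp_stab_iff:
  assumes "p \<in> stab n f" "\<sigma> permutes {1..n}"
  shows "p \<circ> \<sigma> \<in> stab n f \<longleftrightarrow> \<sigma> \<in> stab n f" "\<sigma> \<circ> p \<in> stab n f \<longleftrightarrow> \<sigma> \<in> stab n f"
proof -
  have 1: "inv p \<in> stab n f" and p: "p permutes {1..n}"
    using assms inv_stab stab_permutes by auto
  show "p \<circ> \<sigma> \<in> stab n f \<longleftrightarrow> \<sigma> \<in> stab n f"
    using comp_stab[OF 1, of "p \<circ> \<sigma>"] comp_stab[OF assms(1), of \<sigma>] permutes_cancel[OF p] by metis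
  show "\<sigma> \<circ> p \<in> stab n f \<longleftrightarrow> \<sigma> \<in> stab n f"
    using comp_stab[OF _ 1, of "\<sigma> \<circ> p"] comp_stab[OF _ assms(1), of \<sigma>] permutes_cancel[OF p] by metis
qed

lemma inv_stab_iff: "\<sigma> permutes {1..n} \<Longrightarrow> inv \<sigma> \<in> stab n f \<longleftrightarrow> \<sigma> \<in> stab n f"
  using inv_stab permutes_cancel(7) by metis

lemma transpose_stab:
  assumes "s \<in> {1..n}" "t \<in> {1..n}" "f s = f t"
  shows "transpose s t \<in> stab n f"
  using assms by (auto simp: stab_def permutes_swap_id transpose_def)

lemma finite_stab [simp]: "finite (stab n f)"
  by (rule finite_subset[OF _ finite_Sn[of n]]) (auto simp: stab_def)

lemma star_sym_elt: "star n (sym_elt n f) = sym_elt n f"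
  by (auto simp: star_def sym_elt_def fun_eq_iff inv_stab_iff dest: stab_permutes)

lemma star_alt_elt: "star n (alt_elt n f) = alt_elt n f"
  by (auto simp: star_def alt_elt_def fun_eq_iff inv_stab_iff permutes_sign_inv dest: stab_permutes)

lemma conv_sym_left_inv:
  assumes "p \<in> stab n f" "\<tau> permutes {1..n}"
  shows "conv n (sym_elt n f) x (p \<circ> \<tau>) = conv n (sym_elt n f) x \<tau>"
proof -
  have p: "p permutes {1..n}" using assms(1) by (rule stab_permutes)
  have "conv n (sym_elt n f) x (p \<circ> \<tau>)
      = (\<Sum>\<sigma>\<in>Sn n. sym_elt n f (p \<circ> \<sigma>) * x (inv (p \<circ> \<sigma>) \<circ> (p \<circ> \<tau>)))"
    unfolding conv_apply[OF permutes_compose[OF assms(2) p]] by (rule sum_Sn_left[OF p, symmetric])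
  also have "\<dots> = conv n (sym_elt n f) x \<tau>"
    unfolding conv_apply[OF assms(2)]
    by (rule sum.cong)
       (auto simp: sym_elt_def comp_stab_iff[OF assms(1)] permutes_inv_comp[OF p] comp_assoc permutes_cancel[OF p])
  finally show ?thesis .
qed

lemma conv_alt_right_inv:
  assumes "q \<in> stab n f" "\<tau> permutes {1..n}"
  shows "conv n x (alt_elt n f) (\<tau> \<circ> q) = of_int (sign q) * conv n x (alt_elt n f) \<tau>"
proof -
  have q: "q permutes {1..n}" using assms(1) by (rule stab_permutes)
  show ?thesis
    unfolding conv_apply[OF permutes_compose[OF q assms(2)]] conv_apply[OF assms(2)] sum_distrib_left
  proof (rule sum.cong)
    fix \<sigma> assume "\<sigma> \<in> Sn n"
    then have "inv \<sigma> \<circ> \<tau> permutes {1..n}" by (auto intro: permutes_intros assms(2))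
    then show "x \<sigma> * alt_elt n f (inv \<sigma> \<circ> (\<tau> \<circ> q)) = of_int (sign q) * (x \<sigma> * alt_elt n f (inv \<sigma> \<circ> \<tau>))"
      using comp_stab_iff(2)[OF assms(1)]
      by (simp add: comp_assoc[symmetric] alt_elt_def permutes_sign_comp q)
  qed simp
qed

section \<open>Young symmetrizers\<close>

text \<open>
  A filling of a Young diagram by \<open>1, \<dots>, n\<close>, given by the row and the column of each entry. Distinct
  entries have distinct cells, and every column is filled from the first row on without gaps; the counting of cells
  below rests on these two properties.
\<close>

locale tableau =
  fixes n :: nat and row col :: "nat \<Rightarrow> nat"
  assumes inj_cell: "inj_on (\<lambda>t. (row t, col t)) {1..n}"
    and row_pos: "t \<in> {1..n} \<Longrightarrow> 1 \<le> row t"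
    and col_closed: "t \<in> {1..n} \<Longrightarrow> 1 \<le> i \<Longrightarrow> i \<le> row t \<Longrightarrow> \<exists>s\<in>{1..n}. row s = i \<and> col s = col t"

definition rows_upto :: "nat \<Rightarrow> (nat \<Rightarrow> nat) \<Rightarrow> nat \<Rightarrow> nat" where
  "rows_upto n row k = card {t \<in> {1..n}. row t \<le> k}"

lemma card_by_fibers:
  assumes "finite A" "f ` A \<subseteq> C" "finite C"
  shows "card A = (\<Sum>c\<in>C. card {t \<in> A. f t = c})"
proof -
  have "card A = (\<Sum>t\<in>A. 1)" by simp
  also have "\<dots> = (\<Sum>c\<in>C. \<Sum>t\<in>{t \<in> A. f t = c}. 1)"
    by (rule sum.group[symmetric]) (use assms in auto)
  finally show ?thesis by simp
qed

text \<open>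
  If column \<open>c\<close> of the second tableau reaches row \<open>k\<close>, then it has \<open>k\<close> cells in the first \<open>k\<close> rows, and the
  left-hand set injects into those rows. Otherwise the whole column lies in the first \<open>k\<close> rows, and \<open>h\<close> maps the
  left-hand set injectively into it.
\<close>

lemma column_count_le:
  assumes T: "tableau n row' col'"
    and pos: "\<And>t. t \<in> {1..n} \<Longrightarrow> 1 \<le> row t"
    and h: "h permutes {1..n}"
    and inj: "inj_on (\<lambda>t. (row t, col' (h t))) {1..n}"
  shows "card {t \<in> {1..n}. row t \<le> k \<and> col' (h t) = c} \<le> card {s \<in> {1..n}. row' s \<le> k \<and> col' s = c}"
    (is "card ?M \<le> card ?N")
proof (cases "\<exists>s\<in>{1..n}. k \<le> row' s \<and> col' s = c")
  case True
  then obtain s where s: "s \<in> {1..n}" "k \<le> row' s" "col' s = c" by auto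
  have "row ` ?M \<subseteq> {1..k}"
  proof (rule image_subsetI)
    fix t assume "t \<in> ?M"
    then show "row t \<in> {1..k}" using pos[of t] by simp
  qed
  moreover have "inj_on row ?M"
  proof (rule inj_onI)
    fix s t assume "s \<in> ?M" "t \<in> ?M" "row s = row t"
    then show "s = t" using inj_onD[OF inj, of s t] by simp
  qed
  ultimately have "card ?M \<le> k" using card_inj_on_le[of row ?M "{1..k}"] by simp
  also have "k \<le> card ?N"
  proof -
    have "{1..k} \<subseteq> row' ` ?N"
    proof
      fix i assume i: "i \<in> {1..k}"
      then have "1 \<le> i" "i \<le> row' s" using s(2) by simp_all
      then obtain u where u: "u \<in> {1..n}" "row' u = i" "col' u = col' s"
        using tableau.col_closed[OF T s(1)] by blast
      then have "u \<in> ?N" using i s(3) by simp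
      then show "i \<in> row' ` ?N" using u(2) by blast
    qed
    then have "card {1..k} \<le> card (row' ` ?N)" by (rule card_mono[rotated]) simp
    also have "\<dots> \<le> card ?N" by (rule card_image_le) simp
    finally show ?thesis by simp
  qed
  finally show ?thesis .
next
  case False
  have "h ` ?M \<subseteq> ?N"
  proof (rule image_subsetI)
    fix t assume t: "t \<in> ?M"
    then have "h t \<in> {1..n}" using permutes_in[OF h] by blast
    moreover have "\<not> k \<le> row' (h t)" using False \<open>h t \<in> {1..n}\<close> t by blast
    ultimately show "h t \<in> ?N" using t by auto
  qed
  moreover have "inj_on h ?M" using permutes_inj[OF h] by (rule inj_on_subset) simp
  ultimately show ?thesis by (intro card_inj_on_le[of h]) simp_all
qed

lemma rows_upto_by_columns:
  assumes "finite C" "g ` {1..n} \<subseteq> C"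
  shows "rows_upto n row k = (\<Sum>c\<in>C. card {t \<in> {1..n}. row t \<le> k \<and> g t = c})"
proof -
  have "rows_upto n row k = (\<Sum>c\<in>C. card {t \<in> {t \<in> {1..n}. row t \<le> k}. g t = c})"
    unfolding rows_upto_def by (rule card_by_fibers) (use assms in auto)
  also have "\<dots> = (\<Sum>c\<in>C. card {t \<in> {1..n}. row t \<le> k \<and> g t = c})"
    by (intro sum.cong arg_cong[of _ _ card]) auto
  finally show ?thesis .
qed

text \<open>
  If no two entries of a row of the first tableau are moved to the same column of the second one, then the second
  shape dominates the first: sum the previous inequality over the columns. When the shapes agree, all these
  inequalities are equalities, and the difference of the equalities for \<open>k\<close> and \<open>k - 1\<close> shows that the cell in
  row \<open>row t\<close> and column \<open>col' (h t)\<close> exists.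
\<close>

lemma
  assumes T: "tableau n row' col'"
    and pos: "\<And>t. t \<in> {1..n} \<Longrightarrow> 1 \<le> row t"
    and h: "h permutes {1..n}"
    and inj: "inj_on (\<lambda>t. (row t, col' (h t))) {1..n}"
  shows dominance: "rows_upto n row k \<le> rows_upto n row' k"
    and dominance_eq:
      "\<lbrakk>\<And>k. rows_upto n row k = rows_upto n row' k; t \<in> {1..n}\<rbrakk>
         \<Longrightarrow> \<exists>s\<in>{1..n}. row' s = row t \<and> col' s = col' (h t)"
proof -
  let ?C = "col' ` {1..n}"
  let ?M = "\<lambda>k c. card {t \<in> {1..n}. row t \<le> k \<and> col' (h t) = c}"
  let ?N = "\<lambda>k c. card {t \<in> {1..n}. row' t \<le> k \<and> col' t = c}"
  have M: "rows_upto n row k = (\<Sum>c\<in>?C. ?M k c)" for k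
    by (rule rows_upto_by_columns) (use permutes_in[OF h] in auto)
  have N: "rows_upto n row' k = (\<Sum>c\<in>?C. ?N k c)" for k
    by (rule rows_upto_by_columns) auto
  have le: "?M k c \<le> ?N k c" for k c
    by (rule column_count_le[OF T pos h inj])
  show "rows_upto n row k \<le> rows_upto n row' k"
    unfolding M N by (rule sum_mono) (rule le)
  assume eq: "\<And>k. rows_upto n row k = rows_upto n row' k" and t: "t \<in> {1..n}"
  have MN: "?M k c = ?N k c" if "c \<in> ?C" for k c
  proof (rule ccontr)
    assume "?M k c \<noteq> ?N k c"
    then have "?M k c < ?N k c" using le[of k c] by simp
    then have "(\<Sum>c\<in>?C. ?M k c) < (\<Sum>c\<in>?C. ?N k c)"
      using le that by (intro sum_strict_mono_ex1) auto
    then show False using eq[of k] unfolding M[of k] N[of k] by simp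
  qed
  let ?c = "col' (h t)" and ?k = "row t"
  have c: "?c \<in> ?C" using t permutes_in[OF h] by blast
  have k: "?k - 1 < ?k" using pos[OF t] by simp
  have "?M (?k - 1) ?c < ?M ?k ?c"
  proof (rule psubset_card_mono)
    have "t \<in> {s \<in> {1..n}. row s \<le> ?k \<and> col' (h s) = ?c}"
      "t \<notin> {s \<in> {1..n}. row s \<le> ?k - 1 \<and> col' (h s) = ?c}"
      using t k by auto
    then show "{s \<in> {1..n}. row s \<le> ?k - 1 \<and> col' (h s) = ?c} \<subset> {s \<in> {1..n}. row s \<le> ?k \<and> col' (h s) = ?c}"
      by auto
  qed simp
  then have lt: "?N (?k - 1) ?c < ?N ?k ?c" unfolding MN[OF c] .
  let ?X = "{s \<in> {1..n}. row' s \<le> ?k - 1 \<and> col' s = ?c}"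
  let ?Y = "{s \<in> {1..n}. row' s \<le> ?k \<and> col' s = ?c}"
  have "\<not> ?Y \<subseteq> ?X"
  proof
    assume "?Y \<subseteq> ?X"
    then have "card ?Y \<le> card ?X" by (rule card_mono[rotated]) simp
    with lt show False by simp
  qed
  then obtain s where s: "s \<in> {1..n}" "row' s \<le> ?k" "\<not> row' s \<le> ?k - 1" "col' s = ?c" by blast
  then have "row' s = ?k" by linarith
  with s show "\<exists>s\<in>{1..n}. row' s = row t \<and> col' s = col' (h t)" by blast
qed

text \<open>
  Two entries in the same row whose images lie in the same column give a transposition that fixes \<open>x \<tau>\<close> from the
  left and negates it from the right.
\<close>

lemma collision_zero:
  fixes x :: "perm vec"
  assumes left: "\<And>p \<tau>. p \<in> stab n f \<Longrightarrow> \<tau> permutes {1..n} \<Longrightarrow> x (p \<circ> \<tau>) = x \<tau>"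
    and right: "\<And>q \<tau>. q \<in> stab n g \<Longrightarrow> \<tau> permutes {1..n} \<Longrightarrow> x (\<tau> \<circ> q) = of_int (sign q) * x \<tau>"
    and h: "\<tau> permutes {1..n}" and nz: "x \<tau> \<noteq> 0"
  shows "inj_on (\<lambda>t. (f t, g (inv \<tau> t))) {1..n}"
proof (rule inj_onI, rule ccontr)
  fix s t assume st: "s \<in> {1..n}" "t \<in> {1..n}" "(f s, g (inv \<tau> s)) = (f t, g (inv \<tau> t))" "s \<noteq> t"
  let ?p = "transpose s t" and ?q = "transpose (inv \<tau> s) (inv \<tau> t)"
  have it: "inv \<tau> s \<in> {1..n}" "inv \<tau> t \<in> {1..n}" "inv \<tau> s \<noteq> inv \<tau> t"
    using st permutes_in[OF permutes_inv[OF h]] permutes_inj[OF permutes_inv[OF h]]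
    by (simp_all add: inj_def) blast
  have p: "?p \<in> stab n f" and q: "?q \<in> stab n g"
    using st it by (simp_all add: transpose_stab)
  have "?p \<circ> \<tau> = \<tau> \<circ> ?q"
  proof
    fix u
    have "\<tau> u = v \<longleftrightarrow> u = inv \<tau> v" for v
      using permutes_inverses[OF h] by metis
    then show "(?p \<circ> \<tau>) u = (\<tau> \<circ> ?q) u"
      by (simp add: transpose_def permutes_inverses[OF h])
  qed
  then have "x \<tau> = of_int (sign ?q) * x \<tau>" using left[OF p h] right[OF q h] by simp
  then show False using nz it(3) by (simp add: sign_swap_id)
qed

definition young :: "nat \<Rightarrow> (nat \<Rightarrow> nat) \<Rightarrow> (nat \<Rightarrow> nat) \<Rightarrow> perm vec" where
  "young n row col = conv n (sym_elt n row) (alt_elt n col)"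

text \<open>
  The scalar \<open>k\<close> with \<open>c c = k c\<close> for the Young symmetrizer \<open>c\<close>, read off at the identity because \<open>c id = 1\<close>.
\<close>

definition young_norm :: "nat \<Rightarrow> (nat \<Rightarrow> nat) \<Rightarrow> (nat \<Rightarrow> nat) \<Rightarrow> complex" where
  "young_norm n row col = conv n (young n row col) (young n row col) id"

context tableau
begin

abbreviation c :: "perm vec" where
  "c \<equiv> young n row col"

lemma c_id: "c id = 1"
proof -
  have "p = id" if p: "p \<in> stab n row" "p \<in> stab n col" for p
  proof
    fix t
    have pp: "p permutes {1..n}" using p stab_permutes by auto
    show "p t = id t"
    proof (cases "t \<in> {1..n}")
      case True
      then have "row (p t) = row t" "col (p t) = col t" using p by (auto simp: stab_def)
      moreover have "p t \<in> {1..n}" using True permutes_in[OF pp] by blast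
      ultimately show ?thesis using inj_onD[OF inj_cell, of "p t" t] True by simp
    qed (use pp in \<open>simp add: permutes_not_in\<close>)
  qed
  then have "sym_elt n row \<sigma> * alt_elt n col (inv \<sigma>) = (if \<sigma> = id then 1 else 0)"
    if "\<sigma> permutes {1..n}" for \<sigma>
    using that by (cases "\<sigma> = id") (auto simp: sym_elt_def alt_elt_def inv_stab_iff id_stab)
  then have "c id = (\<Sum>\<sigma>\<in>Sn n. if \<sigma> = id then 1 else 0)"
    unfolding young_def conv_id by (intro sum.cong) simp_all
  then show ?thesis by (simp add: permutes_id)
qed

text \<open>
  Move each entry \<open>t\<close> inside its row to the column of \<open>g\<^sup>-\<^sup>1 t\<close>. The target cell exists because the shapes on both
  sides agree, and what remains of \<open>g\<close> after this move preserves the columns.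
\<close>

lemma row_col_factor:
  assumes g: "g permutes {1..n}" and inj: "inj_on (\<lambda>t. (row t, col (inv g t))) {1..n}"
  obtains p q where "p \<in> stab n row" "q \<in> stab n col" "g = p \<circ> q"
proof -
  have ex: "\<exists>s\<in>{1..n}. row s = row t \<and> col s = col (inv g t)" if "t \<in> {1..n}" for t
    by (rule dominance_eq[OF tableau_axioms row_pos permutes_inv[OF g] inj refl that])
  define m where "m t = (if t \<in> {1..n} then SOME s. s \<in> {1..n} \<and> row s = row t \<and> col s = col (inv g t) else t)" for t
  have m: "m t \<in> {1..n} \<and> row (m t) = row t \<and> col (m t) = col (inv g t)" if "t \<in> {1..n}" for t
  proof -
    have "\<exists>s. s \<in> {1..n} \<and> row s = row t \<and> col s = col (inv g t)" using ex[OF that] by blast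
    from someI_ex[OF this] show ?thesis using that by (simp add: m_def)
  qed
  have "inj_on m {1..n}"
    using m inj unfolding inj_on_def by (metis (no_types, lifting) prod.inject)
  moreover have "m ` {1..n} \<subseteq> {1..n}" using m by blast
  ultimately have "bij_betw m {1..n} {1..n}"
    by (simp add: bij_betw_def endo_inj_surj)
  then have mp: "m permutes {1..n}"
    by (rule bij_imp_permutes) (auto simp: m_def)
  have mR: "m \<in> stab n row" using m mp by (simp add: stab_def)
  have "col (m (g s)) = col s" if "s \<in> {1..n}" for s
  proof -
    have "g s \<in> {1..n}" using that permutes_in[OF g] by blast
    then show ?thesis using m permutes_inverses(2)[OF g] by simp
  qed
  then have "m \<circ> g \<in> stab n col" using permutes_compose[OF g mp] by (simp add: stab_def)
  moreover have "g = inv m \<circ> (m \<circ> g)" using permutes_cancel[OF mp] by simp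
  ultimately show thesis using that inv_stab[OF mR] by blast
qed

lemma c_left: "p \<in> stab n row \<Longrightarrow> \<tau> permutes {1..n} \<Longrightarrow> c (p \<circ> \<tau>) = c \<tau>"
  unfolding young_def by (rule conv_sym_left_inv)

lemma c_right: "q \<in> stab n col \<Longrightarrow> \<tau> permutes {1..n} \<Longrightarrow> c (\<tau> \<circ> q) = of_int (sign q) * c \<tau>"
  unfolding young_def by (rule conv_alt_right_inv)

text \<open>
  Von Neumann's lemma: a function with the symmetries of the Young symmetrizer is determined by its value at the
  identity on products of a row and a column permutation, and all other permutations have a collision.
\<close>

lemma multiple_of_c:
  assumes left: "\<And>p \<tau>. p \<in> stab n row \<Longrightarrow> \<tau> permutes {1..n} \<Longrightarrow> x (p \<circ> \<tau>) = x \<tau>"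
    and right: "\<And>q \<tau>. q \<in> stab n col \<Longrightarrow> \<tau> permutes {1..n} \<Longrightarrow> x (\<tau> \<circ> q) = of_int (sign q) * x \<tau>"
    and out: "\<And>\<tau>. \<not> \<tau> permutes {1..n} \<Longrightarrow> x \<tau> = 0"
  shows "x = vscale (x id) c"
proof
  fix g
  show "x g = vscale (x id) c g"
  proof (cases "g permutes {1..n}")
    case g: True
    show ?thesis
    proof (cases "inj_on (\<lambda>t. (row t, col (inv g t))) {1..n}")
      case True
      then obtain p q where pq: "p \<in> stab n row" "q \<in> stab n col" "g = p \<circ> q"
        using row_col_factor[OF g] by blast
      then have q: "q permutes {1..n}" by (simp add: stab_permutes)
      show ?thesis
        using left[OF pq(1) q] right[OF pq(2) permutes_id] c_left[OF pq(1) q] c_right[OF pq(2) permutes_id]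
        by (simp add: pq(3) c_id)
    next
      case False
      then have "x g = 0" "c g = 0"
        using collision_zero[of n row x col g] collision_zero[of n row c col g] left right c_left c_right g
        by blast+
      then show ?thesis by simp
    qed
  next
    case False
    then show ?thesis using out by (simp add: young_def conv_outside)
  qed
qed

lemma c_conv_c: "conv n c (conv n x c) = vscale (conv n c (conv n x c) id) c"
proof -
  let ?z = "conv n (alt_elt n col) (conv n x (sym_elt n row))"
  have eq: "conv n c (conv n x c) = conv n (sym_elt n row) (conv n ?z (alt_elt n col))"
    by (simp add: young_def conv_assoc)
  then have eq': "conv n c (conv n x c) = conv n (conv n (sym_elt n row) ?z) (alt_elt n col)"
    by (simp add: conv_assoc)
  show ?thesis
  proof (rule multiple_of_c)
    fix p \<tau> assume "p \<in> stab n row" "\<tau> permutes {1..n}"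
    then show "conv n c (conv n x c) (p \<circ> \<tau>) = conv n c (conv n x c) \<tau>"
      unfolding eq by (rule conv_sym_left_inv)
  next
    fix q \<tau> assume "q \<in> stab n col" "\<tau> permutes {1..n}"
    then show "conv n c (conv n x c) (\<tau> \<circ> q) = of_int (sign q) * conv n c (conv n x c) \<tau>"
      unfolding eq' by (rule conv_alt_right_inv)
  qed (simp add: conv_outside)
qed

lemma conv_unit_id:
  assumes "\<And>\<tau>. \<not> \<tau> permutes {1..n} \<Longrightarrow> x \<tau> = 0"
  shows "conv n (unit_vec id) x = x"
proof
  fix \<tau> show "conv n (unit_vec id) x \<tau> = x \<tau>"
    using assms by (cases "\<tau> permutes {1..n}") (auto simp: conv_unit_left permutes_id conv_outside)
qed

lemma young_outside: "\<not> \<tau> permutes {1..n} \<Longrightarrow> c \<tau> = 0"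
  by (simp add: young_def conv_outside)

lemma young_square: "conv n c c = vscale (young_norm n row col) c"
  using c_conv_c[of "unit_vec id"] by (simp add: conv_unit_id young_outside young_norm_def)

end

lemma sym_elt_square: "conv n (sym_elt n f) (conv n (sym_elt n f) x) = vscale (of_nat (card (stab n f))) (conv n (sym_elt n f) x)"
proof
  fix \<tau>
  show "conv n (sym_elt n f) (conv n (sym_elt n f) x) \<tau>
    = vscale (of_nat (card (stab n f))) (conv n (sym_elt n f) x) \<tau>"
  proof (cases "\<tau> permutes {1..n}")
    case True
    have "conv n (sym_elt n f) (conv n (sym_elt n f) x) \<tau>
        = (\<Sum>\<sigma>\<in>Sn n. if \<sigma> \<in> stab n f then conv n (sym_elt n f) x (inv \<sigma> \<circ> \<tau>) else 0)"
      unfolding conv_apply[OF True] by (rule sum.cong) (auto simp: sym_elt_def)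
    also have "\<dots> = (\<Sum>\<sigma>\<in>Sn n. if \<sigma> \<in> stab n f then conv n (sym_elt n f) x \<tau> else 0)"
      by (rule sum.cong) (auto simp: conv_sym_left_inv[OF inv_stab True])
    also have "\<dots> = (\<Sum>\<sigma>\<in>stab n f. conv n (sym_elt n f) x \<tau>)"
      by (rule sum.mono_neutral_cong_right) (auto dest: stab_permutes)
    finally show ?thesis by simp
  qed (simp add: conv_outside)
qed

lemma alt_elt_square: "conv n (alt_elt n f) (conv n (alt_elt n f) x) = vscale (of_nat (card (stab n f))) (conv n (alt_elt n f) x)"
proof -
  have aa: "conv n (alt_elt n f) (alt_elt n f) = vscale (of_nat (card (stab n f))) (alt_elt n f)"
  proof
    fix \<tau>
    show "conv n (alt_elt n f) (alt_elt n f) \<tau> = vscale (of_nat (card (stab n f))) (alt_elt n f) \<tau>"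
    proof (cases "\<tau> permutes {1..n}")
      case True
      have *: "alt_elt n f \<sigma> * alt_elt n f (inv \<sigma> \<circ> \<tau>) = (if \<sigma> \<in> stab n f then alt_elt n f \<tau> else 0)"
        if "\<sigma> \<in> Sn n" for \<sigma>
      proof -
        have s: "\<sigma> permutes {1..n}" using that by simp
        have "of_int (sign \<sigma>) * of_int (sign (inv \<sigma> \<circ> \<tau>)) = (of_int (sign \<tau>) :: complex)"
          unfolding permutes_sign_comp[OF permutes_inv[OF s] True] permutes_sign_inv[OF s] by simp
        then show ?thesis
          using comp_stab_iff(1)[OF inv_stab True, of \<sigma>] by (simp add: alt_elt_def)
      qed
      have "conv n (alt_elt n f) (alt_elt n f) \<tau> = (\<Sum>\<sigma>\<in>Sn n. if \<sigma> \<in> stab n f then alt_elt n f \<tau> else 0)"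
        unfolding conv_apply[OF True] by (rule sum.cong[OF refl *])
      also have "\<dots> = (\<Sum>\<sigma>\<in>stab n f. alt_elt n f \<tau>)"
        by (rule sum.mono_neutral_cong_right) (auto dest: stab_permutes)
      finally show ?thesis by simp
    qed (auto simp: conv_outside alt_elt_def dest: stab_permutes)
  qed
  show ?thesis unfolding conv_assoc[symmetric] aa by simp
qed

lemma stab_card_pos: "card (stab n f) \<noteq> 0"
  using id_stab[of n f] by auto

context tableau
begin

text \<open>
  With \<open>a\<close> and \<open>b\<close> the row symmetrizer and the column antisymmetrizer, \<open>d = a b a\<close> is self-adjoint, and \<open>d d\<close> is
  proportional to \<open>(a b a b) a = k (a b a)\<close>. If \<open>k = 0\<close>, then \<open>d d = 0\<close> and positivity gives \<open>d = 0\<close>; but \<open>d\<close> is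
  proportional to \<open>c c\<^sup>*\<close>, so again by positivity \<open>c = 0\<close>.
\<close>

lemma young_norm_nonzero: "young_norm n row col \<noteq> 0"
proof
  assume k: "young_norm n row col = 0"
  let ?a = "sym_elt n row" and ?b = "alt_elt n col"
  define d where "d = conv n ?a (conv n ?b ?a)"
  have star_d: "star n d = d"
    by (simp add: d_def star_conv star_sym_elt star_alt_elt conv_assoc)
  have cc: "conv n ?a (conv n ?b (conv n ?a ?b)) = 0"
  proof -
    have "conv n c c = 0" unfolding young_square k by (simp add: fun_eq_iff)
    then show ?thesis by (simp add: young_def conv_assoc)
  qed
  have "conv n d d = vscale (of_nat (card (stab n row))) (conv n (conv n ?a (conv n ?b (conv n ?a ?b))) ?a)"
    by (simp add: d_def conv_assoc sym_elt_square)
  then have "conv n d d id = 0" unfolding cc by simp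
  moreover have "conv n d d id = (\<Sum>\<sigma>\<in>Sn n. of_real ((cmod (d \<sigma>))\<^sup>2))"
    unfolding conv_id
  proof (rule sum.cong)
    fix \<sigma> assume "\<sigma> \<in> Sn n"
    then have "star n d (inv \<sigma>) = cnj (d \<sigma>)"
      by (simp add: star_def permutes_inv permutes_cancel)
    then have "d (inv \<sigma>) = cnj (d \<sigma>)" unfolding star_d .
    then show "d \<sigma> * d (inv \<sigma>) = of_real ((cmod (d \<sigma>))\<^sup>2)"
      by (simp only: complex_norm_square)
  qed simp
  ultimately have "(\<Sum>\<sigma>\<in>Sn n. (cmod (d \<sigma>))\<^sup>2) = 0"
    by (simp flip: of_real_sum of_real_power)
  then have "d id = 0" by (subst (asm) sum_nonneg_eq_0_iff) (auto simp: permutes_id)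
  moreover have "of_nat (card (stab n col)) * d id = (\<Sum>\<sigma>\<in>Sn n. of_real ((cmod (c \<sigma>))\<^sup>2))"
  proof -
    have "vscale (of_nat (card (stab n col))) d = conv n c (star n c)"
      unfolding young_def star_conv star_sym_elt star_alt_elt
      by (simp add: d_def conv_assoc alt_elt_square)
    from fun_cong[OF this, of id] have "of_nat (card (stab n col)) * d id = conv n c (star n c) id"
      by simp
    also have "\<dots> = (\<Sum>\<sigma>\<in>Sn n. of_real ((cmod (c \<sigma>))\<^sup>2))"
      unfolding conv_id complex_norm_square
      by (rule sum.cong) (simp_all add: star_def permutes_inv permutes_cancel)
    finally show ?thesis .
  qed
  ultimately have "(\<Sum>\<sigma>\<in>Sn n. (cmod (c \<sigma>))\<^sup>2) = 0"
    by (simp flip: of_real_sum of_real_power)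
  then have "c id = 0" by (subst (asm) sum_nonneg_eq_0_iff) (auto simp: permutes_id)
  then show False by (simp add: c_id)
qed

lemma cnj_young: "cnj (c \<sigma>) = c \<sigma>"
proof (cases "\<sigma> permutes {1..n}")
  case True
  have "cnj (sym_elt n f \<tau>) = sym_elt n f \<tau>" "cnj (alt_elt n f \<tau>) = alt_elt n f \<tau>" for f \<tau>
    by (simp_all add: sym_elt_def alt_elt_def)
  then show ?thesis unfolding young_def conv_apply[OF True] by simp
qed (simp add: young_outside)

lemma cnj_young_norm: "cnj (young_norm n row col) = young_norm n row col"
  unfolding young_norm_def conv_id by (simp add: cnj_young)

text \<open>
  The adjoint of \<open>(a b) (a b) = k (a b)\<close>; the coefficients of \<open>c\<close>, and with them \<open>k\<close>, are real.
\<close>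

lemma reversed_young_square:
  "conv n (conv n (alt_elt n col) (sym_elt n row)) (conv n (alt_elt n col) (sym_elt n row))
     = vscale (young_norm n row col) (conv n (alt_elt n col) (sym_elt n row))"
proof -
  have sc: "star n c = conv n (alt_elt n col) (sym_elt n row)"
    by (simp add: young_def star_conv star_sym_elt star_alt_elt)
  have "star n (conv n c c) = star n (vscale (young_norm n row col) c)"
    by (simp add: young_square)
  moreover have "star n (vscale (young_norm n row col) c) = vscale (young_norm n row col) (star n c)"
    by (auto simp: star_def fun_eq_iff cnj_young_norm)
  ultimately show ?thesis by (simp add: star_conv sc)
qed

end

text \<open>
  In \<open>a\<^sub>1 b\<^sub>1 x a\<^sub>2 b\<^sub>2\<close> the part \<open>a\<^sub>1 \<dots> b\<^sub>2\<close> can be nonzero only if the second shape dominates the first, and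
  \<open>b\<^sub>1 x a\<^sub>2\<close>, whose adjoint is of the same kind with the roles exchanged, only if the first dominates the second.
\<close>

lemma young_orthogonal:
  assumes T1: "tableau n row1 col1" and T2: "tableau n row2 col2"
    and ne: "rows_upto n row1 \<noteq> rows_upto n row2"
  shows "conv n (young n row1 col1) (conv n x (young n row2 col2)) = 0"
proof -
  let ?a1 = "sym_elt n row1" and ?b1 = "alt_elt n col1"
  let ?a2 = "sym_elt n row2" and ?b2 = "alt_elt n col2"
  let ?w = "conv n ?b1 (conv n x ?a2)"
  have le: "rows_upto n rowA k \<le> rows_upto n rowB k"
    if A: "tableau n rowA colA" and B: "tableau n rowB colB"
      and nz: "conv n (sym_elt n rowA) (conv n z (alt_elt n colB)) \<noteq> 0"
    for rowA colA rowB colB z k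
  proof -
    let ?y = "conv n (sym_elt n rowA) (conv n z (alt_elt n colB))"
    obtain \<tau> where \<tau>: "?y \<tau> \<noteq> 0" using nz unfolding fun_eq_iff zero_fun_apply by blast
    have \<tau>p: "\<tau> permutes {1..n}" by (rule ccontr) (use \<tau> conv_outside in blast)
    have "inj_on (\<lambda>t. (rowA t, colB (inv \<tau> t))) {1..n}"
    proof (rule collision_zero[where x = ?y, OF _ _ \<tau>p \<tau>])
      fix p \<rho> assume p: "p \<in> stab n rowA" "\<rho> permutes {1..n}"
      show "?y (p \<circ> \<rho>) = ?y \<rho>" by (rule conv_sym_left_inv[OF p])
    next
      fix q \<rho> assume q: "q \<in> stab n colB" "\<rho> permutes {1..n}"
      show "?y (\<rho> \<circ> q) = of_int (sign q) * ?y \<rho>"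
        unfolding conv_assoc[symmetric] by (rule conv_alt_right_inv[OF q])
    qed
    from dominance[OF B tableau.row_pos[OF A] permutes_inv[OF \<tau>p] this] show ?thesis .
  qed
  show ?thesis
  proof (rule ccontr)
    assume "conv n (young n row1 col1) (conv n x (young n row2 col2)) \<noteq> 0"
    then have nz: "conv n ?a1 (conv n ?w ?b2) \<noteq> 0"
      by (simp add: young_def conv_assoc)
    then have "?w \<noteq> 0" by auto
    moreover have "star n (star n ?w) = ?w"
      by (rule star_star) (rule conv_outside)
    ultimately have "star n ?w \<noteq> 0" by (metis star_zero)
    then have "conv n ?a2 (conv n (star n x) ?b1) \<noteq> 0"
      by (simp add: star_conv star_sym_elt star_alt_elt conv_assoc)
    then have "rows_upto n row2 k \<le> rows_upto n row1 k" for k by (rule le[OF T2 T1])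
    moreover have "rows_upto n row1 k \<le> rows_upto n row2 k" for k by (rule le[OF T1 T2 nz])
    ultimately have "rows_upto n row1 = rows_upto n row2" by (intro ext antisym)
    with ne show False ..
  qed
qed

text \<open>
  The sum of all conjugates of a function. For a Young symmetrizer \<open>c\<close> it is, up to a scalar, the character of
  the irreducible representation generated by \<open>c\<close>.
\<close>

definition class_sum :: "nat \<Rightarrow> perm vec \<Rightarrow> perm vec" where
  "class_sum n x = (\<lambda>\<tau>. if \<tau> permutes {1..n} then \<Sum>g\<in>Sn n. x (inv g \<circ> \<tau> \<circ> g) else 0)"

lemma class_sum_pairing:
  "(\<Sum>\<sigma>\<in>Sn n. class_sum n x (inv \<sigma>) * y \<sigma>) = (\<Sum>g\<in>Sn n. conv n y (conv n (unit_vec g) x) g)"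
proof -
  have "(\<Sum>\<sigma>\<in>Sn n. class_sum n x (inv \<sigma>) * y \<sigma>)
      = (\<Sum>\<sigma>\<in>Sn n. \<Sum>g\<in>Sn n. x (inv g \<circ> inv \<sigma> \<circ> g) * y \<sigma>)"
    by (rule sum.cong) (auto simp: class_sum_def permutes_inv sum_distrib_right)
  also have "\<dots> = (\<Sum>g\<in>Sn n. \<Sum>\<sigma>\<in>Sn n. x (inv g \<circ> inv \<sigma> \<circ> g) * y \<sigma>)"
    by (rule sum.swap)
  also have "\<dots> = (\<Sum>g\<in>Sn n. conv n y (conv n (unit_vec g) x) g)"
  proof (rule sum.cong)
    fix g assume "g \<in> Sn n"
    then have g: "g permutes {1..n}" by simp
    show "(\<Sum>\<sigma>\<in>Sn n. x (inv g \<circ> inv \<sigma> \<circ> g) * y \<sigma>) = conv n y (conv n (unit_vec g) x) g"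
      unfolding conv_apply[OF g, of y]
      by (rule sum.cong) (simp_all add: conv_unit_left[OF g] permutes_intros g comp_assoc mult.commute)
  qed simp
  finally show ?thesis .
qed

lemma class_sum_young_orthogonal:
  assumes "tableau n row1 col1" "tableau n row2 col2" "rows_upto n row1 \<noteq> rows_upto n row2"
  shows "(\<Sum>\<sigma>\<in>Sn n. class_sum n (young n row1 col1) (inv \<sigma>) * young n row2 col2 \<sigma>) = 0"
  unfolding class_sum_pairing using young_orthogonal[OF assms(2,1)] assms(3) by simp

text \<open>
  By \<open>c g c = (c g c) id \<cdot> c\<close>, the sum of \<open>(c g c) g\<close> over \<open>g\<close> is the value at the identity of \<open>c (\<Sum> c g \<cdot> g) c = c c c\<close>.
\<close>

lemma (in tableau) class_sum_young_norm:
  "(\<Sum>\<sigma>\<in>Sn n. class_sum n c (inv \<sigma>) * c \<sigma>) = (young_norm n row col)\<^sup>2"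
proof -
  have "(\<Sum>g\<in>Sn n. conv n c (conv n (unit_vec g) c) g)
      = (\<Sum>g\<in>Sn n. (\<Sum>\<sigma>\<in>Sn n. c \<sigma> * c (inv g \<circ> inv \<sigma>)) * c g)"
  proof (rule sum.cong)
    fix g assume "g \<in> Sn n"
    then have g: "g permutes {1..n}" by simp
    have "conv n c (conv n (unit_vec g) c) g = conv n c (conv n (unit_vec g) c) id * c g"
      using c_conv_c[of "unit_vec g"] by (metis vscale_apply)
    also have "conv n c (conv n (unit_vec g) c) id = (\<Sum>\<sigma>\<in>Sn n. c \<sigma> * c (inv g \<circ> inv \<sigma>))"
      unfolding conv_id by (rule sum.cong) (auto simp: conv_unit_left g permutes_intros)
    finally show "conv n c (conv n (unit_vec g) c) g = (\<Sum>\<sigma>\<in>Sn n. c \<sigma> * c (inv g \<circ> inv \<sigma>)) * c g" .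
  qed simp
  also have "\<dots> = (\<Sum>g\<in>Sn n. \<Sum>\<sigma>\<in>Sn n. c \<sigma> * (c g * c (inv g \<circ> inv \<sigma>)))"
    unfolding sum_distrib_right by (intro sum.cong refl) simp
  also have "\<dots> = (\<Sum>\<sigma>\<in>Sn n. \<Sum>g\<in>Sn n. c \<sigma> * (c g * c (inv g \<circ> inv \<sigma>)))"
    by (rule sum.swap)
  also have "\<dots> = conv n c (conv n c c) id"
    unfolding conv_id sum_distrib_left[symmetric]
    by (rule sum.cong) (auto simp: conv_apply permutes_intros)
  also have "\<dots> = (young_norm n row col)\<^sup>2"
    by (simp add: young_square c_id power2_eq_square)
  finally show ?thesis unfolding class_sum_pairing .
qed

section \<open>Cycle types and class functions\<close>

definition cyclic_along :: "(nat \<Rightarrow> nat) \<Rightarrow> nat list \<Rightarrow> bool" where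
  "cyclic_along \<sigma> c \<longleftrightarrow> (\<forall>i<length c. \<sigma> (c ! i) = c ! (Suc i mod length c))"

text \<open>
  Induction on \<open>S\<close>, removing one cycle at a time. Asking that \<open>\<sigma>\<close> maps \<open>S\<close> onto itself, and not that it permutes \<open>S\<close>,
  keeps \<open>\<sigma>\<close> the same in the induction.
\<close>

lemma cycle_lists_exist:
  assumes "permutation \<sigma>" "finite S" "\<sigma> ` S = S"
  shows "\<exists>cs. distinct (concat cs) \<and> set (concat cs) = S \<and> [] \<notin> set cs \<and> (\<forall>c\<in>set cs. cyclic_along \<sigma> c)"
  using assms(2,3)
proof (induction "card S" arbitrary: S rule: less_induct)
  case less
  show ?case
  proof (cases "S = {}")
    case True
    then show ?thesis by (intro exI[of _ "[]"]) simp
  next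
    case False
    then obtain a where a: "a \<in> S" by auto
    define c where "c = support \<sigma> a"
    let ?k = "least_power \<sigma> a"
    have k: "(\<sigma> ^^ ?k) a = a" "?k > 0" using least_power_of_permutation[OF assms(1)] by auto
    have len: "length c = ?k" by (simp add: c_def)
    have nth: "c ! i = (\<sigma> ^^ i) a" if "i < ?k" for i using that by (simp add: c_def)
    have step: "cyclic_along \<sigma> c"
      unfolding cyclic_along_def len
    proof (intro allI impI)
      fix i assume i: "i < ?k"
      show "\<sigma> (c ! i) = c ! (Suc i mod ?k)"
      proof (cases "Suc i = ?k")
        case True
        then have "\<sigma> ((\<sigma> ^^ i) a) = a" using k by (metis comp_apply funpow.simps(2))
        then show ?thesis using i True k nth[OF i] nth[of 0] by simp
      next
        case False
        then show ?thesis using i nth[OF i] nth[of "Suc i"] by simp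
      qed
    qed
    have powS: "(\<sigma> ^^ i) a \<in> S" for i
      using a less.prems(2) by (induction i) auto
    have cS: "set c \<subseteq> S" using powS by (auto simp: c_def)
    have "\<sigma> ` set c \<subseteq> set c"
    proof
      fix x assume "x \<in> \<sigma> ` set c"
      then obtain i where "i < ?k" "x = \<sigma> (c ! i)" by (auto simp: in_set_conv_nth len)
      then have "x = c ! (Suc i mod ?k)" using step by (simp add: cyclic_along_def len)
      then show "x \<in> set c" using k(2) by (simp add: len)
    qed
    moreover have inj: "inj \<sigma>" using assms(1) by (meson bij_is_inj permutation_bijective)
    ultimately have ic: "\<sigma> ` set c = set c"
      by (intro endo_inj_surj) (auto intro: inj_on_subset)
    have "\<sigma> ` (S - set c) = S - set c"
      by (simp add: image_set_diff[OF inj] less.prems(2) ic)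
    moreover have "card (S - set c) < card S"
    proof (rule psubset_card_mono[OF less.prems(1)])
      have "c ! 0 \<in> set c" using k(2) by (intro nth_mem) (simp add: len)
      then have "a \<in> set c" using nth[of 0] k(2) by simp
      then show "S - set c \<subset> S" using a by auto
    qed
    ultimately obtain cs where cs: "distinct (concat cs)" "set (concat cs) = S - set c" "[] \<notin> set cs"
      "\<forall>c\<in>set cs. cyclic_along \<sigma> c"
      using less.hyps[of "S - set c"] less.prems(1) by blast
    have "distinct c" using cycle_of_permutation[OF assms(1)] by (simp add: c_def)
    moreover have "c \<noteq> []" using len k(2) by auto
    ultimately show ?thesis
      using cs cS step by (intro exI[of _ "c # cs"]) auto
  qed
qed

definition has_cycle_type :: "(nat \<Rightarrow> nat) \<Rightarrow> nat set \<Rightarrow> nat list \<Rightarrow> bool" where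
  "has_cycle_type \<sigma> S ls \<longleftrightarrow>
     (\<exists>cs. distinct (concat cs) \<and> set (concat cs) = S \<and> (\<forall>c\<in>set cs. cyclic_along \<sigma> c) \<and> map length cs = ls)"

lemma cycle_type_exists:
  assumes "\<sigma> permutes {1..n}"
  shows "\<exists>ls\<in>partitions_of n. has_cycle_type \<sigma> {1..n} ls"
proof -
  have "permutation \<sigma>" using assms by (auto simp: permutation_permutes)
  then obtain cs where cs: "distinct (concat cs)" "set (concat cs) = {1..n}" "[] \<notin> set cs"
      "\<forall>c\<in>set cs. cyclic_along \<sigma> c"
    using cycle_lists_exist[of \<sigma> "{1..n}"] permutes_image[OF assms] by auto
  let ?ds = "rev (sort_key length cs)"
  have dcs: "distinct cs"
    using cs(1,3) by (simp add: distinct_concat_iff)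
  have d: "distinct (concat ?ds)"
    using cs(1,3) dcs unfolding distinct_concat_iff by (simp add: distinct_remove1_removeAll)
  have s: "set (concat ?ds) = {1..n}" using cs(2) by simp
  have "map length ?ds \<in> partitions_of n"
  proof -
    have "sum_list (map length ?ds) = card (set (concat ?ds))"
      using distinct_card[OF d] by (metis length_concat)
    then have "sum_list (map length ?ds) = n" unfolding s by simp
    moreover have "sorted_wrt (\<ge>) (map length ?ds)"
      by (simp add: rev_map[symmetric] sorted_wrt_rev)
    moreover have "0 \<notin> set (map length ?ds)" using cs(3) by auto
    ultimately show ?thesis by (simp add: partitions_of_def)
  qed
  moreover have "has_cycle_type \<sigma> {1..n} (map length ?ds)"
    unfolding has_cycle_type_def using d s cs(4) by (intro exI[of _ ?ds]) auto
  ultimately show ?thesis by blast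
qed

text \<open>
  Two lists of cycles with equal lengths are matched entry by entry, and the matching intertwines the two permutations.
\<close>

lemma same_cycle_type_conjugate:
  assumes \<sigma>: "\<sigma> permutes {1..n}" and \<tau>: "\<tau> permutes {1..n}"
    and "has_cycle_type \<sigma> {1..n} ls" "has_cycle_type \<tau> {1..n} ls"
  obtains h where "h permutes {1..n}" "h \<circ> \<sigma> = \<tau> \<circ> h"
proof -
  obtain cs where cs: "distinct (concat cs)" "set (concat cs) = {1..n}"
      "\<forall>c\<in>set cs. cyclic_along \<sigma> c" "map length cs = ls"
    using assms by (auto simp: has_cycle_type_def)
  obtain ds where ds: "distinct (concat ds)" "set (concat ds) = {1..n}"
      "\<forall>c\<in>set ds. cyclic_along \<tau> c" "map length ds = ls"
    using assms by (auto simp: has_cycle_type_def)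
  let ?C = "concat cs" and ?D = "concat ds"
  have len: "length ?C = length ?D" using cs(4) ds(4) by (simp add: length_concat)
  define h where "h x = (if x \<in> {1..n} then the (map_of (zip ?C ?D) x) else x)" for x
  have h: "h (?C ! i) = ?D ! i" if "i < length ?C" for i
  proof -
    have "?C ! i \<in> {1..n}" using that cs(2) nth_mem by blast
    then show ?thesis using that len cs(1) by (simp add: h_def map_of_zip_nth)
  qed
  have hC: "map h ?C = ?D" by (rule nth_equalityI) (simp_all add: len h)
  have "h ` {1..n} = {1..n}" using hC cs(2) ds(2) by (metis set_map)
  then have hp: "h permutes {1..n}"
    by (intro bij_imp_permutes) (auto simp: bij_betw_def h_def intro: eq_card_imp_inj_on)
  have "concat (map (map h) cs) = concat ds" using hC by (simp add: map_concat)
  then have maps: "map (map h) cs = ds"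
  proof (rule concat_injective)
    show "length (map (map h) cs) = length ds" using cs(4) ds(4) by (metis length_map)
    have "length (cs ! i) = length (ds ! i)" if "i < length cs" "i < length ds" for i
      using that cs(4) ds(4) by (metis nth_map)
    then show "\<forall>(x, y)\<in>set (zip (map (map h) cs) ds). length x = length y"
      by (auto simp: set_zip)
  qed
  have "h (\<sigma> x) = \<tau> (h x)" for x
  proof (cases "x \<in> {1..n}")
    case True
    then have "x \<in> set ?C" using cs(2) by blast
    then obtain c where c: "c \<in> set cs" "x \<in> set c" unfolding set_concat by blast
    then obtain i where i: "i < length c" "x = c ! i" by (auto simp: in_set_conv_nth)
    have m: "Suc i mod length c < length c" using i by (intro mod_less_divisor) auto
    have "map h c \<in> set ds" using c maps by auto
    then have "\<tau> (map h c ! i) = map h c ! (Suc i mod length c)"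
      using ds(3) i by (auto simp: cyclic_along_def)
    then have "\<tau> (h x) = h (c ! (Suc i mod length c))" using i m by simp
    then show ?thesis using cs(3) c i by (auto simp: cyclic_along_def)
  next
    case False
    then show ?thesis using \<sigma> \<tau> hp by (simp add: permutes_not_in)
  qed
  then have "h \<circ> \<sigma> = \<tau> \<circ> h" by (simp add: fun_eq_iff)
  then show thesis by (rule that[OF hp])
qed

definition class_fun :: "nat \<Rightarrow> perm vec \<Rightarrow> bool" where
  "class_fun n x \<longleftrightarrow> (\<forall>\<sigma> g. \<sigma> permutes {1..n} \<longrightarrow> g permutes {1..n} \<longrightarrow> x (inv g \<circ> \<sigma> \<circ> g) = x \<sigma>)"

lemma class_funD:
  "class_fun n x \<Longrightarrow> \<sigma> permutes {1..n} \<Longrightarrow> g permutes {1..n} \<Longrightarrow> x (inv g \<circ> \<sigma> \<circ> g) = x \<sigma>"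
  by (simp add: class_fun_def)

lemma finite_partitions_of: "finite (partitions_of n)"
proof (rule finite_subset)
  show "partitions_of n \<subseteq> {xs. set xs \<subseteq> {..n} \<and> length xs \<le> n}"
  proof
    fix \<eta> assume \<eta>: "\<eta> \<in> partitions_of n"
    have "length \<eta> \<le> sum_list \<eta>" if "0 \<notin> set \<eta>" for \<eta> :: "nat list"
      using that by (induction \<eta>) auto
    then have "length \<eta> \<le> n" using \<eta> by (auto simp: partitions_of_def)
    moreover have "set \<eta> \<subseteq> {..n}" using \<eta> member_le_sum_list by (auto simp: partitions_of_def)
    ultimately show "\<eta> \<in> {xs. set xs \<subseteq> {..n} \<and> length xs \<le> n}" by simp
  qed
  show "finite {xs. set xs \<subseteq> {..n} \<and> length xs \<le> n}"
    by (rule finite_lists_length_le) simp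
qed

text \<open>
  A class function is a combination of the indicator functions of the cycle types, of which there are at most as many
  as partitions. This upper bound is what makes the Young symmetrizers account for all irreducible representations.
\<close>

lemma class_functions_span:
  obtains E where "finite E" "card E \<le> card (partitions_of n)"
    "\<And>x. class_fun n x \<Longrightarrow> (\<And>\<sigma>. \<not> \<sigma> permutes {1..n} \<Longrightarrow> x \<sigma> = 0) \<Longrightarrow> x \<in> cvec.span E"
proof
  define ty where "ty \<sigma> = (SOME ls. ls \<in> partitions_of n \<and> has_cycle_type \<sigma> {1..n} ls)" for \<sigma>
  define e :: "nat list \<Rightarrow> perm vec" where "e ls = (\<lambda>\<sigma>. if \<sigma> permutes {1..n} \<and> ty \<sigma> = ls then 1 else 0)" for ls
  define rep where "rep ls = (SOME \<sigma>. \<sigma> permutes {1..n} \<and> ty \<sigma> = ls)" for ls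
  have ty: "ty \<sigma> \<in> partitions_of n \<and> has_cycle_type \<sigma> {1..n} (ty \<sigma>)" if "\<sigma> permutes {1..n}" for \<sigma>
    unfolding ty_def by (rule someI_ex) (use cycle_type_exists[OF that] in blast)
  let ?E = "e ` partitions_of n"
  show "finite ?E" "card ?E \<le> card (partitions_of n)"
    using finite_partitions_of by (auto intro: card_image_le)
  fix x assume x: "class_fun n x" and out: "\<And>\<sigma>. \<not> \<sigma> permutes {1..n} \<Longrightarrow> x \<sigma> = 0"
  have const: "x (rep (ty \<sigma>)) = x \<sigma>" if \<sigma>: "\<sigma> permutes {1..n}" for \<sigma>
  proof -
    have "\<exists>\<sigma>'. \<sigma>' permutes {1..n} \<and> ty \<sigma>' = ty \<sigma>" using \<sigma> by blast
    from someI_ex[OF this] have rep: "rep (ty \<sigma>) permutes {1..n} \<and> ty (rep (ty \<sigma>)) = ty \<sigma>"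
      by (simp add: rep_def)
    then have "has_cycle_type (rep (ty \<sigma>)) {1..n} (ty \<sigma>)" using ty by metis
    then obtain h where h: "h permutes {1..n}" "h \<circ> \<sigma> = rep (ty \<sigma>) \<circ> h"
      using same_cycle_type_conjugate[OF \<sigma>] rep ty[OF \<sigma>] by blast
    have "x (inv h \<circ> rep (ty \<sigma>) \<circ> h) = x (rep (ty \<sigma>))"
      by (rule class_funD[OF x]) (use rep h in auto)
    moreover have "inv h \<circ> rep (ty \<sigma>) \<circ> h = \<sigma>"
      unfolding comp_assoc h(2)[symmetric] using permutes_cancel[OF h(1)] by simp
    ultimately show ?thesis by simp
  qed
  have "x = (\<Sum>ls\<in>partitions_of n. vscale (x (rep ls)) (e ls))"
  proof
    fix \<sigma>
    show "x \<sigma> = (\<Sum>ls\<in>partitions_of n. vscale (x (rep ls)) (e ls)) \<sigma>"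
    proof (cases "\<sigma> permutes {1..n}")
      case True
      have "(\<Sum>ls\<in>partitions_of n. vscale (x (rep ls)) (e ls)) \<sigma>
          = (\<Sum>ls\<in>partitions_of n. if ls = ty \<sigma> then x (rep ls) else 0)"
        unfolding sum_fun_apply by (rule sum.cong) (use True in \<open>auto simp: e_def\<close>)
      also have "\<dots> = x \<sigma>" using ty[OF True] finite_partitions_of const[OF True] by simp
      finally show ?thesis by simp
    next
      case False
      then show ?thesis using out by (simp add: sum_fun_apply e_def)
    qed
  qed
  also have "\<dots> \<in> cvec.span ?E"
    by (intro cvec.span_sum cvec.span_scale cvec.span_base imageI)
  finally show "x \<in> cvec.span ?E" .
qed

section \<open>The standard filling of a Young diagram\<close>

lemma part_Suc: "part \<eta> (Suc i) = (if i < length \<eta> then \<eta> ! i else 0)"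
  by (simp add: part_def One_nat_def Suc_le_eq)

definition rows_len :: "nat list \<Rightarrow> nat \<Rightarrow> nat" where
  "rows_len \<eta> i = (\<Sum>j=1..i. part \<eta> j)"

lemma rows_len_0 [simp]: "rows_len \<eta> 0 = 0"
  by (simp add: rows_len_def)

lemma rows_len_Suc: "rows_len \<eta> (Suc i) = rows_len \<eta> i + part \<eta> (Suc i)"
  by (simp add: rows_len_def)

lemma rows_len_mono: "i \<le> j \<Longrightarrow> rows_len \<eta> i \<le> rows_len \<eta> j"
  unfolding rows_len_def by (rule sum_mono2) auto

lemma rows_len_all:
  assumes "length \<eta> \<le> i"
  shows "rows_len \<eta> i = sum_list \<eta>"
proof -
  have "rows_len \<eta> (length \<eta>) = (\<Sum>j<length \<eta>. part \<eta> (Suc j))"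
    unfolding rows_len_def by (metis One_nat_def atLeast0AtMost atLeast1_atMost_eq_remove0 sum.atLeast1_atMost_eq)
  also have "\<dots> = (\<Sum>j<length \<eta>. \<eta> ! j)"
    by (rule sum.cong) (auto simp: part_def)
  also have "\<dots> = sum_list \<eta>" by (simp add: sum_list_sum_nth atLeast0LessThan)
  finally have "rows_len \<eta> (length \<eta>) = sum_list \<eta>" .
  moreover have "rows_len \<eta> i = rows_len \<eta> (length \<eta>)"
    unfolding rows_len_def by (rule sum.mono_neutral_right) (use assms in \<open>auto simp: part_def\<close>)
  ultimately show ?thesis by simp
qed

lemma rows_len_le: "rows_len \<eta> i \<le> sum_list \<eta>"
proof (cases "length \<eta> \<le> i")
  case True then show ?thesis by (simp add: rows_len_all)
next
  case False
  then show ?thesis using rows_len_mono[of i "length \<eta>" \<eta>] by (simp add: rows_len_all)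
qed

lemma tab_row_altdef: "tab_row \<eta> t = (LEAST i. t \<le> rows_len \<eta> i)"
  by (simp add: tab_row_def rows_len_def)

text \<open>
  The entries of the first \<open>k\<close> rows are an initial segment of \<open>1, \<dots>, n\<close>; all properties of the standard filling
  follow from this.
\<close>

lemma tab_row_le_iff:
  assumes "t \<le> sum_list \<eta>"
  shows "tab_row \<eta> t \<le> k \<longleftrightarrow> t \<le> rows_len \<eta> k"
proof
  have "t \<le> rows_len \<eta> (length \<eta>)" using assms by (simp add: rows_len_all)
  then have "t \<le> rows_len \<eta> (tab_row \<eta> t)"
    unfolding tab_row_altdef by (rule LeastI)
  moreover assume "tab_row \<eta> t \<le> k"
  ultimately show "t \<le> rows_len \<eta> k" using rows_len_mono order_trans by blast
next
  assume "t \<le> rows_len \<eta> k"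
  then show "tab_row \<eta> t \<le> k" unfolding tab_row_altdef by (rule Least_le)
qed

lemma tab_col_altdef: "1 \<le> tab_row \<eta> t \<Longrightarrow> tab_col \<eta> t = t - rows_len \<eta> (tab_row \<eta> t - 1)"
  unfolding tab_col_def rows_len_def
  by (rule arg_cong[where f = "\<lambda>x. t - x"], rule sum.cong) auto

lemma
  assumes "t \<in> {1..sum_list \<eta>}"
  shows tab_row_pos: "1 \<le> tab_row \<eta> t"
    and tab_col_pos: "1 \<le> tab_col \<eta> t"
    and tab_col_le: "tab_col \<eta> t \<le> part \<eta> (tab_row \<eta> t)"
    and tab_decompose: "t = rows_len \<eta> (tab_row \<eta> t - 1) + tab_col \<eta> t"
proof -
  have t: "1 \<le> t" "t \<le> sum_list \<eta>" using assms by auto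
  let ?i = "tab_row \<eta> t"
  have "\<not> ?i \<le> 0" unfolding tab_row_le_iff[OF t(2)] using t(1) by simp
  then show i: "1 \<le> ?i" by simp
  have "\<not> ?i \<le> ?i - 1" using i by simp
  then have lt: "rows_len \<eta> (?i - 1) < t" unfolding tab_row_le_iff[OF t(2)] by simp
  have "t \<le> rows_len \<eta> ?i" using tab_row_le_iff[OF t(2), of ?i] by simp
  also have "\<dots> = rows_len \<eta> (?i - 1) + part \<eta> ?i"
    using rows_len_Suc[of \<eta> "?i - 1"] i by simp
  finally have le: "t \<le> rows_len \<eta> (?i - 1) + part \<eta> ?i" .
  show "1 \<le> tab_col \<eta> t" "tab_col \<eta> t \<le> part \<eta> ?i" "t = rows_len \<eta> (?i - 1) + tab_col \<eta> t"
    using lt le by (auto simp: tab_col_altdef[OF i])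
qed

lemma
  assumes "1 \<le> i" "1 \<le> j" "j \<le> part \<eta> i"
  shows cell_in_range: "rows_len \<eta> (i - 1) + j \<in> {1..sum_list \<eta>}"
    and tab_row_cell: "tab_row \<eta> (rows_len \<eta> (i - 1) + j) = i"
    and tab_col_cell: "tab_col \<eta> (rows_len \<eta> (i - 1) + j) = j"
proof -
  let ?t = "rows_len \<eta> (i - 1) + j"
  have le: "?t \<le> rows_len \<eta> i" using rows_len_Suc[of \<eta> "i - 1"] assms by simp
  have t: "?t \<le> sum_list \<eta>" using le rows_len_le[of \<eta> i] by simp
  then show "?t \<in> {1..sum_list \<eta>}" using assms by simp
  have "tab_row \<eta> ?t \<le> i" "\<not> tab_row \<eta> ?t \<le> i - 1"
    unfolding tab_row_le_iff[OF t] using le assms by auto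
  then show r: "tab_row \<eta> ?t = i" by simp
  show "tab_col \<eta> ?t = j" using tab_col_altdef[of \<eta> ?t] assms(1) by (simp add: r)
qed

lemma part_antimono:
  assumes "sorted_wrt (\<ge>) \<eta>" "1 \<le> i" "i \<le> j"
  shows "part \<eta> j \<le> part \<eta> i"
  using assms by (cases "i = j") (auto simp: part_def sorted_wrt_iff_nth_less)

lemma tableau_of_partition:
  assumes "\<eta> \<in> partitions_of n"
  shows "tableau n (tab_row \<eta>) (tab_col \<eta>)"
proof
  have n: "n = sum_list \<eta>" and sorted: "sorted_wrt (\<ge>) \<eta>"
    using assms by (auto simp: partitions_of_def)
  show "inj_on (\<lambda>t. (tab_row \<eta> t, tab_col \<eta> t)) {1..n}"
  proof (rule inj_onI)
    fix s t assume "s \<in> {1..n}" "t \<in> {1..n}" "(tab_row \<eta> s, tab_col \<eta> s) = (tab_row \<eta> t, tab_col \<eta> t)"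
    then show "s = t" using tab_decompose[of s \<eta>] tab_decompose[of t \<eta>] unfolding n by simp
  qed
  fix t assume t: "t \<in> {1..n}"
  then show "1 \<le> tab_row \<eta> t" using tab_row_pos n by simp
  fix i assume i: "1 \<le> i" "i \<le> tab_row \<eta> t"
  let ?j = "tab_col \<eta> t"
  have "1 \<le> ?j" "?j \<le> part \<eta> i"
    using t tab_col_pos[of t \<eta>] tab_col_le[of t \<eta>] part_antimono[OF sorted i] unfolding n by auto
  then show "\<exists>s\<in>{1..n}. tab_row \<eta> s = i \<and> tab_col \<eta> s = ?j"
    using cell_in_range[OF i(1)] tab_row_cell[OF i(1)] tab_col_cell[OF i(1)] n by blast
qed

lemma rows_upto_tab_row:
  assumes "n = sum_list \<eta>"
  shows "rows_upto n (tab_row \<eta>) = rows_len \<eta>"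
proof
  fix k
  have "{t \<in> {1..n}. tab_row \<eta> t \<le> k} = {1..rows_len \<eta> k}"
    using rows_len_le[of \<eta> k] assms by (auto simp: tab_row_le_iff)
  then show "rows_upto n (tab_row \<eta>) k = rows_len \<eta> k" by (simp add: rows_upto_def)
qed

lemma partition_eq_if_rows_len_eq:
  assumes "0 \<notin> set \<eta>" "0 \<notin> set \<zeta>" "rows_len \<eta> = rows_len \<zeta>"
  shows "\<eta> = \<zeta>"
proof -
  have p: "part \<eta> (Suc i) = part \<zeta> (Suc i)" for i
    using rows_len_Suc[of \<eta> i] rows_len_Suc[of \<zeta> i] assms(3) by simp
  have nz: "part \<theta> (Suc i) \<noteq> 0 \<longleftrightarrow> i < length \<theta>" if "0 \<notin> set \<theta>" for \<theta> i
  proof (cases "i < length \<theta>")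
    case True
    then have "\<theta> ! i \<noteq> 0" using that nth_mem[OF True] by metis
    then show ?thesis using True by (simp add: part_def)
  qed (simp add: part_def)
  have iff: "i < length \<eta> \<longleftrightarrow> i < length \<zeta>" for i
    using nz[OF assms(1)] nz[OF assms(2)] p by metis
  then have "length \<eta> = length \<zeta>" by (metis linorder_neqE_nat less_irrefl)
  moreover have "\<eta> ! i = \<zeta> ! i" if "i < length \<eta>" for i
    using p[of i] that iff[of i] by (simp add: part_Suc)
  ultimately show ?thesis by (rule nth_equalityI)
qed

lemma rows_upto_inj:
  assumes "\<eta> \<in> partitions_of n" "\<zeta> \<in> partitions_of n" "\<eta> \<noteq> \<zeta>"
  shows "rows_upto n (tab_row \<eta>) \<noteq> rows_upto n (tab_row \<zeta>)"
  using assms partition_eq_if_rows_len_eq[of \<eta> \<zeta>] rows_upto_tab_row[of n \<eta>] rows_upto_tab_row[of n \<zeta>]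
  by (auto simp: partitions_of_def)

lemma young_symmetrizer_eq_young:
  assumes "n = sum_list \<eta>"
  shows "young_symmetrizer \<eta> = young n (tab_row \<eta>) (tab_col \<eta>)"
proof
  fix \<tau>
  let ?R = "stab n (tab_row \<eta>)" and ?C = "stab n (tab_col \<eta>)"
  have RC: "row_group \<eta> = ?R" "col_group \<eta> = ?C"
    by (auto simp: row_group_def col_group_def stab_def assms)
  have inner: "(\<Sum>q\<in>?C. if p \<circ> q = \<tau> then of_int (sign q) else 0) = alt_elt n (tab_col \<eta>) (inv p \<circ> \<tau>)"
    if "p \<in> ?R" for p
  proof -
    have "p permutes {1..n}" using that by (rule stab_permutes)
    then have iff: "p \<circ> q = \<tau> \<longleftrightarrow> q = inv p \<circ> \<tau>" for q using permutes_cancel by metis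
    show ?thesis unfolding iff alt_elt_def by simp
  qed
  show "young_symmetrizer \<eta> \<tau> = young n (tab_row \<eta>) (tab_col \<eta>) \<tau>"
  proof (cases "\<tau> permutes {1..n}")
    case True
    have "young_symmetrizer \<eta> \<tau> = (\<Sum>p\<in>?R. alt_elt n (tab_col \<eta>) (inv p \<circ> \<tau>))"
      unfolding young_symmetrizer_def RC by (rule sum.cong) (simp_all add: inner)
    also have "\<dots> = young n (tab_row \<eta>) (tab_col \<eta>) \<tau>"
      unfolding young_def conv_apply[OF True]
      by (rule sum.mono_neutral_cong_left) (auto simp: sym_elt_def dest: stab_permutes)
    finally show ?thesis .
  next
    case False
    have "p \<circ> q \<noteq> \<tau>" if "p \<in> ?R" "q \<in> ?C" for p q
      using that False permutes_comp stab_permutes by metis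
    then have "young_symmetrizer \<eta> \<tau> = 0"
      unfolding young_symmetrizer_def RC by (intro sum.neutral ballI) auto
    then show ?thesis using False by (simp add: young_def conv_outside)
  qed
qed

section \<open>Orthogonality and completeness\<close>

text \<open>
  The normalizing scalar of the Young symmetrizer is classically the product of the hook lengths.
\<close>

abbreviation hook_prod :: "nat list \<Rightarrow> complex" where
  "hook_prod \<eta> \<equiv> young_norm (sum_list \<eta>) (tab_row \<eta>) (tab_col \<eta>)"

definition pairing :: "nat \<Rightarrow> perm vec \<Rightarrow> perm vec \<Rightarrow> complex" where
  "pairing n x y = (\<Sum>\<sigma>\<in>Sn n. x \<sigma> * y \<sigma>)"

lemma class_fun_class_sum: "class_fun n (class_sum n x)"
  unfolding class_fun_def
proof (intro allI impI)
  fix \<sigma> g assume p: "\<sigma> permutes {1..n}" "g permutes {1..n}"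
  have "class_sum n x (inv g \<circ> \<sigma> \<circ> g) = (\<Sum>h\<in>Sn n. x (inv (g \<circ> h) \<circ> \<sigma> \<circ> (g \<circ> h)))"
    unfolding class_sum_def
    by (simp add: p permutes_intros, rule sum.cong) (simp_all add: p permutes_inv_comp[OF p(2)] comp_assoc)
  also have "\<dots> = (\<Sum>h\<in>Sn n. x (inv h \<circ> \<sigma> \<circ> h))"
    by (rule sum_Sn_left[OF p(2)])
  finally show "class_sum n x (inv g \<circ> \<sigma> \<circ> g) = class_sum n x \<sigma>"
    using p by (simp add: class_sum_def)
qed

lemma pairing_class_sum:
  assumes "class_fun n x"
  shows "pairing n x (class_sum n y) = fact n * pairing n x y"
proof -
  have "pairing n x (class_sum n y) = (\<Sum>\<sigma>\<in>Sn n. \<Sum>g\<in>Sn n. x \<sigma> * y (inv g \<circ> \<sigma> \<circ> g))"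
    unfolding pairing_def by (rule sum.cong) (auto simp: class_sum_def sum_distrib_left)
  also have "\<dots> = (\<Sum>g\<in>Sn n. \<Sum>\<sigma>\<in>Sn n. x \<sigma> * y (inv g \<circ> \<sigma> \<circ> g))"
    by (rule sum.swap)
  also have "\<dots> = (\<Sum>g\<in>Sn n. pairing n x y)"
  proof (rule sum.cong)
    fix g assume "g \<in> Sn n"
    then have g: "g permutes {1..n}" by simp
    have "(\<Sum>\<sigma>\<in>Sn n. x \<sigma> * y (inv g \<circ> \<sigma> \<circ> g)) = (\<Sum>\<sigma>\<in>Sn n. x (inv g \<circ> \<sigma> \<circ> g) * y (inv g \<circ> \<sigma> \<circ> g))"
      by (rule sum.cong) (simp_all add: class_funD[OF assms _ g])
    also have "\<dots> = (\<Sum>\<sigma>\<in>Sn n. x (\<sigma> \<circ> g) * y (\<sigma> \<circ> g))"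
      using sum_Sn_left[OF permutes_inv[OF g], of "\<lambda>\<sigma>. x (\<sigma> \<circ> g) * y (\<sigma> \<circ> g)"] by (simp add: comp_assoc)
    also have "\<dots> = pairing n x y"
      unfolding pairing_def by (rule sum_Sn_right[OF g, of "\<lambda>\<sigma>. x \<sigma> * y \<sigma>"])
    finally show "(\<Sum>\<sigma>\<in>Sn n. x \<sigma> * y (inv g \<circ> \<sigma> \<circ> g)) = pairing n x y" .
  qed simp
  also have "\<dots> = fact n * pairing n x y"
    using card_permutations[of "{1..n}" n] by simp
  finally show ?thesis .
qed

lemma independent_max_spans:
  assumes "cvec.independent A" "A \<subseteq> cvec.span B" "finite B" "card B \<le> card A" "x \<in> cvec.span B"
  shows "x \<in> cvec.span A"
proof (rule ccontr)
  assume x: "x \<notin> cvec.span A"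
  then have "cvec.independent (insert x A)" using assms(1) by (rule cvec.independent_insertI)
  then have "finite (insert x A) \<and> card (insert x A) \<le> card B"
    using assms by (intro cvec.independent_span_bound) auto
  moreover have "x \<notin> A" using x cvec.span_base by blast
  ultimately show False using assms(4) by auto
qed

text \<open>
  The conjugate sums of the Young symmetrizers are orthogonal for the pairing, with nonzero norms, and there are as many
  of them as partitions; hence they span the class functions. Expanding \<open>y\<close> in them and pairing with \<open>c\<^sub>\<eta>\<close> yields the
  coefficients, and pairing the expansion with \<open>x\<close> yields the identity. For the characters \<open>x\<close> and \<open>y\<close> of two
  representations it computes the dimension of the invariants of their tensor product from the multiplicities of
  the irreducible representations.
\<close>

theorem young_parseval:
  assumes x: "class_fun n x" and y: "class_fun n y"
    and y_inv: "\<And>\<sigma>. \<sigma> permutes {1..n} \<Longrightarrow> y (inv \<sigma>) = y \<sigma>"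
  shows "pairing n x y = fact n * (\<Sum>\<eta>\<in>partitions_of n.
    (pairing n x (young_symmetrizer \<eta>) / hook_prod \<eta>) * (pairing n y (young_symmetrizer \<eta>) / hook_prod \<eta>))"
proof -
  let ?P = "partitions_of n"
  \<comment> \<open>Up to normalization, the irreducible characters.\<close>
  define z where "z \<eta> = class_sum n (young_symmetrizer \<eta>)" for \<eta>
  have n: "sum_list \<eta> = n" if "\<eta> \<in> ?P" for \<eta> using that by (simp add: partitions_of_def)
  have k: "hook_prod \<eta> \<noteq> 0" if "\<eta> \<in> ?P" for \<eta>
    using tableau.young_norm_nonzero[OF tableau_of_partition[OF that]] n[OF that] by simp
  have pair: "(\<Sum>\<sigma>\<in>Sn n. z \<zeta> (inv \<sigma>) * young_symmetrizer \<eta> \<sigma>)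
      = (if \<eta> = \<zeta> then (hook_prod \<eta>)\<^sup>2 else 0)" if "\<eta> \<in> ?P" "\<zeta> \<in> ?P" for \<eta> \<zeta>
    using class_sum_young_orthogonal[OF tableau_of_partition[OF that(2)] tableau_of_partition[OF that(1)]]
      tableau.class_sum_young_norm[OF tableau_of_partition[OF that(1)]] rows_upto_inj[OF that] n that
    by (auto simp: z_def young_symmetrizer_eq_young)
  have lin: "(\<Sum>\<sigma>\<in>Sn n. (\<Sum>\<zeta>\<in>?P. \<beta> \<zeta> * z \<zeta> (inv \<sigma>)) * young_symmetrizer \<eta> \<sigma>) = \<beta> \<eta> * (hook_prod \<eta>)\<^sup>2"
    if \<eta>: "\<eta> \<in> ?P" for \<eta> \<beta>
  proof -
    have "(\<Sum>\<sigma>\<in>Sn n. (\<Sum>\<zeta>\<in>?P. \<beta> \<zeta> * z \<zeta> (inv \<sigma>)) * young_symmetrizer \<eta> \<sigma>)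
        = (\<Sum>\<sigma>\<in>Sn n. \<Sum>\<zeta>\<in>?P. \<beta> \<zeta> * (z \<zeta> (inv \<sigma>) * young_symmetrizer \<eta> \<sigma>))"
      by (simp add: sum_distrib_right mult.assoc)
    also have "\<dots> = (\<Sum>\<zeta>\<in>?P. \<Sum>\<sigma>\<in>Sn n. \<beta> \<zeta> * (z \<zeta> (inv \<sigma>) * young_symmetrizer \<eta> \<sigma>))"
      by (rule sum.swap)
    also have "\<dots> = (\<Sum>\<zeta>\<in>?P. if \<zeta> = \<eta> then \<beta> \<eta> * (hook_prod \<eta>)\<^sup>2 else 0)"
      unfolding sum_distrib_left[symmetric] by (rule sum.cong) (auto simp: pair[OF \<eta>])
    finally show ?thesis using \<eta> finite_partitions_of by simp
  qed
  have inj: "inj_on z ?P"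
  proof (rule inj_onI)
    fix \<eta> \<zeta> assume "\<eta> \<in> ?P" "\<zeta> \<in> ?P" "z \<eta> = z \<zeta>"
    then have "(if \<eta> = \<zeta> then (hook_prod \<eta>)\<^sup>2 else 0) = (hook_prod \<eta>)\<^sup>2"
      using pair[of \<eta> \<eta>] pair[of \<eta> \<zeta>] by simp
    then show "\<eta> = \<zeta>" using k[OF \<open>\<eta> \<in> ?P\<close>] by (metis zero_eq_power2)
  qed
  have ind: "cvec.independent (z ` ?P)"
  proof (rule cvec.independent_if_scalars_zero)
    fix f v assume f: "(\<Sum>v\<in>z ` ?P. vscale (f v) v) = 0" and v: "v \<in> z ` ?P"
    then obtain \<eta> where \<eta>: "\<eta> \<in> ?P" "v = z \<eta>" by auto
    have "(\<Sum>\<zeta>\<in>?P. vscale (f (z \<zeta>)) (z \<zeta>)) = 0" using f by (simp add: sum.reindex[OF inj])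
    from fun_cong[OF this] have "(\<Sum>\<zeta>\<in>?P. f (z \<zeta>) * z \<zeta> \<sigma>) = 0" for \<sigma>
      by (simp add: sum_fun_apply)
    then have "f (z \<eta>) * (hook_prod \<eta>)\<^sup>2 = 0"
      using lin[OF \<eta>(1), of "\<lambda>\<zeta>. f (z \<zeta>)"] by simp
    then show "f v = 0" using k[OF \<eta>(1)] \<eta>(2) by simp
  qed (simp add: finite_partitions_of)
  obtain E where E: "finite E" "card E \<le> card ?P"
    "\<And>x. class_fun n x \<Longrightarrow> (\<And>\<sigma>. \<not> \<sigma> permutes {1..n} \<Longrightarrow> x \<sigma> = 0) \<Longrightarrow> x \<in> cvec.span E"
    using class_functions_span by blast
  define y' where "y' = (\<lambda>\<sigma>. if \<sigma> permutes {1..n} then y \<sigma> else 0)"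
  have "y' \<in> cvec.span E"
  proof (rule E(3))
    show "class_fun n y'"
      using class_funD[OF y] by (simp add: class_fun_def y'_def permutes_intros)
  qed (simp add: y'_def)
  moreover have "z ` ?P \<subseteq> cvec.span E"
  proof (rule image_subsetI)
    fix \<eta>
    show "z \<eta> \<in> cvec.span E"
      unfolding z_def by (rule E(3)[OF class_fun_class_sum]) (simp add: class_sum_def)
  qed
  moreover have "card (z ` ?P) = card ?P" by (rule card_image[OF inj])
  ultimately have "y' \<in> cvec.span (z ` ?P)"
    using independent_max_spans[OF ind _ E(1), of y'] E(2) by simp
  then obtain f where "y' = (\<Sum>v\<in>z ` ?P. vscale (f v) v)"
    unfolding cvec.span_finite[OF finite_imageI[OF finite_partitions_of]] by blast
  then have y': "y' = (\<Sum>\<zeta>\<in>?P. vscale (f (z \<zeta>)) (z \<zeta>))" by (simp add: sum.reindex[OF inj])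
  define \<beta> where "\<beta> \<zeta> = f (z \<zeta>)" for \<zeta>
  have yz: "y \<sigma> = (\<Sum>\<zeta>\<in>?P. \<beta> \<zeta> * z \<zeta> \<sigma>)" if "\<sigma> permutes {1..n}" for \<sigma>
    using fun_cong[OF y', of \<sigma>] that by (simp add: y'_def sum_fun_apply \<beta>_def)
  have \<beta>: "\<beta> \<eta> = pairing n y (young_symmetrizer \<eta>) / (hook_prod \<eta>)\<^sup>2" if \<eta>: "\<eta> \<in> ?P" for \<eta>
  proof -
    have "pairing n y (young_symmetrizer \<eta>)
        = (\<Sum>\<sigma>\<in>Sn n. (\<Sum>\<zeta>\<in>?P. \<beta> \<zeta> * z \<zeta> (inv \<sigma>)) * young_symmetrizer \<eta> \<sigma>)"
      unfolding pairing_def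
      by (rule sum.cong) (auto simp: yz[symmetric] permutes_inv y_inv)
    then show ?thesis using lin[OF \<eta>, of \<beta>] k[OF \<eta>] by simp
  qed
  have "pairing n x y = (\<Sum>\<sigma>\<in>Sn n. \<Sum>\<zeta>\<in>?P. \<beta> \<zeta> * (x \<sigma> * z \<zeta> \<sigma>))"
    unfolding pairing_def by (rule sum.cong) (auto simp: yz sum_distrib_left mult_ac)
  also have "\<dots> = (\<Sum>\<zeta>\<in>?P. \<Sum>\<sigma>\<in>Sn n. \<beta> \<zeta> * (x \<sigma> * z \<zeta> \<sigma>))"
    by (rule sum.swap)
  also have "\<dots> = (\<Sum>\<zeta>\<in>?P. \<beta> \<zeta> * pairing n x (z \<zeta>))"
    unfolding sum_distrib_left[symmetric] pairing_def ..
  also have "\<dots> = (\<Sum>\<zeta>\<in>?P. fact n * ((pairing n x (young_symmetrizer \<zeta>) / hook_prod \<zeta>)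
      * (pairing n y (young_symmetrizer \<zeta>) / hook_prod \<zeta>)))"
    by (rule sum.cong) (simp_all add: \<beta> z_def pairing_class_sum[OF x] power2_eq_square)
  finally show ?thesis by (simp add: sum_distrib_left)
qed

section \<open>Monomial representations\<close>

text \<open>
  The group acts on the basis \<open>X\<close> from the right by \<open>move\<close> and on coefficient functions from the left, twisted by the
  linear character \<open>\<epsilon>\<close>. This covers words, parking functions twisted by the sign, their products, and antisymmetric
  tensors, all with the same formulas for traces.
\<close>

locale monomial_rep =
  fixes n :: nat and X :: "'x set" and move :: "'x \<Rightarrow> perm \<Rightarrow> 'x" and \<epsilon> :: "perm \<Rightarrow> complex"
  assumes finX: "finite X"
    and move_closed: "x \<in> X \<Longrightarrow> \<sigma> permutes {1..n} \<Longrightarrow> move x \<sigma> \<in> X"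
    and move_id: "move x id = x"
    and move_comp: "move (move x \<sigma>) \<tau> = move x (\<sigma> \<circ> \<tau>)"
    and \<epsilon>_id: "\<epsilon> id = 1"
    and \<epsilon>_comp: "\<sigma> permutes {1..n} \<Longrightarrow> \<tau> permutes {1..n} \<Longrightarrow> \<epsilon> (\<sigma> \<circ> \<tau>) = \<epsilon> \<sigma> * \<epsilon> \<tau>"
    and \<epsilon>_inv: "\<sigma> permutes {1..n} \<Longrightarrow> \<epsilon> (inv \<sigma>) = \<epsilon> \<sigma>"
begin

definition act :: "perm \<Rightarrow> 'x vec \<Rightarrow> 'x vec" where
  "act \<sigma> T = (\<lambda>x. \<epsilon> \<sigma> * T (move x \<sigma>))"

definition alg :: "perm vec \<Rightarrow> 'x vec \<Rightarrow> 'x vec" where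
  "alg u T = (\<lambda>x. \<Sum>\<sigma>\<in>Sn n. u \<sigma> * act \<sigma> T x)"

definition character :: "perm vec" where
  "character = (\<lambda>\<sigma>. \<epsilon> \<sigma> * of_nat (card {x \<in> X. move x \<sigma> = x}))"

lemma move_inj_iff:
  assumes "\<sigma> permutes {1..n}"
  shows "move x \<sigma> = y \<longleftrightarrow> x = move y (inv \<sigma>)"
  using move_comp[of x \<sigma> "inv \<sigma>"] move_comp[of y "inv \<sigma>" \<sigma>] move_id permutes_cancel(1,2)[OF assms]
  by metis

lemma move_in_iff:
  assumes "\<sigma> permutes {1..n}"
  shows "move x \<sigma> \<in> X \<longleftrightarrow> x \<in> X"
  using move_closed[OF _ assms] move_closed[OF _ permutes_inv[OF assms]] move_inj_iff[OF assms]
  by metis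

lemma clinear_alg: "clinear (alg u)"
  by (rule clinearI)
     (auto simp: alg_def act_def fun_eq_iff algebra_simps sum.distrib sum_distrib_left)

lemma alg_supp: 
  assumes "T \<in> supp_on X"
  shows "alg u T \<in> supp_on X"
  unfolding supp_on_def alg_def act_def
proof (intro CollectI allI impI sum.neutral ballI)
  fix x \<sigma> assume "x \<notin> X" "\<sigma> \<in> Sn n"
  then have "T (move x \<sigma>) = 0" using supp_onD[OF assms] move_in_iff by blast
  then show "u \<sigma> * (\<epsilon> \<sigma> * T (move x \<sigma>)) = 0" by simp
qed

lemma act_comp:
  "\<sigma> permutes {1..n} \<Longrightarrow> \<tau> permutes {1..n} \<Longrightarrow> act \<sigma> (act \<tau> T) = act (\<sigma> \<circ> \<tau>) T"
  by (simp add: act_def move_comp \<epsilon>_comp mult.assoc)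

lemma act_alg:
  assumes "\<sigma> permutes {1..n}"
  shows "act \<sigma> (alg u T) x = (\<Sum>\<tau>\<in>Sn n. u (inv \<sigma> \<circ> \<tau>) * act \<tau> T x)"
proof -
  have "act \<sigma> (alg u T) x = (\<Sum>\<tau>\<in>Sn n. u \<tau> * act (\<sigma> \<circ> \<tau>) T x)"
  proof -
    have "act \<sigma> (alg u T) x = (\<Sum>\<tau>\<in>Sn n. u \<tau> * act \<sigma> (act \<tau> T) x)"
      by (simp add: act_def alg_def sum_distrib_left mult_ac)
    also have "\<dots> = (\<Sum>\<tau>\<in>Sn n. u \<tau> * act (\<sigma> \<circ> \<tau>) T x)"
      by (rule sum.cong) (simp_all add: act_comp[OF assms])
    finally show ?thesis .
  qed
  also have "\<dots> = (\<Sum>\<tau>\<in>Sn n. u (inv \<sigma> \<circ> (\<sigma> \<circ> \<tau>)) * act (\<sigma> \<circ> \<tau>) T x)"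
    by (simp add: permutes_cancel[OF assms])
  also have "\<dots> = (\<Sum>\<tau>\<in>Sn n. u (inv \<sigma> \<circ> \<tau>) * act \<tau> T x)"
    by (rule sum_Sn_left[OF assms])
  finally show ?thesis .
qed

lemma alg_conv: "alg u (alg v T) = alg (conv n u v) T"
proof
  fix x
  have "alg u (alg v T) x = (\<Sum>\<sigma>\<in>Sn n. \<Sum>\<tau>\<in>Sn n. u \<sigma> * (v (inv \<sigma> \<circ> \<tau>) * act \<tau> T x))"
    unfolding alg_def[of u] by (rule sum.cong) (simp_all add: act_alg sum_distrib_left)
  also have "\<dots> = (\<Sum>\<tau>\<in>Sn n. \<Sum>\<sigma>\<in>Sn n. u \<sigma> * (v (inv \<sigma> \<circ> \<tau>) * act \<tau> T x))"
    by (rule sum.swap)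
  also have "\<dots> = alg (conv n u v) T x"
    unfolding alg_def by (rule sum.cong) (auto simp: conv_apply sum_distrib_right mult.assoc)
  finally show "alg u (alg v T) x = alg (conv n u v) T x" .
qed

lemma alg_vscale: "alg (vscale k u) T = vscale k (alg u T)"
  by (auto simp: alg_def fun_eq_iff sum_distrib_left mult.assoc)

lemma trace_alg: "(\<Sum>x\<in>X. alg u (unit_vec x) x) = pairing n u character"
proof -
  have "(\<Sum>x\<in>X. alg u (unit_vec x) x)
      = (\<Sum>\<sigma>\<in>Sn n. \<Sum>x\<in>X. u \<sigma> * (\<epsilon> \<sigma> * (if move x \<sigma> = x then 1 else 0)))"
    unfolding alg_def act_def unit_vec_def by (rule sum.swap)
  also have "\<dots> = pairing n u character"
    unfolding pairing_def character_def sum_distrib_left[symmetric]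
    by (simp add: sum.If_cases[OF finX] Int_def)
  finally show ?thesis .
qed

text \<open>
  The trace of the action of a group algebra element is its pairing with the character, and for quasi-idempotent
  elements it gives the rank.
\<close>

lemma dim_alg_image:
  assumes "conv n u u = vscale k u" "k \<noteq> 0"
  shows "k * of_nat (cvec.dim (alg u ` supp_on X)) = pairing n u character"
  unfolding trace_alg[symmetric]
  by (rule trace_quasi_idempotent[OF finX clinear_alg])
     (simp_all add: alg_supp alg_conv assms alg_vscale)

lemma class_fun_character: "class_fun n character"
  unfolding class_fun_def
proof (intro allI impI)
  fix \<sigma> g assume p: "\<sigma> permutes {1..n}" "g permutes {1..n}"
  let ?A = "{x \<in> X. move x (inv g \<circ> \<sigma> \<circ> g) = x}" and ?B = "{x \<in> X. move x \<sigma> = x}"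
  have "bij_betw (\<lambda>x. move x (inv g)) ?A ?B"
  proof (rule bij_betw_byWitness[where f' = "\<lambda>x. move x g"])
    show "\<forall>x\<in>?A. move (move x (inv g)) g = x" "\<forall>x\<in>?B. move (move x g) (inv g) = x"
      by (simp_all add: move_comp permutes_cancel[OF p(2)] move_id)
    show "(\<lambda>x. move x (inv g)) ` ?A \<subseteq> ?B"
    proof (rule image_subsetI)
      fix x assume x: "x \<in> ?A"
      have "(inv g \<circ> \<sigma> \<circ> g) \<circ> inv g = inv g \<circ> \<sigma>"
        by (rule permutes_cancel(6)[OF p(2)])
      then have "move (move x (inv g)) \<sigma> = move (move x (inv g \<circ> \<sigma> \<circ> g)) (inv g)"
        unfolding move_comp by simp
      then show "move x (inv g) \<in> ?B" using x move_closed[OF _ permutes_inv[OF p(2)]] by simp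
    qed
    show "(\<lambda>x. move x g) ` ?B \<subseteq> ?A"
    proof (rule image_subsetI)
      fix x assume x: "x \<in> ?B"
      have "move (move x g) (inv g \<circ> \<sigma> \<circ> g) = move (move x \<sigma>) g"
        by (simp add: move_comp comp_assoc permutes_cancel[OF p(2)])
      then show "move x g \<in> ?A" using x move_closed[OF _ p(2)] by simp
    qed
  qed
  then have "card ?A = card ?B" by (rule bij_betw_same_card)
  moreover have "\<epsilon> (inv g \<circ> \<sigma> \<circ> g) = \<epsilon> \<sigma>"
  proof -
    have "\<epsilon> (inv g \<circ> \<sigma> \<circ> g) = \<epsilon> g * \<epsilon> \<sigma> * \<epsilon> g"
      using p by (simp add: \<epsilon>_comp permutes_intros \<epsilon>_inv)
    moreover have "\<epsilon> g * \<epsilon> g = 1"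
      using \<epsilon>_comp[OF p(2) permutes_inv[OF p(2)]] by (simp add: permutes_cancel[OF p(2)] \<epsilon>_id \<epsilon>_inv[OF p(2)])
    ultimately show ?thesis by (metis mult.assoc mult.commute mult_1)
  qed
  ultimately show "character (inv g \<circ> \<sigma> \<circ> g) = character \<sigma>" by (simp add: character_def)
qed

lemma character_inv:
  assumes "\<sigma> permutes {1..n}"
  shows "character (inv \<sigma>) = character \<sigma>"
proof -
  have "move x (inv \<sigma>) = x \<longleftrightarrow> move x \<sigma> = x" for x using move_inj_iff[OF assms, of x x] by metis
  then show ?thesis by (simp add: character_def \<epsilon>_inv[OF assms])
qed

definition invs :: "'x vec set" where
  "invs = {T \<in> supp_on X. \<forall>\<sigma>. \<sigma> permutes {1..n} \<longrightarrow> act \<sigma> T = T}"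

text \<open>
  The sum of all group elements is \<open>n!\<close> times the projection to the invariants.
\<close>

lemma dim_invs: "fact n * of_nat (cvec.dim invs) = (\<Sum>\<sigma>\<in>Sn n. character \<sigma>)"
proof -
  \<comment> \<open>The sum of all group elements.\<close>
  define u :: "perm vec" where "u = (\<lambda>\<sigma>. if \<sigma> permutes {1..n} then 1 else 0)"
  have fact: "of_nat (card (Sn n)) = (fact n :: complex)"
    using card_permutations[of "{1..n}" n] by simp
  have alg_u: "alg u T x = (\<Sum>\<sigma>\<in>Sn n. act \<sigma> T x)" for T x
    unfolding alg_def by (rule sum.cong) (auto simp: u_def)
  have "conv n u u = vscale (fact n) u"
  proof
    fix \<tau>
    show "conv n u u \<tau> = vscale (fact n) u \<tau>"
    proof (cases "\<tau> permutes {1..n}")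
      case True
      have "conv n u u \<tau> = (\<Sum>\<sigma>\<in>Sn n. 1)"
        unfolding conv_apply[OF True] by (rule sum.cong) (auto simp: u_def permutes_intros True)
      then show ?thesis using fact True by (simp add: u_def)
    qed (simp add: conv_outside u_def)
  qed
  then have "fact n * of_nat (cvec.dim (alg u ` supp_on X)) = pairing n u character"
    by (rule dim_alg_image) simp
  moreover have "pairing n u character = (\<Sum>\<sigma>\<in>Sn n. character \<sigma>)"
    unfolding pairing_def by (rule sum.cong) (auto simp: u_def)
  moreover have "alg u ` supp_on X = invs"
  proof
    show "alg u ` supp_on X \<subseteq> invs"
    proof (rule image_subsetI)
      fix T assume T: "T \<in> supp_on X"
      have "act \<sigma> (alg u T) = alg u T" if \<sigma>: "\<sigma> permutes {1..n}" for \<sigma>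
      proof
        fix x
        have "act \<sigma> (alg u T) x = (\<Sum>\<tau>\<in>Sn n. act \<tau> T x)"
          unfolding act_alg[OF \<sigma>] by (rule sum.cong) (auto simp: u_def permutes_intros \<sigma>)
        then show "act \<sigma> (alg u T) x = alg u T x" by (simp add: alg_u)
      qed
      then show "alg u T \<in> invs" using alg_supp[OF T] by (simp add: invs_def)
    qed
    show "invs \<subseteq> alg u ` supp_on X"
    proof
      fix T assume T: "T \<in> invs"
      have "alg u T x = fact n * T x" for x
      proof -
        have "alg u T x = (\<Sum>\<sigma>\<in>Sn n. T x)"
          unfolding alg_u by (rule sum.cong) (use T in \<open>auto simp: invs_def\<close>)
        then show ?thesis using fact by simp
      qed
      then have *: "alg u T = vscale (fact n) T" by (simp add: fun_eq_iff)
      interpret a: Vector_Spaces.linear vscale vscale "alg u" by (rule clinear_alg)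
      from * have "alg u (vscale (inverse (fact n)) T) = T"
        by (simp add: a.scale)
      moreover have "vscale (inverse (fact n)) T \<in> supp_on X"
        using T cvec.subspace_scale[OF subspace_supp_on] by (auto simp: invs_def)
      ultimately show "T \<in> alg u ` supp_on X" by (metis image_eqI)
    qed
  qed
  ultimately show ?thesis by simp
qed

end

lemma hom_subspace_sym_hom:
  assumes M': "cvec.subspace M'" and A': "\<And>\<sigma>. clinear (A' \<sigma>)"
  shows "homvec.subspace (sym_hom n A M A' M')"
proof -
  have add: "A' \<sigma> (S + T) = A' \<sigma> S + A' \<sigma> T" and scale: "A' \<sigma> (vscale k S) = vscale k (A' \<sigma> S)" for \<sigma> S T k
    using A' by (simp_all add: Vector_Spaces.linear_iff)
  have zero: "A' \<sigma> 0 = 0" for \<sigma> using scale[of \<sigma> 0 0] by (simp add: fun_eq_iff)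
  show ?thesis
    unfolding homvec.subspace_def
  proof (intro conjI ballI allI)
    show "0 \<in> sym_hom n A M A' M'"
      using cvec.subspace_0[OF M'] by (auto simp: sym_hom_def zero fun_eq_iff)
    show "\<phi> + \<psi> \<in> sym_hom n A M A' M'" if "\<phi> \<in> sym_hom n A M A' M'" "\<psi> \<in> sym_hom n A M A' M'" for \<phi> \<psi>
      using that cvec.subspace_add[OF M']
      by (auto simp: sym_hom_def add fun_eq_iff algebra_simps)
    show "homscale k \<phi> \<in> sym_hom n A M A' M'" if "\<phi> \<in> sym_hom n A M A' M'" for k \<phi>
      using that cvec.subspace_scale[OF M']
      by (auto simp: sym_hom_def scale fun_eq_iff algebra_simps homscale_def)
  qed
qed

context monomial_rep
begin

lemma act_linear: "clinear (act \<sigma>)"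
  by (rule clinearI) (auto simp: act_def fun_eq_iff algebra_simps)

text \<open>
  An equivariant map \<open>\<phi>\<close> from the left ideal generated by \<open>c\<close> is determined by \<open>\<phi> c\<close>, because \<open>S c = k S\<close> on the
  ideal; and \<open>c c = k c\<close> forces \<open>\<phi> c\<close> to lie in \<open>c M\<close>, every element of which arises.
\<close>

lemma dim_hom_specht:
  assumes \<eta>: "\<eta> \<in> partitions_of n"
  shows "homvec.dim (sym_hom n left_act (specht \<eta>) act (supp_on X))
    = cvec.dim (alg (young_symmetrizer \<eta>) ` supp_on X)"
proof -
  let ?c = "young_symmetrizer \<eta>" and ?k = "hook_prod \<eta>" and ?M = "supp_on X"
  let ?H = "sym_hom n left_act (specht \<eta>) act ?M"
  have n: "sum_list \<eta> = n" using \<eta> by (simp add: partitions_of_def)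
  note ceq = young_symmetrizer_eq_young[OF n[symmetric]]
  have out: "?c \<tau> = 0" if "\<not> \<tau> permutes {1..n}" for \<tau>
    using that tableau.young_outside[OF tableau_of_partition[OF \<eta>]] by (simp add: ceq)
  have k: "?k \<noteq> 0" and cc: "conv n ?c ?c = vscale ?k ?c"
    using tableau.young_norm_nonzero[OF tableau_of_partition[OF \<eta>]]
      tableau.young_square[OF tableau_of_partition[OF \<eta>]] by (simp_all add: n ceq)
  have left: "left_act \<sigma> x = conv n (unit_vec \<sigma>) x"
    if \<sigma>: "\<sigma> permutes {1..n}" and x: "\<And>\<tau>. \<not> \<tau> permutes {1..n} \<Longrightarrow> x \<tau> = 0" for \<sigma> x
  proof
    fix \<tau>
    show "left_act \<sigma> x \<tau> = conv n (unit_vec \<sigma>) x \<tau>"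
    proof (cases "\<tau> permutes {1..n}")
      case True then show ?thesis using \<sigma> by (simp add: left_act_def conv_unit_left)
    next
      case False
      then have "\<not> inv \<sigma> \<circ> \<tau> permutes {1..n}"
        using permutes_cancel(4)[OF \<sigma>, of \<tau>] permutes_comp[OF \<sigma>, of "inv \<sigma> \<circ> \<tau>"] by auto
      then show ?thesis using False x by (simp add: left_act_def conv_outside)
    qed
  qed
  have conv_in: "conv n u ?c = (\<Sum>\<sigma>\<in>Sn n. vscale (u \<sigma>) (left_act \<sigma> ?c))" for u
  proof
    fix \<tau>
    have "(\<Sum>\<sigma>\<in>Sn n. vscale (u \<sigma>) (left_act \<sigma> ?c)) \<tau> = (\<Sum>\<sigma>\<in>Sn n. u \<sigma> * conv n (unit_vec \<sigma>) ?c \<tau>)"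
      unfolding sum_fun_apply by (rule sum.cong) (auto simp: left out)
    also have "\<dots> = conv n u ?c \<tau>"
    proof (cases "\<tau> permutes {1..n}")
      case True
      show ?thesis unfolding conv_apply[OF True, of u]
        by (rule sum.cong) (auto simp: conv_unit_left True)
    qed (simp add: conv_outside)
    finally show "conv n u ?c \<tau> = (\<Sum>\<sigma>\<in>Sn n. vscale (u \<sigma>) (left_act \<sigma> ?c)) \<tau>" ..
  qed
  have gen: "left_act \<sigma> ?c \<in> specht \<eta>" if "\<sigma> permutes {1..n}" for \<sigma>
    unfolding specht_def by (rule cvec.span_base) (use that n in blast)
  have c_in: "?c \<in> specht \<eta>"
    using gen[OF permutes_id] by (simp add: left_act_def)
  have Sc: "conv n S ?c = vscale ?k S" if "S \<in> specht \<eta>" for S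
    using that unfolding specht_def
  proof (induction rule: cvec.span_induct_alt)
    case base
    show ?case by (simp only: conv_zero cvec.scale_zero_right)
  next
    case (step a x y)
    then obtain \<sigma> where \<sigma>: "\<sigma> permutes {1..n}" "x = left_act \<sigma> ?c" using n by auto
    have "conv n x ?c = vscale ?k x" by (simp add: \<sigma> left out conv_assoc cc)
    moreover have "conv n (vscale a x + y) ?c = vscale a (conv n x ?c) + conv n y ?c"
      by (auto simp: conv_def fun_eq_iff sum.distrib sum_distrib_left algebra_simps)
    moreover have "conv n y ?c = vscale ?k y" by (rule step.IH)
    ultimately show ?case
      by (simp only: cvec.scale_right_distrib cvec.scale_scale mult.commute)
  qed
  have out_S: "S \<tau> = 0" if "S \<in> specht \<eta>" "\<not> \<tau> permutes {1..n}" for S \<tau>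
    using fun_cong[OF Sc[OF that(1)], of \<tau>] k that(2) by (simp add: conv_outside)
  have sub: "cvec.subspace (specht \<eta>)" unfolding specht_def by simp
  have left_in: "left_act \<sigma> S \<in> specht \<eta>" if \<sigma>: "\<sigma> permutes {1..n}" and S: "S \<in> specht \<eta>" for \<sigma> S
  proof -
    have "vscale ?k (left_act \<sigma> S) = left_act \<sigma> (vscale ?k S)" by (simp add: left_act_def vscale_def)
    also have "\<dots> = conv n (conv n (unit_vec \<sigma>) S) ?c"
      unfolding Sc[OF S, symmetric] by (subst left[OF \<sigma>]) (simp_all add: conv_outside conv_assoc)
    also have "\<dots> \<in> specht \<eta>"
      unfolding conv_in by (intro cvec.subspace_sum[OF sub] cvec.subspace_scale[OF sub] gen) simp
    finally have "vscale (inverse ?k) (vscale ?k (left_act \<sigma> S)) \<in> specht \<eta>"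
      by (rule cvec.subspace_scale[OF sub])
    then show ?thesis using k by simp
  qed
  have \<phi>_alg: "\<phi> (conv n u ?c) = alg u (\<phi> ?c)" if \<phi>: "\<phi> \<in> ?H" for \<phi> u
  proof -
    have in_sum: "(\<Sum>\<sigma>\<in>A. vscale (u \<sigma>) (left_act \<sigma> ?c)) \<in> specht \<eta>
        \<and> \<phi> (\<Sum>\<sigma>\<in>A. vscale (u \<sigma>) (left_act \<sigma> ?c)) = (\<Sum>\<sigma>\<in>A. vscale (u \<sigma>) (act \<sigma> (\<phi> ?c)))"
      if "finite A" "A \<subseteq> Sn n" for A
      using that
    proof (induction A rule: finite_induct)
      case empty
      have "\<phi> (vscale 0 ?c) = vscale 0 (\<phi> ?c)" using \<phi> c_in unfolding sym_hom_def by blast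
      then show ?case using cvec.subspace_0[OF sub] by (simp add: vscale_def zero_fun_def)
    next
      case (insert \<sigma> A)
      then have \<sigma>: "\<sigma> permutes {1..n}" by simp
      have g: "left_act \<sigma> ?c \<in> specht \<eta>" by (rule gen[OF \<sigma>])
      have g': "vscale (u \<sigma>) (left_act \<sigma> ?c) \<in> specht \<eta>" by (rule cvec.subspace_scale[OF sub g])
      have "\<phi> (vscale (u \<sigma>) (left_act \<sigma> ?c)) = vscale (u \<sigma>) (act \<sigma> (\<phi> ?c))"
        using \<phi> c_in g \<sigma> unfolding sym_hom_def by simp
      moreover have add: "\<phi> (S + T) = \<phi> S + \<phi> T" if "S \<in> specht \<eta>" "T \<in> specht \<eta>" for S T
        using that \<phi> unfolding sym_hom_def by blast
      moreover have IH: "(\<Sum>\<sigma>\<in>A. vscale (u \<sigma>) (left_act \<sigma> ?c)) \<in> specht \<eta>"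
        "\<phi> (\<Sum>\<sigma>\<in>A. vscale (u \<sigma>) (left_act \<sigma> ?c)) = (\<Sum>\<sigma>\<in>A. vscale (u \<sigma>) (act \<sigma> (\<phi> ?c)))"
        using insert.IH insert.prems by blast+
      ultimately show ?case
        unfolding sum.insert[OF insert(1,2)] add[OF g' IH(1)]
        by (intro conjI cvec.subspace_add[OF sub] g') simp_all
    qed
    have "\<phi> (conv n u ?c) = (\<Sum>\<sigma>\<in>Sn n. vscale (u \<sigma>) (act \<sigma> (\<phi> ?c)))"
      unfolding conv_in using in_sum[of "Sn n"] by simp
    then show ?thesis by (simp add: alg_def fun_eq_iff sum_fun_apply)
  qed
  have \<phi>_determined: "vscale ?k (\<phi> S) = alg S (\<phi> ?c)" if "\<phi> \<in> ?H" "S \<in> specht \<eta>" for \<phi> S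
  proof -
    have "\<phi> (vscale ?k S) = vscale ?k (\<phi> S)" using that unfolding sym_hom_def by blast
    then show ?thesis using \<phi>_alg[OF that(1), of S] Sc[OF that(2)] by simp
  qed
  let ?ev = "\<lambda>\<phi>. \<phi> ?c"
  have lin: "Vector_Spaces.linear homscale vscale ?ev"
    by (simp add: Vector_Spaces.linear_iff vector_space_vscale vector_space_homscale homscale_def)
  have inj: "inj_on ?ev ?H"
  proof (rule inj_onI, rule ext)
    fix \<phi> \<psi> S assume H: "\<phi> \<in> ?H" "\<psi> \<in> ?H" "\<phi> ?c = \<psi> ?c"
    show "\<phi> S = \<psi> S"
    proof (cases "S \<in> specht \<eta>")
      case True
      then have "vscale ?k (\<phi> S) = vscale ?k (\<psi> S)" using \<phi>_determined H by simp
      then show ?thesis using k by simp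
    next
      case False
      then show ?thesis using H unfolding sym_hom_def by simp
    qed
  qed
  have "?ev ` ?H = alg ?c ` ?M"
  proof
    show "?ev ` ?H \<subseteq> alg ?c ` ?M"
    proof (rule image_subsetI)
      fix \<phi> assume \<phi>: "\<phi> \<in> ?H"
      interpret a: Vector_Spaces.linear vscale vscale "alg ?c" by (rule clinear_alg)
      have m: "\<phi> ?c \<in> ?M" using \<phi> c_in unfolding sym_hom_def by blast
      have "alg ?c (vscale (inverse ?k) (\<phi> ?c)) = \<phi> ?c"
        using \<phi>_determined[OF \<phi> c_in] k by (simp add: a.scale flip: \<phi>_determined[OF \<phi> c_in])
      then show "\<phi> ?c \<in> alg ?c ` ?M"
        using cvec.subspace_scale[OF subspace_supp_on m] by (metis image_eqI)
    qed
    show "alg ?c ` ?M \<subseteq> ?ev ` ?H"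
    proof (rule image_subsetI)
      fix m0 assume m0: "m0 \<in> ?M"
      define m where "m = alg ?c m0"
      have m: "m \<in> ?M" using alg_supp[OF m0] by (simp add: m_def)
      define \<phi> where "\<phi> S = (if S \<in> specht \<eta> then vscale (inverse ?k) (alg S m) else 0)" for S
      have "\<phi> \<in> ?H"
        unfolding sym_hom_def
      proof (intro CollectI conjI ballI allI impI)
        fix S assume S: "S \<in> specht \<eta>"
        show "\<phi> S \<in> ?M"
          using S alg_supp[OF m] by (simp add: \<phi>_def cvec.subspace_scale[OF subspace_supp_on])
        show "\<phi> (vscale k S) = vscale k (\<phi> S)" for k
          using S cvec.subspace_scale[OF sub S] by (simp add: \<phi>_def alg_vscale mult.commute)
        fix T assume T: "T \<in> specht \<eta>"
        have "alg (S + T) m = alg S m + alg T m"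
          by (simp add: alg_def fun_eq_iff algebra_simps sum.distrib)
        then show "\<phi> (S + T) = \<phi> S + \<phi> T"
          using S T cvec.subspace_add[OF sub S T] by (simp add: \<phi>_def fun_eq_iff algebra_simps)
      next
        fix \<sigma> S assume \<sigma>: "\<sigma> permutes {1..n}" and S: "S \<in> specht \<eta>"
        have "alg (left_act \<sigma> S) m = act \<sigma> (alg S m)"
          by (simp add: fun_eq_iff act_alg[OF \<sigma>]) (simp add: alg_def left_act_def)
        then show "\<phi> (left_act \<sigma> S) = act \<sigma> (\<phi> S)"
          using S left_in[OF \<sigma> S] by (simp add: \<phi>_def act_def fun_eq_iff algebra_simps)
      qed (simp add: \<phi>_def)
      moreover have "\<phi> ?c = m"
        using c_in k by (simp add: \<phi>_def m_def alg_conv cc alg_vscale)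
      ultimately show "alg ?c m0 \<in> ?ev ` ?H" unfolding m_def by (metis image_eqI)
    qed
  qed
  moreover have "homvec.subspace ?H"
    by (rule hom_subspace_sym_hom[OF subspace_supp_on act_linear])
  ultimately show ?thesis
    using hpair.dim_linear_image_inj[OF lin _ inj] by simp
qed

lemma dim_hom_specht_character:
  assumes "\<eta> \<in> partitions_of n"
  shows "of_nat (homvec.dim (sym_hom n left_act (specht \<eta>) act (supp_on X)))
    = pairing n character (young_symmetrizer \<eta>) / hook_prod \<eta>"
proof -
  have n: "sum_list \<eta> = n" using assms by (simp add: partitions_of_def)
  have k: "hook_prod \<eta> \<noteq> 0" and cc: "conv n (young_symmetrizer \<eta>) (young_symmetrizer \<eta>) = vscale (hook_prod \<eta>) (young_symmetrizer \<eta>)"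
    using tableau.young_norm_nonzero[OF tableau_of_partition[OF assms]]
      tableau.young_square[OF tableau_of_partition[OF assms]]
    by (simp_all add: n young_symmetrizer_eq_young[OF n[symmetric]])
  have "pairing n character (young_symmetrizer \<eta>) = pairing n (young_symmetrizer \<eta>) character"
    by (simp add: pairing_def mult.commute)
  then show ?thesis
    using dim_alg_image[OF cc k] k unfolding dim_hom_specht[OF assms] by (simp add: field_simps)
qed

end

section \<open>Words and parking functions\<close>

definition count_of :: "nat \<Rightarrow> (nat \<Rightarrow> nat) \<Rightarrow> nat \<Rightarrow> nat" where
  "count_of n w p = card {t \<in> {1..n}. w t = p}"

abbreviation words :: "nat \<Rightarrow> nat \<Rightarrow> (nat \<Rightarrow> nat) set" where
  "words r n \<equiv> {1..n} \<rightarrow>\<^sub>E {1..r}"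

definition words_of_weight :: "nat \<Rightarrow> nat \<Rightarrow> (nat \<Rightarrow> complex) \<Rightarrow> (nat \<Rightarrow> nat) set" where
  "words_of_weight r n \<mu> = {w \<in> words r n. \<forall>p\<in>{1..r}. of_nat (count_of n w p) = \<mu> p}"

lemma PiE_comp_permutes:
  assumes "w \<in> {1..n} \<rightarrow>\<^sub>E A" "\<sigma> permutes {1..n}"
  shows "w \<circ> \<sigma> \<in> {1..n} \<rightarrow>\<^sub>E A"
proof (rule PiE_I)
  fix t assume "t \<in> {1..n}"
  then show "(w \<circ> \<sigma>) t \<in> A" using permutes_in[OF assms(2)] PiE_mem[OF assms(1)] by simp
next
  fix t assume "t \<notin> {1..n}"
  then show "(w \<circ> \<sigma>) t = undefined"
    using assms PiE_arb[OF assms(1)] by (simp add: permutes_not_in)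
qed

lemma card_permutes_Collect:
  assumes "\<sigma> permutes {1..n::nat}"
  shows "card {t \<in> {1..n}. P (\<sigma> t)} = card {t \<in> {1..n}. P t}"
proof -
  have "bij_betw \<sigma> {t \<in> {1..n}. P (\<sigma> t)} {t \<in> {1..n}. P t}"
  proof (rule bij_betw_byWitness[where f' = "inv \<sigma>"])
    show "\<sigma> ` {t \<in> {1..n}. P (\<sigma> t)} \<subseteq> {t \<in> {1..n}. P t}"
      using permutes_in[OF assms] by blast
    show "inv \<sigma> ` {t \<in> {1..n}. P t} \<subseteq> {t \<in> {1..n}. P (\<sigma> t)}"
      using permutes_in[OF permutes_inv[OF assms]] permutes_inverses[OF assms] by auto
  qed (simp_all add: permutes_inverses[OF assms])
  then show ?thesis by (rule bij_betw_same_card)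
qed

lemma count_of_comp:
  "\<sigma> permutes {1..n} \<Longrightarrow> count_of n (w \<circ> \<sigma>) p = count_of n w p"
  unfolding count_of_def using card_permutes_Collect[of \<sigma> n "\<lambda>t. w t = p"] by simp

lemma words_of_weight_comp:
  "w \<in> words_of_weight r n \<mu> \<Longrightarrow> \<sigma> permutes {1..n} \<Longrightarrow> w \<circ> \<sigma> \<in> words_of_weight r n \<mu>"
  by (simp add: words_of_weight_def PiE_comp_permutes count_of_comp)

lemma words_of_weight_subset: "words_of_weight r n \<mu> \<subseteq> words r n"
  by (auto simp: words_of_weight_def)

lemma finite_words: "finite (words r n)"
  by (rule finite_PiE) auto

lemma finite_words_of_weight: "finite (words_of_weight r n \<mu>)"
  by (rule finite_subset[OF words_of_weight_subset finite_words])

lemma PFm_comp: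
  assumes f: "f \<in> PFm n \<rho> m" and \<sigma>: "\<sigma> permutes {1..n}"
  shows "f \<circ> \<sigma> \<in> PFm n \<rho> m"
proof -
  have sum: "(\<Sum>i=1..n. (f \<circ> \<sigma>) i) = (\<Sum>i=1..n. f i)"
    using sum.permute[OF \<sigma>, of f] by simp
  have card: "card {i \<in> {1..n}. (f \<circ> \<sigma>) i \<in> A} = card {i \<in> {1..n}. f i \<in> A}" for A
    unfolding comp_def by (rule card_permutes_Collect[OF \<sigma>])
  have "f \<circ> \<sigma> \<in> {1..n} \<rightarrow>\<^sub>E {1..n}"
    by (rule PiE_comp_permutes[OF _ \<sigma>]) (use f in \<open>simp add: PFm_def PF_def\<close>)
  then show ?thesis
    using f unfolding PFm_def PF_def pf_deg_def mem_Collect_eq card sum by blast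
qed

lemma finite_PFm: "finite (PFm n \<rho> m)"
proof (rule finite_subset)
  show "PFm n \<rho> m \<subseteq> {1..n} \<rightarrow>\<^sub>E {1..n}" by (auto simp: PFm_def PF_def)
qed (auto intro: finite_PiE)

lemma sign_character:
  fixes \<sigma> \<tau> :: perm
  shows "of_int (sign (id :: perm)) = (1 :: complex)"
  "\<sigma> permutes {1..n} \<Longrightarrow> \<tau> permutes {1..n} \<Longrightarrow>
     of_int (sign (\<sigma> \<circ> \<tau>)) = (of_int (sign \<sigma>) * of_int (sign \<tau>) :: complex)"
  "\<sigma> permutes {1..n} \<Longrightarrow> of_int (sign (inv \<sigma>)) = (of_int (sign \<sigma>) :: complex)"
  using permutes_sign_comp[of \<sigma> n \<tau>] permutes_sign_inv[of \<sigma> n] by simp_all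

interpretation wr: monomial_rep n "words_of_weight r n \<mu>" "\<lambda>w \<sigma>. w \<circ> \<sigma>" "\<lambda>_. 1"
  by standard (simp_all add: finite_words_of_weight words_of_weight_comp comp_assoc)

interpretation pr: monomial_rep n "PFm n \<rho> m" "\<lambda>f \<sigma>. f \<circ> \<sigma>" "\<lambda>\<sigma>. of_int (sign \<sigma>)"
  by standard (simp_all add: finite_PFm PFm_comp comp_assoc sign_character)

interpretation tr: monomial_rep n "words_of_weight r n \<mu> \<times> PFm n \<rho> m"
    "\<lambda>(w, f) \<sigma>. (w \<circ> \<sigma>, f \<circ> \<sigma>)" "\<lambda>\<sigma>. of_int (sign \<sigma>)"
  by standard (auto simp: finite_words_of_weight words_of_weight_comp finite_PFm PFm_comp comp_assoc sign_character)

abbreviation word_char :: "nat \<Rightarrow> nat \<Rightarrow> (nat \<Rightarrow> complex) \<Rightarrow> perm vec" where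
  "word_char r n \<mu> \<equiv> wr.character r n \<mu>"

abbreviation pf_char :: "nat \<Rightarrow> nat list \<Rightarrow> int \<Rightarrow> perm vec" where
  "pf_char n \<rho> m \<equiv> pr.character n \<rho> m"

lemma dim_sym_class_pf:
  assumes "\<eta> \<in> partitions_of n"
  shows "of_int (sym_class n pf_sign_act (CPFm n \<rho> m) \<eta>)
    = pairing n (pf_char n \<rho> m) (young_symmetrizer \<eta>) / hook_prod \<eta>"
proof -
  have "pr.act = pf_sign_act"
    by (auto simp: fun_eq_iff pr.act_def pf_sign_act_def)
  then show ?thesis
    using pr.dim_hom_specht_character[OF assms, of \<rho> m] assms
    by (simp add: sym_class_def CPFm_def free_space_finite finite_PFm)
qed

lemma sum_diag_Emat:
  fixes G :: "nat \<Rightarrow> nat \<Rightarrow> complex"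
  assumes "\<And>t. t \<in> {1..n} \<Longrightarrow> w t \<in> {1..r}"
    and "\<And>t. t \<in> {1..n} \<Longrightarrow> G t (w t) = G0"
  shows "(\<Sum>t=1..n. \<Sum>q=1..r. Emat p p (w t) q * G t q) = of_nat (count_of n w p) * G0"
proof -
  have "(\<Sum>q=1..r. Emat p p (w t) q * G t q) = (if w t = p then G0 else 0)" if t: "t \<in> {1..n}" for t
  proof -
    have "(\<Sum>q=1..r. Emat p p (w t) q * G t q) = (\<Sum>q=1..r. if q = w t then (if w t = p then G t (w t) else 0) else 0)"
      by (rule sum.cong) (auto simp: Emat_def)
    also have "\<dots> = (if w t = p then G t (w t) else 0)" using assms(1)[OF t] by simp
    also have "\<dots> = (if w t = p then G0 else 0)" unfolding assms(2)[OF t] ..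
    finally show ?thesis .
  qed
  then have "(\<Sum>t=1..n. \<Sum>q=1..r. Emat p p (w t) q * G t q) = (\<Sum>t\<in>{1..n}. if w t = p then G0 else 0)"
    by (intro sum.cong) simp_all
  also have "\<dots> = of_nat (count_of n w p) * G0"
    by (simp add: sum.If_cases count_of_def Int_def)
  finally show ?thesis .
qed

lemma tensor_diag:
  assumes "w \<in> words r n"
  shows "tensor_gl_act r n (Emat p p) T (w, f) = of_nat (count_of n w p) * T (w, f)"
proof -
  have "w t \<in> {1..r}" if "t \<in> {1..n}" for t using PiE_mem[OF assms that] .
  moreover have "w(t := w t) = w" for t by simp
  ultimately show ?thesis
    using sum_diag_Emat[of n w r "\<lambda>t q. T (w(t := q), f)" "T (w, f)" p] assms
    by (simp add: tensor_gl_act_def)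
qed

lemma cvec_dim_zero: "cvec.dim {0 :: 'x vec} = 0"
  using cvec.dim_span[of "{} :: 'x vec set"] cvec.dim_eq_card_independent[OF cvec.independent_empty]
  by simp

lemma ch_eq_dim:
  "ch r a W \<mu> = int (cvec.dim {T \<in> W. \<forall>p\<in>{1..r}. a (Emat p p) T = vscale (\<mu> p) T})"
  unfolding ch_def ch_quot_def Let_def by (simp add: cvec_dim_zero)

text \<open>
  The weight space of the invariants consists of the invariants supported on words of the given content, and the
  permutation character of pairs is the product of the two characters.
\<close>

lemma ch_tensor_invariants:
  "fact n * of_int (ch r (tensor_gl_act r n) (invariants n tensor_sign_act (tensor_CPFm r n \<rho> m)) \<mu>)
     = pairing n (word_char r n \<mu>) (pf_char n \<rho> m)"
proof -
  have "{T \<in> invariants n tensor_sign_act (tensor_CPFm r n \<rho> m).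
      \<forall>p\<in>{1..r}. tensor_gl_act r n (Emat p p) T = vscale (\<mu> p) T} = tr.invs n r \<mu> \<rho> m" (is "?L = ?R")
  proof -
    have act: "tr.act \<sigma> T = tensor_sign_act \<sigma> T" for \<sigma> and T :: "((nat \<Rightarrow> nat) \<times> (nat \<Rightarrow> nat)) vec"
      by (auto simp: fun_eq_iff tr.act_def tensor_sign_act_def)
    have "T \<in> supp_on (words_of_weight r n \<mu> \<times> PFm n \<rho> m) \<longleftrightarrow>
        T \<in> supp_on (words r n \<times> PFm n \<rho> m) \<and>
        (\<forall>p\<in>{1..r}. tensor_gl_act r n (Emat p p) T = vscale (\<mu> p) T)" for T
    proof
      assume T: "T \<in> supp_on (words_of_weight r n \<mu> \<times> PFm n \<rho> m)"
      have "tensor_gl_act r n (Emat p p) T = vscale (\<mu> p) T" if p: "p \<in> {1..r}" for p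
      proof
        fix x :: "(nat \<Rightarrow> nat) \<times> (nat \<Rightarrow> nat)"
        obtain w f where x: "x = (w, f)" by (cases x)
        show "tensor_gl_act r n (Emat p p) T x = vscale (\<mu> p) T x"
        proof (cases "w \<in> words r n")
          case True
          show ?thesis
          proof (cases "w \<in> words_of_weight r n \<mu>")
            case True
            then show ?thesis using p \<open>w \<in> words r n\<close> by (simp add: x tensor_diag words_of_weight_def)
          next
            case False
            then have "T (w, f) = 0" using supp_onD[OF T] by simp
            then show ?thesis using True by (simp add: x tensor_diag)
          qed
        next
          case False
          then have "T (w, f) = 0" using supp_onD[OF T] words_of_weight_subset by blast
          then show ?thesis using False unfolding x by (simp add: tensor_gl_act_def)
        qed
      qed
      moreover have "T \<in> supp_on (words r n \<times> PFm n \<rho> m)"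
        using T words_of_weight_subset[of r n \<mu>] by (auto simp: supp_on_def)
      ultimately show "T \<in> supp_on (words r n \<times> PFm n \<rho> m) \<and>
        (\<forall>p\<in>{1..r}. tensor_gl_act r n (Emat p p) T = vscale (\<mu> p) T)" by blast
    next
      assume T: "T \<in> supp_on (words r n \<times> PFm n \<rho> m) \<and>
        (\<forall>p\<in>{1..r}. tensor_gl_act r n (Emat p p) T = vscale (\<mu> p) T)"
      show "T \<in> supp_on (words_of_weight r n \<mu> \<times> PFm n \<rho> m)"
        unfolding supp_on_def
      proof (intro CollectI allI impI, rule ccontr)
        fix x assume x: "x \<notin> words_of_weight r n \<mu> \<times> PFm n \<rho> m" "T x \<noteq> 0"
        obtain w f where wf: "x = (w, f)" by (cases x)
        have w: "w \<in> words r n" "f \<in> PFm n \<rho> m" using x(2) T wf by (auto simp: supp_on_def)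
        have "of_nat (count_of n w p) = \<mu> p" if p: "p \<in> {1..r}" for p
        proof -
          have "tensor_gl_act r n (Emat p p) T x = vscale (\<mu> p) T x" using T p by simp
          then show ?thesis using x(2) by (simp add: wf tensor_diag[OF w(1)])
        qed
        then show False using w x(1) wf by (simp add: words_of_weight_def)
      qed
    qed
    then show ?thesis
      unfolding tr.invs_def invariants_def tensor_CPFm_def act
      by (auto simp: free_space_finite finite_words finite_PFm)
  qed
  then have "fact n * of_int (ch r (tensor_gl_act r n) (invariants n tensor_sign_act (tensor_CPFm r n \<rho> m)) \<mu>)
      = (\<Sum>\<sigma>\<in>Sn n. tr.character r n \<mu> \<rho> m \<sigma>)"
    using tr.dim_invs[of n r \<mu> \<rho> m] by (simp add: ch_eq_dim)
  also have "\<dots> = pairing n (word_char r n \<mu>) (pf_char n \<rho> m)"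
    unfolding pairing_def
  proof (rule sum.cong)
    fix \<sigma>
    have "{x \<in> words_of_weight r n \<mu> \<times> PFm n \<rho> m. (case x of (w, f) \<Rightarrow> \<lambda>\<sigma>. (w \<circ> \<sigma>, f \<circ> \<sigma>)) \<sigma> = x}
        = {w \<in> words_of_weight r n \<mu>. w \<circ> \<sigma> = w} \<times> {f \<in> PFm n \<rho> m. f \<circ> \<sigma> = f}" by auto
    then show "tr.character r n \<mu> \<rho> m \<sigma> = word_char r n \<mu> \<sigma> * pf_char n \<rho> m \<sigma>"
      by (simp add: tr.character_def wr.character_def pr.character_def card_cartesian_product)
  qed simp
  finally show ?thesis .
qed

text \<open>
  The first column of the diagram has more cells than there are letters, so every word repeats a letter there. The
  transposition of the two cells fixes the word and negates the Young symmetrizer.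
\<close>

lemma word_char_young_zero:
  assumes \<eta>: "\<eta> \<in> partitions_of n" and r: "part \<eta> (r + 1) \<noteq> 0"
  shows "pairing n (word_char r n \<mu>) (young_symmetrizer \<eta>) = 0"
proof -
  let ?c = "young_symmetrizer \<eta>" and ?W = "words_of_weight r n \<mu>"
  have n: "sum_list \<eta> = n" and sorted: "sorted_wrt (\<ge>) \<eta>" using \<eta> by (auto simp: partitions_of_def)
  have "pairing n (word_char r n \<mu>) ?c = (\<Sum>\<sigma>\<in>Sn n. \<Sum>w\<in>?W. if w \<circ> \<sigma> = w then ?c \<sigma> else 0)"
    unfolding pairing_def wr.character_def
    by (rule sum.cong) (simp_all add: sum.If_cases finite_words_of_weight Int_def)
  also have "\<dots> = (\<Sum>w\<in>?W. \<Sum>\<sigma>\<in>Sn n. if w \<circ> \<sigma> = w then ?c \<sigma> else 0)" by (rule sum.swap)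
  also have "\<dots> = 0"
  proof (rule sum.neutral, rule ballI)
    fix w assume "w \<in> ?W"
    then have w: "w \<in> words r n" using words_of_weight_subset by blast
    \<comment> \<open>The cells of the first column.\<close>
    let ?cell = "\<lambda>i. rows_len \<eta> (i - 1) + 1"
    have p1: "1 \<le> part \<eta> i" if "i \<in> {1..r+1}" for i
      using part_antimono[OF sorted, of i "r + 1"] that r by simp
    have cell: "?cell i \<in> {1..n}" "tab_row \<eta> (?cell i) = i" "tab_col \<eta> (?cell i) = 1" if "i \<in> {1..r+1}" for i
      using cell_in_range[of i 1 \<eta>] tab_row_cell[of i 1 \<eta>] tab_col_cell[of i 1 \<eta>] p1[OF that] that n
      by simp_all
    have "\<not> inj_on (\<lambda>i. w (?cell i)) {1..r+1}"
    proof
      assume "inj_on (\<lambda>i. w (?cell i)) {1..r+1}"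
      moreover have "(\<lambda>i. w (?cell i)) ` {1..r+1} \<subseteq> {1..r}"
        using PiE_mem[OF w] cell(1) by blast
      ultimately have "card {1..r+1} \<le> card {1..r}" by (rule card_inj_on_le) simp
      then show False by simp
    qed
    then obtain i j where ij: "i \<in> {1..r+1}" "j \<in> {1..r+1}" "i \<noteq> j" "w (?cell i) = w (?cell j)"
      by (auto simp: inj_on_def)
    define \<tau> where "\<tau> = transpose (?cell i) (?cell j)"
    have \<tau>: "\<tau> \<in> stab n (tab_col \<eta>)" unfolding \<tau>_def
      by (rule transpose_stab) (use cell ij in auto)
    have \<tau>p: "\<tau> permutes {1..n}" using \<tau> by (rule stab_permutes)
    have "?cell i \<noteq> ?cell j" using cell(2)[OF ij(1)] cell(2)[OF ij(2)] ij(3) by metis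
    then have sg: "sign \<tau> = -1" by (simp add: \<tau>_def sign_swap_id)
    have w\<tau>: "w \<circ> \<tau> = w" using ij(4) by (auto simp: \<tau>_def transpose_def fun_eq_iff)
    have iff: "w \<circ> (\<sigma> \<circ> \<tau>) = w \<longleftrightarrow> w \<circ> \<sigma> = w" for \<sigma>
      using w\<tau> permutes_cancel(5,6)[OF \<tau>p] by (metis comp_assoc)
    let ?S = "\<Sum>\<sigma>\<in>Sn n. if w \<circ> \<sigma> = w then ?c \<sigma> else 0"
    have "?S = (\<Sum>\<sigma>\<in>Sn n. if w \<circ> (\<sigma> \<circ> \<tau>) = w then ?c (\<sigma> \<circ> \<tau>) else 0)"
      by (rule sum_Sn_right[OF \<tau>p, symmetric])
    also have "\<dots> = (\<Sum>\<sigma>\<in>Sn n. - (if w \<circ> \<sigma> = w then ?c \<sigma> else 0))"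
      unfolding iff
      by (rule sum.cong)
         (simp_all add: young_symmetrizer_eq_young n tableau.c_right[OF tableau_of_partition[OF \<eta>] \<tau>] sg)
    finally show "?S = 0" by (simp add: sum_negf)
  qed
  finally show ?thesis .
qed

section \<open>Antisymmetric tensors\<close>

definition antisym :: "nat \<Rightarrow> (nat \<Rightarrow> 'a) vec \<Rightarrow> bool" where
  "antisym n T \<longleftrightarrow> (\<forall>\<sigma> b. \<sigma> permutes {1..n} \<longrightarrow> T (b \<circ> \<sigma>) = of_int (sign \<sigma>) * T b)"

text \<open>
  The antisymmetrization of the pure tensor \<open>b\<^sub>0\<close>. Unlike wedges of lists, it can be handled under replacing a label at
  one position without tracking signs.
\<close>

definition altv :: "nat \<Rightarrow> (nat \<Rightarrow> 'a) \<Rightarrow> (nat \<Rightarrow> 'a) vec" where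
  "altv n b\<^sub>0 = (\<lambda>b. \<Sum>\<sigma>\<in>Sn n. if b = b\<^sub>0 \<circ> \<sigma> then of_int (sign \<sigma>) else 0)"

lemma antisymD: "antisym n T \<Longrightarrow> \<sigma> permutes {1..n} \<Longrightarrow> T (b \<circ> \<sigma>) = of_int (sign \<sigma>) * T b"
  by (simp add: antisym_def)

lemma comp_permutes_eq_iff:
  assumes "\<tau> permutes S"
  shows "b \<circ> \<tau> = b' \<circ> \<tau> \<longleftrightarrow> b = b'" "b \<circ> \<tau> = b' \<longleftrightarrow> b = b' \<circ> inv \<tau>"
  using permutes_cancel(1,2)[OF assms] by (metis comp_assoc comp_id)+

lemma antisym_altv: "antisym n (altv n b\<^sub>0)"
  unfolding antisym_def
proof (intro allI impI)
  fix \<tau> b assume \<tau>: "\<tau> permutes {1..n}"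
  have "altv n b\<^sub>0 (b \<circ> \<tau>) = (\<Sum>\<sigma>\<in>Sn n. if b \<circ> \<tau> = b\<^sub>0 \<circ> (\<sigma> \<circ> \<tau>) then of_int (sign (\<sigma> \<circ> \<tau>)) else 0)"
    unfolding altv_def by (rule sum_Sn_right[OF \<tau>, symmetric])
  also have "\<dots> = (\<Sum>\<sigma>\<in>Sn n. of_int (sign \<tau>) * (if b = b\<^sub>0 \<circ> \<sigma> then of_int (sign \<sigma>) else 0))"
    unfolding comp_assoc[symmetric] comp_permutes_eq_iff(1)[OF \<tau>]
    by (rule sum.cong) (auto simp: permutes_sign_comp[OF _ \<tau>])
  finally show "altv n b\<^sub>0 (b \<circ> \<tau>) = of_int (sign \<tau>) * altv n b\<^sub>0 b"
    by (simp add: altv_def sum_distrib_left)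
qed

lemma altv_comp:
  assumes "\<tau> permutes {1..n}"
  shows "altv n (b\<^sub>0 \<circ> \<tau>) = vscale (of_int (sign \<tau>)) (altv n b\<^sub>0)"
proof
  fix b
  have "altv n b\<^sub>0 b = (\<Sum>\<sigma>\<in>Sn n. if b = b\<^sub>0 \<circ> (\<tau> \<circ> \<sigma>) then of_int (sign (\<tau> \<circ> \<sigma>)) else 0)"
    unfolding altv_def by (rule sum_Sn_left[OF assms, symmetric])
  also have "\<dots> = (\<Sum>\<sigma>\<in>Sn n. of_int (sign \<tau>) * (if b = b\<^sub>0 \<circ> \<tau> \<circ> \<sigma> then of_int (sign \<sigma>) else 0))"
    by (rule sum.cong) (auto simp: permutes_sign_comp[OF assms] comp_assoc)
  also have "\<dots> = of_int (sign \<tau>) * altv n (b\<^sub>0 \<circ> \<tau>) b"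
    by (simp add: altv_def sum_distrib_left)
  finally show "altv n (b\<^sub>0 \<circ> \<tau>) b = vscale (of_int (sign \<tau>)) (altv n b\<^sub>0) b" by simp
qed

lemma altv_nonzeroD:
  assumes "altv n b\<^sub>0 b \<noteq> 0"
  obtains \<sigma> where "\<sigma> permutes {1..n}" "b = b\<^sub>0 \<circ> \<sigma>"
proof -
  have "\<exists>\<sigma>. \<sigma> permutes {1..n} \<and> b = b\<^sub>0 \<circ> \<sigma>"
  proof (rule ccontr)
    assume "\<nexists>\<sigma>. \<sigma> permutes {1..n} \<and> b = b\<^sub>0 \<circ> \<sigma>"
    then have "altv n b\<^sub>0 b = 0" unfolding altv_def by (intro sum.neutral ballI if_not_P) blast
    then show False using assms by simp
  qed
  then show thesis using that by blast
qed

lemma wedge_eq_altv: "wedge bs = altv (length bs) (\<lambda>t\<in>{1..length bs}. bs ! (t - 1))"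
proof -
  have "(\<lambda>t\<in>{1..n}. bs ! (\<sigma> t - 1)) = (\<lambda>t\<in>{1..n}. bs ! (t - 1)) \<circ> \<sigma>"
    if \<sigma>: "\<sigma> permutes {1..n}" for \<sigma> and n :: nat
  proof
    fix t
    show "(\<lambda>t\<in>{1..n}. bs ! (\<sigma> t - 1)) t = ((\<lambda>t\<in>{1..n}. bs ! (t - 1)) \<circ> \<sigma>) t"
    proof (cases "t \<in> {1..n}")
      case True
      then show ?thesis using permutes_in[OF \<sigma> True] by simp
    next
      case False
      then have "\<sigma> t = t" using \<sigma> by (simp add: permutes_not_in)
      then show ?thesis unfolding comp_apply restrict_apply by (simp only: False if_False)
    qed
  qed
  then show ?thesis unfolding wedge_def altv_def Let_def by (intro ext sum.cong) auto
qed

definition vlist :: "nat \<Rightarrow> nat list \<Rightarrow> int \<Rightarrow> (nat \<times> int) list" where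
  "vlist r \<xi> N = concat (map (\<lambda>j. map (\<lambda>i. (j, i)) [N - int (part \<xi> j)..N - 1]) [1..<Suc r])"

lemma vlist_Suc: "vlist (Suc r) \<xi> N = vlist r \<xi> N @ map (\<lambda>i. (Suc r, i)) [N - int (part \<xi> (Suc r))..N - 1]"
  by (simp add: vlist_def)

lemma length_vlist: "length (vlist r \<xi> N) = rows_len \<xi> r"
proof (induction r)
  case 0 then show ?case by (simp add: vlist_def)
next
  case (Suc r)
  then show ?case by (simp add: vlist_Suc rows_len_Suc)
qed

lemma nth_vlist:
  assumes "1 \<le> j" "j \<le> r" "c < part \<xi> j"
  shows "vlist r \<xi> N ! (rows_len \<xi> (j - 1) + c) = (j, N - int (part \<xi> j) + int c)"
  using assms
proof (induction r)
  case 0 then show ?case by simp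
next
  case (Suc r)
  show ?case
  proof (cases "j = Suc r")
    case True
    have "[N - int (part \<xi> (Suc r))..N - 1] ! c = N - int (part \<xi> (Suc r)) + int c"
      using Suc.prems True by (intro nth_upto) simp
    moreover have "c < length [N - int (part \<xi> (Suc r))..N - 1]" using Suc.prems True by simp
    ultimately show ?thesis using True by (simp add: vlist_Suc nth_append length_vlist One_nat_def)
  next
    case False
    then have j: "j \<le> r" using Suc.prems by simp
    have "rows_len \<xi> (j - 1) + c < rows_len \<xi> j"
      using rows_len_Suc[of \<xi> "j - 1"] Suc.prems by simp
    also have "\<dots> \<le> rows_len \<xi> r" by (rule rows_len_mono[OF j])
    finally show ?thesis using Suc.IH[OF Suc.prems(1) j Suc.prems(3)]
      by (simp add: vlist_Suc nth_append length_vlist)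
  qed
qed

text \<open>
  The labels of the generating vector in the order of the standard filling: row \<open>j\<close> of the diagram carries
  \<open>u\<^sub>j\<close>, at the levels from \<open>N - \<xi>\<^sub>j\<close> to \<open>N - 1\<close>.
\<close>

definition vinit :: "nat list \<Rightarrow> int \<Rightarrow> nat \<Rightarrow> nat \<times> int" where
  "vinit \<xi> N = (\<lambda>t\<in>{1..sum_list \<xi>}.
     (tab_row \<xi> t, N - int (part \<xi> (tab_row \<xi> t)) + int (tab_col \<xi> t) - 1))"

lemma tab_row_le_length:
  assumes "t \<in> {1..sum_list \<xi>}"
  shows "tab_row \<xi> t \<le> length \<xi>"
  using assms tab_row_le_iff[of t \<xi> "length \<xi>"] by (simp add: rows_len_all)

lemma vxi_eq_altv:
  assumes "length \<xi> \<le> r"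
  shows "vxi r \<xi> N = altv (sum_list \<xi>) (vinit \<xi> N)"
proof -
  have len: "length (vlist r \<xi> N) = sum_list \<xi>" using assms by (simp add: length_vlist rows_len_all)
  have "vlist r \<xi> N ! (t - 1) = (tab_row \<xi> t, N - int (part \<xi> (tab_row \<xi> t)) + int (tab_col \<xi> t) - 1)"
    if t: "t \<in> {1..sum_list \<xi>}" for t
  proof -
    have "t - 1 = rows_len \<xi> (tab_row \<xi> t - 1) + (tab_col \<xi> t - 1)"
      using tab_decompose[OF t] tab_col_pos[OF t] by simp
    moreover have "vlist r \<xi> N ! (rows_len \<xi> (tab_row \<xi> t - 1) + (tab_col \<xi> t - 1))
        = (tab_row \<xi> t, N - int (part \<xi> (tab_row \<xi> t)) + int (tab_col \<xi> t - 1))"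
      using tab_row_pos[OF t] tab_col_pos[OF t] tab_col_le[OF t] tab_row_le_length[OF t] assms
      by (intro nth_vlist) simp_all
    ultimately show ?thesis using tab_col_pos[OF t] by simp
  qed
  then have "(\<lambda>t\<in>{1..sum_list \<xi>}. vlist r \<xi> N ! (t - 1)) = vinit \<xi> N"
    unfolding vinit_def by (intro restrict_ext)
  then show ?thesis
    unfolding vxi_def vlist_def[symmetric] wedge_eq_altv len by simp
qed

lemma clinear_gact: "clinear (gact r N n a)"
  by (rule clinearI)
     (auto simp: gact_def fun_eq_iff case_prod_beta sum.distrib sum_distrib_left algebra_simps)

lemma fun_upd_comp_permutes:
  assumes "\<sigma> permutes S"
  shows "(b \<circ> \<sigma>)(t := v) = b(\<sigma> t := v) \<circ> \<sigma>"
  using permutes_inj[OF assms] by (auto simp: fun_eq_iff inj_def)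

lemma PiE_comp_permutes_iff:
  assumes "\<sigma> permutes {1..n}"
  shows "w \<circ> \<sigma> \<in> {1..n} \<rightarrow>\<^sub>E A \<longleftrightarrow> w \<in> {1..n} \<rightarrow>\<^sub>E A"
  using PiE_comp_permutes[OF _ assms, of w A] PiE_comp_permutes[OF _ permutes_inv[OF assms], of "w \<circ> \<sigma>" A]
  by (auto simp: comp_assoc permutes_cancel(2)[OF assms])

lemma antisym_gact:
  assumes T: "antisym n T"
  shows "antisym n (gact r N n a T)"
  unfolding antisym_def
proof (intro allI impI)
  fix \<sigma> b assume \<sigma>: "\<sigma> permutes {1..n}"
  let ?F = "\<lambda>b t. \<Sum>(k, l)\<in>gelt_supp a. \<Sum>q=1..r. a k l (fst (b t)) q * of_int (snd (b t) - int k) ^ l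
              * T (b(t := (q, snd (b t) - int k)))"
  have "?F (b \<circ> \<sigma>) t = of_int (sign \<sigma>) * ?F b (\<sigma> t)" for t
    unfolding fun_upd_comp_permutes[OF \<sigma>] antisymD[OF T \<sigma>] sum_distrib_left
    by (intro sum.cong refl) (auto simp: sum_distrib_left mult_ac)
  then have "(\<Sum>t=1..n. ?F (b \<circ> \<sigma>) t) = of_int (sign \<sigma>) * (\<Sum>t=1..n. ?F b (\<sigma> t))"
    by (simp only: sum_distrib_left)
  also have "(\<Sum>t=1..n. ?F b (\<sigma> t)) = (\<Sum>t=1..n. ?F b t)"
    using sum.permute[OF \<sigma>, of "?F b"] by (simp only: comp_def)
  finally show "gact r N n a T (b \<circ> \<sigma>) = of_int (sign \<sigma>) * gact r N n a T b"
    unfolding gact_def PiE_comp_permutes_iff[OF \<sigma>] by (simp only: mult_zero_right split: if_split) blast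
qed

lemma gl_act_calV_apply:
  "gl_act_calV r N n g T b = (if b \<in> {1..n} \<rightarrow>\<^sub>E Vbasis r N
     then \<Sum>t=1..n. \<Sum>q=1..r. g (fst (b t)) q * T (b(t := (q, snd (b t)))) else 0)"
proof (cases "g = 0")
  case True
  then show ?thesis by (simp add: gl_act_calV_def gact_def gelt_of_def gelt_supp_def)
next
  case False
  then have "gelt_supp (gelt_of g 0 0) = {(0, 0)}" by (auto simp: gelt_supp_def gelt_of_def)
  then show ?thesis by (simp add: gl_act_calV_def gact_def gelt_of_def)
qed

section \<open>Irreducible modules over the general linear algebra\<close>

definition wact :: "nat \<Rightarrow> nat \<Rightarrow> glmat \<Rightarrow> (nat \<Rightarrow> nat) vec \<Rightarrow> (nat \<Rightarrow> nat) vec" where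
  "wact r n g S = (\<lambda>w. if w \<in> words r n then \<Sum>t=1..n. \<Sum>q=1..r. g (w t) q * S (w(t := q)) else 0)"

definition walg :: "nat \<Rightarrow> perm vec \<Rightarrow> (nat \<Rightarrow> nat) vec \<Rightarrow> (nat \<Rightarrow> nat) vec" where
  "walg n u S = (\<lambda>w. \<Sum>\<sigma>\<in>Sn n. u \<sigma> * S (w \<circ> \<sigma>))"

lemma walg_apply: "walg n u S w = (\<Sum>\<sigma>\<in>Sn n. u \<sigma> * S (w \<circ> \<sigma>))"
  by (simp add: walg_def)

lemma alg_eq_walg: "wr.alg n u S = walg n u S"
  by (simp add: fun_eq_iff wr.alg_def wr.act_def walg_def)

lemmas clinear_walg = wr.clinear_alg[unfolded alg_eq_walg]
  and walg_conv = wr.alg_conv[unfolded alg_eq_walg]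
  and walg_supp_on = wr.alg_supp[unfolded alg_eq_walg]
  and dim_walg_image = wr.dim_alg_image[unfolded alg_eq_walg]

lemma clinear_wact: "clinear (wact r n g)"
  by (rule clinearI)
     (auto simp: wact_def fun_eq_iff sum.distrib sum_distrib_left algebra_simps)

lemma wact_walg: "wact r n g (walg n u S) = walg n u (wact r n g S)"
proof
  fix w
  show "wact r n g (walg n u S) w = walg n u (wact r n g S) w"
  proof (cases "w \<in> words r n")
    case w: True
    have "walg n u (wact r n g S) w
        = (\<Sum>\<sigma>\<in>Sn n. u \<sigma> * (\<Sum>t=1..n. \<Sum>q=1..r. g (w t) q * S (w(t := q) \<circ> \<sigma>)))"
      unfolding walg_apply
    proof (rule sum.cong)
      fix \<sigma> assume "\<sigma> \<in> Sn n"
      then have \<sigma>: "\<sigma> permutes {1..n}" by simp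
      let ?F = "\<lambda>t. \<Sum>q=1..r. g (w t) q * S (w(t := q) \<circ> \<sigma>)"
      have "wact r n g S (w \<circ> \<sigma>) = (\<Sum>t=1..n. ?F (\<sigma> t))"
        using PiE_comp_permutes[OF w \<sigma>] by (simp add: wact_def fun_upd_comp_permutes[OF \<sigma>])
      also have "\<dots> = (\<Sum>t=1..n. ?F t)"
        using sum.permute[OF \<sigma>, of ?F] by (simp only: comp_def)
      finally show "u \<sigma> * wact r n g S (w \<circ> \<sigma>) = u \<sigma> * (\<Sum>t=1..n. ?F t)" by simp
    qed simp
    also have "\<dots> = (\<Sum>\<sigma>\<in>Sn n. \<Sum>t=1..n. \<Sum>q=1..r. g (w t) q * (u \<sigma> * S (w(t := q) \<circ> \<sigma>)))"
      by (simp add: sum_distrib_left mult_ac)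
    also have "\<dots> = (\<Sum>t=1..n. \<Sum>q=1..r. \<Sum>\<sigma>\<in>Sn n. g (w t) q * (u \<sigma> * S (w(t := q) \<circ> \<sigma>)))"
      by (subst sum.swap, intro sum.cong refl, rule sum.swap)
    also have "\<dots> = wact r n g (walg n u S) w"
      using w by (simp add: wact_def walg_apply sum_distrib_left)
    finally show ?thesis by simp
  next
    case False
    have "wact r n g S (w \<circ> \<sigma>) = 0" if "\<sigma> permutes {1..n}" for \<sigma>
      using False by (simp add: wact_def PiE_comp_permutes_iff[OF that])
    then show ?thesis using False by (simp add: wact_def walg_apply)
  qed
qed

lemma walg_sym_unit_comp:
  assumes p: "p \<in> stab n f"
  shows "walg n (sym_elt n f) (unit_vec (w \<circ> p)) = walg n (sym_elt n f) (unit_vec w)"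
proof
  fix v
  have pp: "p permutes {1..n}" using p by (rule stab_permutes)
  have "walg n (sym_elt n f) (unit_vec (w \<circ> p)) v
      = (\<Sum>\<sigma>\<in>Sn n. sym_elt n f (\<sigma> \<circ> p) * unit_vec (w \<circ> p) (v \<circ> (\<sigma> \<circ> p)))"
    unfolding walg_apply by (rule sum_Sn_right[OF pp, symmetric])
  also have "\<dots> = walg n (sym_elt n f) (unit_vec w) v"
    unfolding walg_apply
    by (rule sum.cong)
       (simp_all add: sym_elt_def comp_stab_iff(2)[OF p] unit_vec_def comp_assoc[symmetric] comp_permutes_eq_iff(1)[OF pp])
  finally show "walg n (sym_elt n f) (unit_vec (w \<circ> p)) v = walg n (sym_elt n f) (unit_vec w) v" .
qed

lemma wact_Emat_unit:
  assumes w: "w \<in> words r n" and xy: "x \<in> {1..r}" "y \<in> {1..r}"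
  shows "wact r n (Emat x y) (unit_vec w) = (\<Sum>t\<in>{t \<in> {1..n}. w t = y}. unit_vec (w(t := x)))"
proof
  fix v
  have R: "(\<Sum>t\<in>{t \<in> {1..n}. w t = y}. unit_vec (w(t := x))) v
      = (\<Sum>t\<in>{1..n}. if w t = y \<and> v = w(t := x) then 1 else 0)"
    unfolding sum_fun_apply unit_vec_def
    by (rule sum.mono_neutral_cong_left) auto
  show "wact r n (Emat x y) (unit_vec w) v = (\<Sum>t\<in>{t \<in> {1..n}. w t = y}. unit_vec (w(t := x))) v"
  proof (cases "v \<in> words r n")
    case True
    have "(\<Sum>q=1..r. Emat x y (v t) q * unit_vec w (v(t := q))) = (if w t = y \<and> v = w(t := x) then 1 else 0)" for t
    proof -
      have "(\<Sum>q=1..r. Emat x y (v t) q * unit_vec w (v(t := q)))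
          = (\<Sum>q=1..r. if q = y then (if v t = x \<and> v(t := y) = w then 1 else 0) else 0)"
        by (rule sum.cong) (auto simp: Emat_def unit_vec_def)
      also have "\<dots> = (if v t = x \<and> v(t := y) = w then 1 else 0)" using xy by simp
      also have "v t = x \<and> v(t := y) = w \<longleftrightarrow> w t = y \<and> v = w(t := x)" by (auto simp: fun_eq_iff)
      finally show ?thesis .
    qed
    then show ?thesis unfolding R using True by (simp add: wact_def)
  next
    case False
    have "v \<noteq> w(t := x)" if "t \<in> {1..n}" for t
      using False PiE_fun_upd[OF xy(1) w, of t] that by (auto simp: insert_absorb)
    then show ?thesis unfolding R using False by (simp add: wact_def)
  qed
qed

lemma walg_sym_unit_base:
  assumes w0: "w\<^sub>0 \<in> words r n" and f: "\<And>t. t \<in> {1..n} \<Longrightarrow> w\<^sub>0 t = f t"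
  shows "walg n (sym_elt n f) (unit_vec w\<^sub>0) = vscale (of_nat (card (stab n f))) (unit_vec w\<^sub>0)"
proof
  fix v
  have "walg n (sym_elt n f) (unit_vec w\<^sub>0) v = (\<Sum>\<sigma>\<in>Sn n. if \<sigma> \<in> stab n f then unit_vec w\<^sub>0 v else 0)"
    unfolding walg_apply
  proof (rule sum.cong)
    fix \<sigma> assume "\<sigma> \<in> Sn n"
    then have \<sigma>: "\<sigma> permutes {1..n}" by simp
    have "w\<^sub>0 \<circ> \<sigma> = w\<^sub>0" if "\<sigma> \<in> stab n f"
    proof
      fix t
      show "(w\<^sub>0 \<circ> \<sigma>) t = w\<^sub>0 t"
        using that f[of t] f[of "\<sigma> t"] permutes_in[OF \<sigma>, of t] permutes_not_in[OF \<sigma>, of t]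
        by (cases "t \<in> {1..n}") (simp_all add: stab_def)
    qed
    then have "unit_vec w\<^sub>0 (v \<circ> \<sigma>) = unit_vec w\<^sub>0 v" if "\<sigma> \<in> stab n f"
      using that comp_permutes_eq_iff(1)[OF \<sigma>, of v w\<^sub>0] by (simp add: unit_vec_def)
    then show "sym_elt n f \<sigma> * unit_vec w\<^sub>0 (v \<circ> \<sigma>) = (if \<sigma> \<in> stab n f then unit_vec w\<^sub>0 v else 0)"
      by (simp add: sym_elt_def)
  qed simp
  also have "\<dots> = (\<Sum>\<sigma>\<in>stab n f. unit_vec w\<^sub>0 v)"
    by (rule sum.mono_neutral_cong_right) (auto dest: stab_permutes)
  finally show "walg n (sym_elt n f) (unit_vec w\<^sub>0) v = vscale (of_nat (card (stab n f))) (unit_vec w\<^sub>0) v" by simp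
qed

definition wspan :: "nat \<Rightarrow> nat \<Rightarrow> (nat \<Rightarrow> nat) \<Rightarrow> (nat \<Rightarrow> nat) vec set" where
  "wspan r n w = cvec.span {foldr (wact r n) gs (unit_vec w) | gs. True}"

lemma wspan_base: "unit_vec w \<in> wspan r n w"
  unfolding wspan_def by (rule cvec.span_base) (auto intro: exI[of _ "[]"])

lemma subspace_wspan: "cvec.subspace (wspan r n w)"
  by (simp add: wspan_def)

lemma wspan_wact:
  assumes "S \<in> wspan r n w"
  shows "wact r n g S \<in> wspan r n w"
proof -
  interpret a: Vector_Spaces.linear vscale vscale "wact r n g" by (rule clinear_wact)
  have "wact r n g ` {foldr (wact r n) gs (unit_vec w) | gs. True} \<subseteq> {foldr (wact r n) gs (unit_vec w) | gs. True}"
  proof (rule image_subsetI)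
    fix S assume "S \<in> {foldr (wact r n) gs (unit_vec w) | gs. True}"
    then obtain gs where "S = foldr (wact r n) gs (unit_vec w)" by auto
    then have "wact r n g S = foldr (wact r n) (g # gs) (unit_vec w)" by simp
    then show "wact r n g S \<in> {foldr (wact r n) gs (unit_vec w) | gs. True}" by blast
  qed
  then show ?thesis
    using assms a.span_image cvec.span_mono unfolding wspan_def by blast
qed

text \<open>
  Induction on the number of positions where \<open>w\<close> differs from \<open>w\<^sub>0\<close>. Undo one difference, where a letter \<open>y\<close> had been
  turned into \<open>x\<close>, and apply the matrix unit that turns \<open>y\<close> into \<open>x\<close>. It may change any letter \<open>y\<close>. Where \<open>w\<^sub>0\<close> also has
  the letter \<open>y\<close> the result is \<open>w\<close> up to a row permutation, which the symmetrization does not see; elsewhere there are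
  no more differences than before the matrix unit was applied. The first kind occurs with a positive multiplicity.
\<close>

lemma symmetrized_word_in_wspan:
  assumes w0: "w\<^sub>0 \<in> words r n" and f: "\<And>t. t \<in> {1..n} \<Longrightarrow> w\<^sub>0 t = f t"
    and w: "w \<in> words r n"
  shows "walg n (sym_elt n f) (unit_vec w) \<in> wspan r n w\<^sub>0"
  using w
proof (induction "card {t \<in> {1..n}. w t \<noteq> w\<^sub>0 t}" arbitrary: w rule: less_induct)
  case less
  let ?A = "walg n (sym_elt n f)" and ?U = "wspan r n w\<^sub>0"
  interpret A: Vector_Spaces.linear vscale vscale ?A by (rule clinear_walg)
  show ?case
  proof (cases "\<exists>t\<in>{1..n}. w t \<noteq> w\<^sub>0 t")
    case False
    then have "w = w\<^sub>0" using less.prems w0 by (intro PiE_ext) auto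
    then show ?thesis
      using cvec.subspace_scale[OF subspace_wspan wspan_base] walg_sym_unit_base[OF w0 f] by simp
  next
    case True
    then obtain t0 where t0: "t0 \<in> {1..n}" "w t0 \<noteq> w\<^sub>0 t0" by blast
    define x where "x = w t0"
    define y where "y = w\<^sub>0 t0"
    define w' where "w' = w(t0 := y)"
    have xy: "x \<in> {1..r}" "y \<in> {1..r}" "x \<noteq> y"
      using PiE_mem[OF less.prems t0(1)] PiE_mem[OF w0 t0(1)] t0(2) by (auto simp: x_def y_def)
    have upd: "v(t := z) \<in> words r n" if "v \<in> words r n" "t \<in> {1..n}" "z \<in> {1..r}" for v t z
      using PiE_fun_upd[OF that(3,1), of t] that(2) by (simp add: insert_absorb)
    have w': "w' \<in> words r n" unfolding w'_def by (rule upd[OF less.prems t0(1) xy(2)])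
    let ?D = "\<lambda>w. {t \<in> {1..n}. w t \<noteq> w\<^sub>0 t}"
    have D': "?D w' = ?D w - {t0}" by (auto simp: w'_def y_def)
    have less': "card (?D w') < card (?D w)"
      unfolding D' by (rule card_Diff1_less) (use t0 in auto)
    have "wact r n (Emat x y) (?A (unit_vec w')) \<in> ?U"
      by (rule wspan_wact) (rule less.hyps[OF less' w'])
    then have inU: "(\<Sum>t\<in>{t \<in> {1..n}. w' t = y}. ?A (unit_vec (w'(t := x)))) \<in> ?U"
      unfolding wact_walg wact_Emat_unit[OF w' xy(1,2)] A.sum .
    let ?Y1 = "{t \<in> {1..n}. w' t = y \<and> w\<^sub>0 t = y}" and ?Y2 = "{t \<in> {1..n}. w' t = y \<and> w\<^sub>0 t \<noteq> y}"
    have "{t \<in> {1..n}. w' t = y} = ?Y1 \<union> ?Y2" by auto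
    then have split: "(\<Sum>t\<in>{t \<in> {1..n}. w' t = y}. ?A (unit_vec (w'(t := x))))
        = (\<Sum>t\<in>?Y1. ?A (unit_vec (w'(t := x)))) + (\<Sum>t\<in>?Y2. ?A (unit_vec (w'(t := x))))"
      by (simp only:) (rule sum.union_disjoint, auto)
    have Y2: "(\<Sum>t\<in>?Y2. ?A (unit_vec (w'(t := x)))) \<in> ?U"
    proof (rule cvec.subspace_sum[OF subspace_wspan])
      fix t assume t: "t \<in> ?Y2"
      have "?D (w'(t := x)) \<subseteq> ?D w'" using t by auto
      then have "card (?D (w'(t := x))) \<le> card (?D w')" by (rule card_mono[rotated]) simp
      with less' have "card (?D (w'(t := x))) < card (?D w)" by simp
      moreover have "w'(t := x) \<in> words r n" by (rule upd[OF w' _ xy(1)]) (use t in simp)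
      ultimately show "?A (unit_vec (w'(t := x))) \<in> ?U" by (rule less.hyps)
    qed
    have "?A (unit_vec (w'(t := x))) = ?A (unit_vec w)" if t: "t \<in> ?Y1" for t
    proof -
      have st: "transpose t0 t \<in> stab n f"
        using t t0(1) f[OF t0(1)] f[of t] by (intro transpose_stab) (auto simp: y_def)
      have "w'(t := x) = w \<circ> transpose t0 t"
        using t t0(1) by (auto simp: fun_eq_iff w'_def x_def transpose_def split: if_splits)
      then show ?thesis using walg_sym_unit_comp[OF st] by simp
    qed
    then have Y1: "(\<Sum>t\<in>?Y1. ?A (unit_vec (w'(t := x)))) = vscale (of_nat (card ?Y1)) (?A (unit_vec w))"
      by (simp add: fun_eq_iff sum_fun_apply)
    have "t0 \<in> ?Y1" using t0(1) by (simp add: w'_def y_def)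
    then have c: "card ?Y1 \<noteq> 0" by auto
    have "vscale (of_nat (card ?Y1)) (?A (unit_vec w)) \<in> ?U"
      using cvec.subspace_diff[OF subspace_wspan inU Y2] unfolding split Y1 by simp
    from cvec.subspace_scale[OF subspace_wspan this, of "inverse (of_nat (card ?Y1))"]
    show ?thesis using c by simp
  qed
qed

text \<open>
  The Lie algebra generates from the word \<open>w\<^sub>0\<close> all row-symmetric vectors, as the image of its universal enveloping
  algebra is the commutant of the symmetric group.
\<close>

lemma wspan_eq_symmetrized:
  assumes w0: "w\<^sub>0 \<in> words r n" and f: "\<And>t. t \<in> {1..n} \<Longrightarrow> w\<^sub>0 t = f t"
  shows "wspan r n w\<^sub>0 = walg n (sym_elt n f) ` supp_on (words r n)"
proof
  let ?A = "walg n (sym_elt n f)"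
  interpret A: Vector_Spaces.linear vscale vscale ?A by (rule clinear_walg)
  have sub: "cvec.subspace (?A ` supp_on (words r n))"
    by (rule A.subspace_image[OF subspace_supp_on])
  show "?A ` supp_on (words r n) \<subseteq> wspan r n w\<^sub>0"
  proof (rule image_subsetI)
    fix S assume S: "S \<in> supp_on (words r n)"
    have "?A S = (\<Sum>w\<in>words r n. vscale (S w) (?A (unit_vec w)))"
      by (subst vec_expand[OF finite_words S]) (simp add: A.sum A.scale)
    also have "\<dots> \<in> wspan r n w\<^sub>0"
      by (intro cvec.subspace_sum[OF subspace_wspan] cvec.subspace_scale[OF subspace_wspan]
          symmetrized_word_in_wspan[OF w0 f])
    finally show "?A S \<in> wspan r n w\<^sub>0" .
  qed
  have gen: "foldr (wact r n) gs (unit_vec w\<^sub>0) \<in> ?A ` supp_on (words r n)" for gs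
  proof (induction gs)
    case Nil
    have u: "unit_vec w\<^sub>0 \<in> supp_on (words r n)" using w0 by (auto simp: supp_on_def unit_vec_def)
    have base: "?A (unit_vec w\<^sub>0) = vscale (of_nat (card (stab n f))) (unit_vec w\<^sub>0)"
      by (rule walg_sym_unit_base[OF w0]) (rule f)
    have "?A (vscale (inverse (of_nat (card (stab n f)))) (unit_vec w\<^sub>0)) = unit_vec w\<^sub>0"
      unfolding A.scale base cvec.scale_scale using stab_card_pos[of n f] by simp
    then show ?case using cvec.subspace_scale[OF subspace_supp_on u] by (metis foldr_Nil id_apply image_eqI)
  next
    case (Cons g gs)
    then obtain S where S: "foldr (wact r n) gs (unit_vec w\<^sub>0) = ?A S" by blast
    have "wact r n g S \<in> supp_on (words r n)" by (simp add: supp_on_def wact_def)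
    then show ?case by (simp only: S foldr_Cons comp_apply wact_walg) (rule imageI)
  qed
  show "wspan r n w\<^sub>0 \<subseteq> ?A ` supp_on (words r n)"
    unfolding wspan_def by (rule cvec.span_minimal[OF _ sub]) (use gen in blast)
qed

text \<open>
  An antisymmetric tensor whose levels are a rearrangement of \<open>f\<close> is determined by its coefficients at the labels with
  levels exactly \<open>f\<close>. Reading these off turns the exterior power into a space of words without losing the action of
  the Lie algebra on the first components.
\<close>

definition restrict_levels :: "nat \<Rightarrow> nat \<Rightarrow> (nat \<Rightarrow> int) \<Rightarrow> tens \<Rightarrow> (nat \<Rightarrow> nat) vec" where
  "restrict_levels r n f T = (\<lambda>w. if w \<in> words r n then T (\<lambda>t\<in>{1..n}. (w t, f t)) else 0)"

lemma clinear_restrict_levels: "clinear (restrict_levels r n f)"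
  by (rule clinearI) (auto simp: restrict_levels_def fun_eq_iff)

lemma restrict_levels_gl_act:
  assumes f: "\<And>t. t \<in> {1..n} \<Longrightarrow> f t < N"
  shows "restrict_levels r n f (gl_act_calV r N n g T) = wact r n g (restrict_levels r n f T)"
proof
  fix w
  let ?b = "\<lambda>w. \<lambda>t\<in>{1..n}. (w t, f t)"
  show "restrict_levels r n f (gl_act_calV r N n g T) w = wact r n g (restrict_levels r n f T) w"
  proof (cases "w \<in> words r n")
    case w: True
    have "?b w \<in> {1..n} \<rightarrow>\<^sub>E Vbasis r N"
      using PiE_mem[OF w] f by (intro restrict_PiE_iff[THEN iffD2]) (auto simp: Vbasis_def)
    then have "restrict_levels r n f (gl_act_calV r N n g T) w
        = (\<Sum>t=1..n. \<Sum>q=1..r. g (fst (?b w t)) q * T ((?b w)(t := (q, snd (?b w t)))))"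
      using w unfolding restrict_levels_def gl_act_calV_apply by simp
    also have "\<dots> = (\<Sum>t=1..n. \<Sum>q=1..r. g (w t) q * restrict_levels r n f T (w(t := q)))"
    proof (intro sum.cong refl)
      fix t q assume t: "t \<in> {1..n}" and q: "q \<in> {1..r}"
      have "w(t := q) \<in> words r n" using PiE_fun_upd[OF q w, of t] t by (simp add: insert_absorb)
      moreover have "(?b w)(t := (q, snd (?b w t))) = ?b (w(t := q))"
        using t by (auto simp: fun_eq_iff)
      ultimately show "g (fst (?b w t)) q * T ((?b w)(t := (q, snd (?b w t))))
          = g (w t) q * restrict_levels r n f T (w(t := q))"
        using t by (simp add: restrict_levels_def)
    qed
    also have "\<dots> = wact r n g (restrict_levels r n f T) w" using w by (simp add: wact_def)
    finally show ?thesis .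
  qed (simp add: restrict_levels_def wact_def)
qed

text \<open>
  In the generating vector the rows of the diagram are aligned at their right ends, in the tableau at their left ends. Reversing the rows, which is a row permutation, relates the two.
\<close>

lemma row_reversal:
  assumes \<eta>: "\<eta> \<in> partitions_of n"
  obtains \<rho> where "\<rho> permutes {1..n}"
    "\<And>t. t \<in> {1..n} \<Longrightarrow> tab_row \<eta> (\<rho> t) = tab_row \<eta> t"
    "\<And>t. t \<in> {1..n} \<Longrightarrow> tab_col \<eta> (\<rho> t) = part \<eta> (tab_row \<eta> t) + 1 - tab_col \<eta> t"
proof -
  have n: "sum_list \<eta> = n" using \<eta> by (simp add: partitions_of_def)
  let ?c = "\<lambda>t. part \<eta> (tab_row \<eta> t) + 1 - tab_col \<eta> t"
  define \<rho> where "\<rho> t = (if t \<in> {1..n} then rows_len \<eta> (tab_row \<eta> t - 1) + ?c t else t)" for t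
  have cell: "1 \<le> tab_row \<eta> t" "1 \<le> ?c t" "?c t \<le> part \<eta> (tab_row \<eta> t)" if "t \<in> {1..n}" for t
    using tab_row_pos[of t \<eta>] tab_col_pos[of t \<eta>] tab_col_le[of t \<eta>] that n by auto
  have \<rho>: "\<rho> t \<in> {1..n}" "tab_row \<eta> (\<rho> t) = tab_row \<eta> t" "tab_col \<eta> (\<rho> t) = ?c t" if "t \<in> {1..n}" for t
    using cell_in_range[OF cell[OF that]] tab_row_cell[OF cell[OF that]] tab_col_cell[OF cell[OF that]] that n
    by (simp_all add: \<rho>_def)
  have "\<rho> (\<rho> t) = t" if t: "t \<in> {1..n}" for t
  proof -
    have "\<rho> (\<rho> t) = rows_len \<eta> (tab_row \<eta> t - 1) + (part \<eta> (tab_row \<eta> t) + 1 - ?c t)"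
      using \<rho>[OF t] unfolding \<rho>_def[of "\<rho> t"] by simp
    also have "part \<eta> (tab_row \<eta> t) + 1 - ?c t = tab_col \<eta> t" using cell[OF t] t n tab_col_le[of t \<eta>] by simp
    finally show ?thesis using tab_decompose[of t \<eta>] t n by simp
  qed
  then have "bij_betw \<rho> {1..n} {1..n}"
    using \<rho>(1) by (intro bij_betw_byWitness[where f' = \<rho>]) auto
  then have "\<rho> permutes {1..n}" by (rule bij_imp_permutes) (auto simp: \<rho>_def)
  then show thesis using that \<rho>(2,3) by blast
qed

text \<open>
  The permutations contributing to the coefficients at the levels \<open>-col\<close> form one coset of the column group, the one of
  the row reversal; so the generating vector becomes, up to a sign, the column antisymmetrization of the row word.
\<close>

lemma restrict_levels_vxi:
  assumes \<eta>: "\<eta> \<in> partitions_of n" and r: "length \<eta> \<le> r"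
  defines "w\<^sub>0 \<equiv> \<lambda>t\<in>{1..n}. tab_row \<eta> t"
  obtains s :: complex where "s \<noteq> 0"
    "restrict_levels r n (\<lambda>t. - int (tab_col \<eta> t)) (vxi r \<eta> 0) = vscale s (walg n (alt_elt n (tab_col \<eta>)) (unit_vec w\<^sub>0))"
proof -
  have n: "sum_list \<eta> = n" using \<eta> by (simp add: partitions_of_def)
  obtain \<rho> where \<rho>: "\<rho> permutes {1..n}"
    "\<And>t. t \<in> {1..n} \<Longrightarrow> tab_row \<eta> (\<rho> t) = tab_row \<eta> t"
    "\<And>t. t \<in> {1..n} \<Longrightarrow> tab_col \<eta> (\<rho> t) = part \<eta> (tab_row \<eta> t) + 1 - tab_col \<eta> t"
    using row_reversal[OF \<eta>] by blast
  let ?f = "\<lambda>t. - int (tab_col \<eta> t)" and ?C = "stab n (tab_col \<eta>)"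
  have w0: "w\<^sub>0 \<in> words r n"
    unfolding w\<^sub>0_def using tab_row_pos[of _ \<eta>] tab_row_le_length[of _ \<eta>] r n
    by (intro restrict_PiE_iff[THEN iffD2]) force
  have iff: "(\<lambda>t\<in>{1..n}. (w t, ?f t)) = vinit \<eta> 0 \<circ> \<sigma> \<longleftrightarrow> \<rho> \<circ> \<sigma> \<in> ?C \<and> w = w\<^sub>0 \<circ> (\<rho> \<circ> \<sigma>)"
    if \<sigma>: "\<sigma> permutes {1..n}" and w: "w \<in> words r n" for \<sigma> w
  proof -
    have "(\<lambda>t\<in>{1..n}. (w t, ?f t)) t = (vinit \<eta> 0 \<circ> \<sigma>) t \<longleftrightarrow>
        w t = w\<^sub>0 (\<rho> (\<sigma> t)) \<and> tab_col \<eta> (\<rho> (\<sigma> t)) = tab_col \<eta> t" if t: "t \<in> {1..n}" for t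
    proof -
      have st: "\<sigma> t \<in> {1..n}" "\<rho> (\<sigma> t) \<in> {1..n}" using permutes_in[OF \<sigma> t] permutes_in[OF \<rho>(1)] by auto
      have le: "tab_col \<eta> (\<sigma> t) \<le> part \<eta> (tab_row \<eta> (\<sigma> t))" using tab_col_le[of "\<sigma> t" \<eta>] st n by simp
      have "w\<^sub>0 (\<rho> (\<sigma> t)) = tab_row \<eta> (\<sigma> t)" using st \<rho>(2) by (simp add: w\<^sub>0_def)
      moreover have "?f t = - int (part \<eta> (tab_row \<eta> (\<sigma> t))) + int (tab_col \<eta> (\<sigma> t)) - 1 \<longleftrightarrow>
          tab_col \<eta> (\<rho> (\<sigma> t)) = tab_col \<eta> t"
        unfolding \<rho>(3)[OF st(1)] using le by auto
      ultimately show ?thesis using t st n by (simp add: vinit_def)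
    qed
    moreover have "(\<lambda>t\<in>{1..n}. (w t, ?f t)) t = (vinit \<eta> 0 \<circ> \<sigma>) t" "w t = w\<^sub>0 (\<rho> (\<sigma> t))" if t: "t \<notin> {1..n}" for t
      using t \<sigma> \<rho>(1) PiE_arb[OF w t] n
      by (simp_all only: permutes_not_in[OF \<sigma> t] permutes_not_in[OF \<rho>(1) t] comp_apply vinit_def w\<^sub>0_def restrict_apply if_False)
    moreover have "\<rho> \<circ> \<sigma> \<in> ?C \<longleftrightarrow> (\<forall>t\<in>{1..n}. tab_col \<eta> (\<rho> (\<sigma> t)) = tab_col \<eta> t)"
      using permutes_comp[OF \<rho>(1) \<sigma>] by (simp add: stab_def)
    ultimately show ?thesis unfolding fun_eq_iff comp_apply by blast
  qed
  have "restrict_levels r n ?f (vxi r \<eta> 0) w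
      = of_int (sign \<rho>) * walg n (alt_elt n (tab_col \<eta>)) (unit_vec w\<^sub>0) w" for w
  proof (cases "w \<in> words r n")
    case w: True
    have "restrict_levels r n ?f (vxi r \<eta> 0) w
        = (\<Sum>\<sigma>\<in>Sn n. if \<rho> \<circ> \<sigma> \<in> ?C \<and> w = w\<^sub>0 \<circ> (\<rho> \<circ> \<sigma>) then of_int (sign \<sigma>) else 0)"
      unfolding vxi_eq_altv[OF r] n restrict_levels_def altv_def if_P[OF w]
      by (rule sum.cong) (simp_all add: iff w)
    also have "\<dots> = (\<Sum>\<sigma>\<in>Sn n. of_int (sign \<rho>) *
        (\<lambda>\<sigma>. if \<sigma> \<in> ?C \<and> w = w\<^sub>0 \<circ> \<sigma> then of_int (sign \<sigma>) else 0) (\<rho> \<circ> \<sigma>))"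
      by (rule sum.cong) (simp_all add: permutes_sign_comp[OF \<rho>(1)])
    also have "\<dots> = of_int (sign \<rho>) * (\<Sum>\<sigma>\<in>Sn n. if \<sigma> \<in> ?C \<and> w = w\<^sub>0 \<circ> \<sigma> then of_int (sign \<sigma>) else 0)"
      unfolding sum_distrib_left[symmetric] by (rule arg_cong[OF sum_Sn_left[OF \<rho>(1)]])
    also have "(\<Sum>\<sigma>\<in>Sn n. if \<sigma> \<in> ?C \<and> w = w\<^sub>0 \<circ> \<sigma> then of_int (sign \<sigma>) else 0)
        = (\<Sum>\<sigma>\<in>Sn n. (\<lambda>\<sigma>. if \<sigma> \<in> ?C \<and> w = w\<^sub>0 \<circ> \<sigma> then of_int (sign \<sigma>) else (0::complex)) (inv \<sigma>))"
      by (rule sum_Sn_inv[symmetric])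
    also have "\<dots> = walg n (alt_elt n (tab_col \<eta>)) (unit_vec w\<^sub>0) w"
      unfolding walg_apply
    proof (rule sum.cong)
      fix \<sigma> assume "\<sigma> \<in> Sn n"
      then have \<sigma>: "\<sigma> permutes {1..n}" by simp
      show "(if inv \<sigma> \<in> ?C \<and> w = w\<^sub>0 \<circ> inv \<sigma> then of_int (sign (inv \<sigma>)) else 0)
          = alt_elt n (tab_col \<eta>) \<sigma> * unit_vec w\<^sub>0 (w \<circ> \<sigma>)"
        using comp_permutes_eq_iff(2)[OF \<sigma>, of w w\<^sub>0]
        by (simp add: alt_elt_def unit_vec_def inv_stab_iff[OF \<sigma>] permutes_sign_inv[OF \<sigma>])
    qed simp
    finally show ?thesis .
  next
    case False
    have "unit_vec w\<^sub>0 (w \<circ> \<sigma>) = 0" if "\<sigma> permutes {1..n}" for \<sigma>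
      using False w0 PiE_comp_permutes_iff[OF that, of w "{1..r}"] by (auto simp: unit_vec_def)
    then show ?thesis using False by (simp add: restrict_levels_def walg_apply)
  qed
  then have "restrict_levels r n ?f (vxi r \<eta> 0)
      = vscale (of_int (sign \<rho>)) (walg n (alt_elt n (tab_col \<eta>)) (unit_vec w\<^sub>0))" by (simp add: fun_eq_iff)
  then show thesis by (rule that[rotated]) simp
qed

lemma pairing_conv_commute:
  assumes "class_fun n \<chi>"
  shows "pairing n (conv n x y) \<chi> = pairing n (conv n y x) \<chi>"
proof -
  have expand: "pairing n (conv n x y) \<chi> = (\<Sum>\<sigma>\<in>Sn n. \<Sum>\<tau>\<in>Sn n. x \<sigma> * (y \<tau> * \<chi> (\<sigma> \<circ> \<tau>)))" for x y
  proof -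
    have "pairing n (conv n x y) \<chi> = (\<Sum>\<tau>\<in>Sn n. \<Sum>\<sigma>\<in>Sn n. x \<sigma> * (y (inv \<sigma> \<circ> \<tau>) * \<chi> \<tau>))"
      unfolding pairing_def by (rule sum.cong) (auto simp: conv_apply sum_distrib_right mult.assoc)
    also have "\<dots> = (\<Sum>\<sigma>\<in>Sn n. \<Sum>\<tau>\<in>Sn n. x \<sigma> * (y (inv \<sigma> \<circ> \<tau>) * \<chi> \<tau>))" by (rule sum.swap)
    also have "\<dots> = (\<Sum>\<sigma>\<in>Sn n. \<Sum>\<tau>\<in>Sn n. x \<sigma> * (y \<tau> * \<chi> (\<sigma> \<circ> \<tau>)))"
    proof (rule sum.cong)
      fix \<sigma> assume "\<sigma> \<in> Sn n"
      then have \<sigma>: "\<sigma> permutes {1..n}" by simp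
      have "(\<Sum>\<tau>\<in>Sn n. x \<sigma> * (y (inv \<sigma> \<circ> \<tau>) * \<chi> \<tau>))
          = (\<Sum>\<tau>\<in>Sn n. x \<sigma> * (y (inv \<sigma> \<circ> (\<sigma> \<circ> \<tau>)) * \<chi> (\<sigma> \<circ> \<tau>)))"
        by (rule sum_Sn_left[OF \<sigma>, symmetric])
      then show "(\<Sum>\<tau>\<in>Sn n. x \<sigma> * (y (inv \<sigma> \<circ> \<tau>) * \<chi> \<tau>)) = (\<Sum>\<tau>\<in>Sn n. x \<sigma> * (y \<tau> * \<chi> (\<sigma> \<circ> \<tau>)))"
        by (simp add: permutes_cancel[OF \<sigma>])
    qed simp
    finally show ?thesis .
  qed
  have comm: "\<chi> (\<sigma> \<circ> \<tau>) = \<chi> (\<tau> \<circ> \<sigma>)" if "\<sigma> permutes {1..n}" "\<tau> permutes {1..n}" for \<sigma> \<tau>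
    using class_funD[OF assms permutes_comp[OF that] that(1)] by (simp add: permutes_cancel[OF that(1)])
  have "pairing n (conv n x y) \<chi> = (\<Sum>\<tau>\<in>Sn n. \<Sum>\<sigma>\<in>Sn n. x \<sigma> * (y \<tau> * \<chi> (\<sigma> \<circ> \<tau>)))"
    unfolding expand by (rule sum.swap)
  also have "\<dots> = pairing n (conv n y x) \<chi>"
    unfolding expand by (intro sum.cong refl) (simp add: comm mult_ac)
  finally show ?thesis .
qed

lemma gl_act_diag:
  assumes "b \<in> {1..n} \<rightarrow>\<^sub>E Vbasis r N"
  shows "gl_act_calV r N n (Emat p p) T b = of_nat (count_of n (fst \<circ> b) p) * T b"
proof -
  have b: "b t \<in> {1..r} \<times> {..<N}" if "t \<in> {1..n}" for t
    using PiE_mem[OF assms that] by (simp add: Vbasis_def)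
  have "(fst \<circ> b) t \<in> {1..r}" if "t \<in> {1..n}" for t using b[OF that] by (auto simp: mem_Times_iff)
  moreover have "b(t := (fst (b t), snd (b t))) = b" for t by simp
  ultimately show ?thesis
    using sum_diag_Emat[of n "fst \<circ> b" r "\<lambda>t q. T (b(t := (q, snd (b t))))" "T b" p] assms
    by (simp add: gl_act_calV_apply)
qed

text \<open>
  A space of tensors that contains the irreducible module and on which the restriction to fixed levels is injective.
\<close>

definition level_orbit :: "nat \<Rightarrow> nat \<Rightarrow> int \<Rightarrow> (nat \<Rightarrow> int) \<Rightarrow> tens set" where
  "level_orbit r n N f = {T \<in> supp_on ({1..n} \<rightarrow>\<^sub>E Vbasis r N). antisym n T \<and>
     (\<forall>b. T b \<noteq> 0 \<longrightarrow> (\<exists>\<sigma>. \<sigma> permutes {1..n} \<and> (\<forall>t\<in>{1..n}. snd (b (\<sigma> t)) = f t)))}"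

lemma subspace_level_orbit: "cvec.subspace (level_orbit r n N f)"
proof (rule csubspaceI)
  show "0 \<in> level_orbit r n N f" by (simp add: level_orbit_def supp_on_def antisym_def)
next
  fix S T assume S: "S \<in> level_orbit r n N f" and T: "T \<in> level_orbit r n N f"
  have "S + T \<in> supp_on ({1..n} \<rightarrow>\<^sub>E Vbasis r N)" "antisym n (S + T)"
    using S T by (auto simp: level_orbit_def supp_on_def antisym_def distrib_left)
  moreover have "S b \<noteq> 0 \<or> T b \<noteq> 0" if "(S + T) b \<noteq> 0" for b using that by auto
  ultimately show "S + T \<in> level_orbit r n N f" using S T unfolding level_orbit_def by blast
next
  fix k T assume T: "T \<in> level_orbit r n N f"
  then show "vscale k T \<in> level_orbit r n N f"
    by (auto simp: level_orbit_def supp_on_def antisym_def mult_ac)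
qed

lemma level_orbit_gl_act:
  assumes T: "T \<in> level_orbit r n N f"
  shows "gl_act_calV r N n g T \<in> level_orbit r n N f"
proof -
  let ?T = "gl_act_calV r N n g T"
  have "?T \<in> supp_on ({1..n} \<rightarrow>\<^sub>E Vbasis r N)" by (simp add: supp_on_def gl_act_calV_apply)
  moreover have "antisym n ?T"
    using T unfolding gl_act_calV_def level_orbit_def by (simp add: antisym_gact)
  moreover have "\<exists>\<sigma>. \<sigma> permutes {1..n} \<and> (\<forall>t\<in>{1..n}. snd (b (\<sigma> t)) = f t)" if nz: "?T b \<noteq> 0" for b
  proof -
    have "\<exists>t q. T (b(t := (q, snd (b t)))) \<noteq> 0"
    proof (rule ccontr)
      assume "\<nexists>t q. T (b(t := (q, snd (b t)))) \<noteq> 0"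
      then have "?T b = 0" by (simp add: gl_act_calV_apply)
      then show False using nz by simp
    qed
    then obtain u q where "T (b(u := (q, snd (b u)))) \<noteq> 0" by blast
    then obtain \<sigma> where "\<sigma> permutes {1..n}" "\<forall>t\<in>{1..n}. snd ((b(u := (q, snd (b u)))) (\<sigma> t)) = f t"
      using T unfolding level_orbit_def by blast
    moreover have "snd ((b(u := (q, snd (b u)))) t) = snd (b t)" for t by simp
    ultimately show ?thesis by auto
  qed
  ultimately show ?thesis by (simp add: level_orbit_def)
qed

lemma level_orbit_restrict:
  assumes T: "T \<in> level_orbit r n N f" and b: "T b \<noteq> 0"
  obtains \<sigma> w where "\<sigma> permutes {1..n}" "w \<in> words r n" "\<forall>t\<in>{1..n}. w t = fst (b (\<sigma> t))"
    "restrict_levels r n f T w = of_int (sign \<sigma>) * T b" "b \<in> {1..n} \<rightarrow>\<^sub>E Vbasis r N"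
proof -
  obtain \<sigma> where \<sigma>: "\<sigma> permutes {1..n}" "\<forall>t\<in>{1..n}. snd (b (\<sigma> t)) = f t"
    using T b unfolding level_orbit_def by blast
  have lab: "b \<in> {1..n} \<rightarrow>\<^sub>E Vbasis r N" using T b by (auto simp: level_orbit_def supp_on_def)
  define w where "w = (\<lambda>t\<in>{1..n}. fst (b (\<sigma> t)))"
  have w: "w \<in> words r n"
    unfolding w_def
  proof (rule restrict_PiE_iff[THEN iffD2], rule ballI)
    fix t assume "t \<in> {1..n}"
    then have "b (\<sigma> t) \<in> Vbasis r N" using PiE_mem[OF lab permutes_in[OF \<sigma>(1)]] by blast
    then show "fst (b (\<sigma> t)) \<in> {1..r}" by (auto simp: Vbasis_def)
  qed
  have "b \<circ> \<sigma> = (\<lambda>t\<in>{1..n}. (w t, f t))"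
  proof
    fix t
    show "(b \<circ> \<sigma>) t = (\<lambda>t\<in>{1..n}. (w t, f t)) t"
    proof (cases "t \<in> {1..n}")
      case True
      then have "w t = fst (b (\<sigma> t))" "f t = snd (b (\<sigma> t))" using \<sigma>(2) by (simp_all add: w_def)
      then show ?thesis using True by simp
    next
      case False
      then show ?thesis using PiE_arb[OF PiE_comp_permutes[OF lab \<sigma>(1)] False] by (simp only: restrict_apply if_False)
    qed
  qed
  then have "restrict_levels r n f T w = T (b \<circ> \<sigma>)" using w by (simp add: restrict_levels_def)
  also have "\<dots> = of_int (sign \<sigma>) * T b"
    using T antisymD[OF _ \<sigma>(1), of T b] by (simp add: level_orbit_def)
  finally show thesis using that[OF \<sigma>(1) w _ _ lab] by (simp add: w_def)
qed

lemma vxi_level_orbit: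
  assumes \<eta>: "\<eta> \<in> partitions_of n" and r: "length \<eta> \<le> r"
  shows "vxi r \<eta> 0 \<in> level_orbit r n 0 (\<lambda>t. - int (tab_col \<eta> t))"
proof -
  have n: "sum_list \<eta> = n" using \<eta> by (simp add: partitions_of_def)
  obtain \<rho> where \<rho>: "\<rho> permutes {1..n}"
    "\<And>t. t \<in> {1..n} \<Longrightarrow> tab_row \<eta> (\<rho> t) = tab_row \<eta> t"
    "\<And>t. t \<in> {1..n} \<Longrightarrow> tab_col \<eta> (\<rho> t) = part \<eta> (tab_row \<eta> t) + 1 - tab_col \<eta> t"
    using row_reversal[OF \<eta>] by blast
  have init: "vinit \<eta> 0 \<in> {1..n} \<rightarrow>\<^sub>E Vbasis r 0"
    unfolding vinit_def n
  proof (rule restrict_PiE_iff[THEN iffD2], rule ballI)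
    fix t assume "t \<in> {1..n}"
    then show "(tab_row \<eta> t, 0 - int (part \<eta> (tab_row \<eta> t)) + int (tab_col \<eta> t) - 1) \<in> Vbasis r 0"
      using tab_row_pos[of t \<eta>] tab_col_le[of t \<eta>] tab_row_le_length[of t \<eta>] r n
      by (auto simp: Vbasis_def)
  qed
  have lev: "snd (vinit \<eta> 0 (\<rho> t)) = - int (tab_col \<eta> t)" if t: "t \<in> {1..n}" for t
    using permutes_in[OF \<rho>(1) t] \<rho>(2,3)[OF t] tab_col_le[of t \<eta>] t n by (simp add: vinit_def)
  have ex: "\<exists>\<sigma>. \<sigma> permutes {1..n} \<and> b = vinit \<eta> 0 \<circ> \<sigma>" if "altv n (vinit \<eta> 0) b \<noteq> 0" for b
    by (rule altv_nonzeroD[OF that]) blast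
  show ?thesis
    unfolding vxi_eq_altv[OF r] n level_orbit_def
  proof (intro CollectI conjI allI impI antisym_altv)
    show "altv n (vinit \<eta> 0) \<in> supp_on ({1..n} \<rightarrow>\<^sub>E Vbasis r 0)"
      unfolding supp_on_def using ex PiE_comp_permutes[OF init] by blast
    fix b assume "altv n (vinit \<eta> 0) b \<noteq> 0"
    then obtain \<sigma> where \<sigma>: "\<sigma> permutes {1..n}" "b = vinit \<eta> 0 \<circ> \<sigma>" using ex by blast
    have "snd (b ((inv \<sigma> \<circ> \<rho>) t)) = - int (tab_col \<eta> t)" if "t \<in> {1..n}" for t
      using lev[OF that] by (simp add: \<sigma>(2) permutes_inverses[OF \<sigma>(1)])
    then show "\<exists>\<sigma>. \<sigma> permutes {1..n} \<and> (\<forall>t\<in>{1..n}. snd (b (\<sigma> t)) = - int (tab_col \<eta> t))"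
      using permutes_comp[OF permutes_inv[OF \<sigma>(1)] \<rho>(1)] by blast
  qed
qed

text \<open>
  The Lie algebra commutes with the column antisymmetrizer \<open>b\<close>, so it generates \<open>b\<close> applied to all row-symmetric
  vectors, which is the image of \<open>b a\<close>.
\<close>

lemma restrict_levels_gl_irrep:
  assumes \<eta>: "\<eta> \<in> partitions_of n" and r: "length \<eta> \<le> r"
  shows "restrict_levels r n (\<lambda>t. - int (tab_col \<eta> t)) ` gl_irrep r \<eta>
    = walg n (conv n (alt_elt n (tab_col \<eta>)) (sym_elt n (tab_row \<eta>))) ` supp_on (words r n)"
proof -
  have n: "sum_list \<eta> = n" using \<eta> by (simp add: partitions_of_def)
  let ?f = "\<lambda>t. - int (tab_col \<eta> t)" and ?B = "walg n (alt_elt n (tab_col \<eta>))"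
  let ?\<Theta> = "restrict_levels r n ?f"
  define w\<^sub>0 where "w\<^sub>0 = (\<lambda>t\<in>{1..n}. tab_row \<eta> t)"
  obtain s :: complex where s: "s \<noteq> 0" "?\<Theta> (vxi r \<eta> 0) = vscale s (?B (unit_vec w\<^sub>0))"
    using restrict_levels_vxi[OF \<eta> r] unfolding w\<^sub>0_def by blast
  interpret \<Theta>: Vector_Spaces.linear vscale vscale ?\<Theta> by (rule clinear_restrict_levels)
  interpret B: Vector_Spaces.linear vscale vscale ?B by (rule clinear_walg)
  interpret sc: Vector_Spaces.linear vscale vscale "vscale s"
    by (rule clinearI) (simp_all add: cvec.scale_right_distrib mult.commute)
  have w0: "w\<^sub>0 \<in> words r n"
    unfolding w\<^sub>0_def using tab_row_pos[of _ \<eta>] tab_row_le_length[of _ \<eta>] r n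
    by (intro restrict_PiE_iff[THEN iffD2]) force
  have lt: "?f t < 0" if "t \<in> {1..n}" for t using tab_col_pos[of t \<eta>] that n by simp
  have gen: "?\<Theta> (foldr (gl_act_calV r 0 n) gs (vxi r \<eta> 0)) = vscale s (?B (foldr (wact r n) gs (unit_vec w\<^sub>0)))" for gs
  proof (induction gs)
    case Nil then show ?case using s by simp
  next
    case (Cons g gs)
    interpret W: Vector_Spaces.linear vscale vscale "wact r n g" by (rule clinear_wact)
    have "?\<Theta> (gl_act_calV r 0 n g T) = wact r n g (?\<Theta> T)" for T
      by (rule restrict_levels_gl_act) (rule lt)
    then show ?case by (simp only: foldr_Cons comp_apply Cons.IH W.scale wact_walg)
  qed
  have "?\<Theta> ` gl_irrep r \<eta> = cvec.span (?\<Theta> ` {foldr (gl_act_calV r 0 n) gs (vxi r \<eta> 0) | gs. True})"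
    unfolding gl_irrep_def n by (rule \<Theta>.span_image[symmetric])
  also have "?\<Theta> ` {foldr (gl_act_calV r 0 n) gs (vxi r \<eta> 0) | gs. True}
      = vscale s ` (?B ` {foldr (wact r n) gs (unit_vec w\<^sub>0) | gs. True})"
  proof -
    have "{foldr (gl_act_calV r 0 n) gs (vxi r \<eta> 0) | gs. True} = range (\<lambda>gs. foldr (gl_act_calV r 0 n) gs (vxi r \<eta> 0))"
      "{foldr (wact r n) gs (unit_vec w\<^sub>0) | gs. True} = range (\<lambda>gs. foldr (wact r n) gs (unit_vec w\<^sub>0))"
      by blast+
    then show ?thesis by (simp only: image_image gen)
  qed
  also have "cvec.span \<dots> = vscale s ` (?B ` wspan r n w\<^sub>0)"
    unfolding wspan_def sc.span_image B.span_image ..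
  also have "\<dots> = ?B ` wspan r n w\<^sub>0"
  proof -
    have sub: "cvec.subspace (?B ` wspan r n w\<^sub>0)" by (rule B.subspace_image[OF subspace_wspan])
    have "T \<in> vscale s ` (?B ` wspan r n w\<^sub>0)" if T: "T \<in> ?B ` wspan r n w\<^sub>0" for T
    proof (rule image_eqI)
      show "T = vscale s (vscale (inverse s) T)" using s(1) by simp
    qed (rule cvec.subspace_scale[OF sub T])
    then show ?thesis using cvec.subspace_scale[OF sub] by blast
  qed
  also have "wspan r n w\<^sub>0 = walg n (sym_elt n (tab_row \<eta>)) ` supp_on (words r n)"
    by (rule wspan_eq_symmetrized[OF w0]) (simp add: w\<^sub>0_def)
  finally show ?thesis by (simp only: image_image walg_conv)
qed

text \<open>
  The weight space is the image of \<open>b a\<close> on words of fixed content. Its dimension is the normalized trace of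
  \<open>b a\<close>, which equals the trace of \<open>a b\<close>, the Young symmetrizer.
\<close>

theorem ch_gl_irrep:
  assumes \<eta>: "\<eta> \<in> partitions_of n" and r: "part \<eta> (r + 1) = 0"
  shows "of_int (ch r (gl_act_calV r 0 n) (gl_irrep r \<eta>) \<mu>)
    = pairing n (word_char r n \<mu>) (young_symmetrizer \<eta>) / hook_prod \<eta>"
proof -
  have n: "sum_list \<eta> = n" and nz: "0 \<notin> set \<eta>" using \<eta> by (auto simp: partitions_of_def)
  have len: "length \<eta> \<le> r"
  proof (rule ccontr)
    assume "\<not> length \<eta> \<le> r"
    then have "part \<eta> (r + 1) \<in> set \<eta>" by (simp add: part_def)
    then show False using r nz by simp
  qed
  let ?f = "\<lambda>t. - int (tab_col \<eta> t)" and ?W = "gl_irrep r \<eta>"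
  let ?\<Theta> = "restrict_levels r n ?f"
  let ?u = "conv n (alt_elt n (tab_col \<eta>)) (sym_elt n (tab_row \<eta>))"
  let ?X = "words_of_weight r n \<mu>"
  let ?W\<mu> = "{T \<in> ?W. \<forall>p\<in>{1..r}. gl_act_calV r 0 n (Emat p p) T = vscale (\<mu> p) T}"
  interpret \<Theta>: Vector_Spaces.linear vscale vscale ?\<Theta> by (rule clinear_restrict_levels)
  have W_sub: "cvec.subspace ?W" by (simp add: gl_irrep_def)
  have "foldr (gl_act_calV r 0 n) gs (vxi r \<eta> 0) \<in> level_orbit r n 0 ?f" for gs
    by (induction gs) (simp_all add: vxi_level_orbit[OF \<eta> len] level_orbit_gl_act)
  then have W_orb: "?W \<subseteq> level_orbit r n 0 ?f"
    unfolding gl_irrep_def n by (intro cvec.span_minimal subspace_level_orbit) blast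
  have inj: "inj_on ?\<Theta> ?W"
  proof (rule inj_onI)
    fix S T assume ST: "S \<in> ?W" "T \<in> ?W" "?\<Theta> S = ?\<Theta> T"
    have D: "S - T \<in> level_orbit r n 0 ?f" using ST W_orb cvec.subspace_diff[OF W_sub] by blast
    have z: "?\<Theta> (S - T) = 0" using ST by (simp add: \<Theta>.diff)
    have "(S - T) b = 0" for b
    proof (rule ccontr)
      assume b: "(S - T) b \<noteq> 0"
      obtain \<sigma> w where "\<sigma> permutes {1..n}" "w \<in> words r n" "\<forall>t\<in>{1..n}. w t = fst (b (\<sigma> t))"
        "?\<Theta> (S - T) w = of_int (sign \<sigma>) * (S - T) b" "b \<in> {1..n} \<rightarrow>\<^sub>E Vbasis r 0"
        by (rule level_orbit_restrict[OF D b])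
      then show False using b by (simp add: z)
    qed
    then show "S = T" by (simp add: fun_eq_iff)
  qed
  have count: "count_of n (fst \<circ> b) p = count_of n w p"
    if "\<sigma> permutes {1..n}" "\<forall>t\<in>{1..n}. w t = fst (b (\<sigma> t))" for \<sigma> w b p
  proof -
    have "count_of n w p = count_of n (fst \<circ> b \<circ> \<sigma>) p"
      unfolding count_of_def using that(2) by (intro arg_cong[of _ _ card]) auto
    then show ?thesis using count_of_comp[OF that(1), of "fst \<circ> b" p] by simp
  qed
  have "?\<Theta> ` ?W\<mu> = walg n ?u ` supp_on ?X"
  proof
    show "?\<Theta> ` ?W\<mu> \<subseteq> walg n ?u ` supp_on ?X"
    proof (rule image_subsetI)
      fix T assume T: "T \<in> ?W\<mu>"
      have supp: "?\<Theta> T w = 0" if w: "w \<notin> ?X" for w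
      proof (cases "w \<in> words r n")
        case True
        let ?b = "\<lambda>t\<in>{1..n}. (w t, ?f t)"
        have b: "?b \<in> {1..n} \<rightarrow>\<^sub>E Vbasis r 0"
        proof (rule restrict_PiE_iff[THEN iffD2], rule ballI)
          fix t assume t: "t \<in> {1..n}"
          then show "(w t, ?f t) \<in> Vbasis r 0"
            using PiE_mem[OF True t] tab_col_pos[of t \<eta>] n by (simp add: Vbasis_def)
        qed
        obtain p where p: "p \<in> {1..r}" "of_nat (count_of n w p) \<noteq> \<mu> p"
          using w True unfolding words_of_weight_def by blast
        have c: "count_of n (fst \<circ> ?b) p = count_of n w p"
          unfolding count_of_def by (rule arg_cong[of _ _ card]) auto
        have "gl_act_calV r 0 n (Emat p p) T = vscale (\<mu> p) T" using T p(1) by blast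
        from fun_cong[OF this, of ?b] have "of_nat (count_of n w p) * T ?b = \<mu> p * T ?b"
          unfolding gl_act_diag[OF b] c vscale_apply .
        then have "T ?b = 0" using p(2) by (metis mult_cancel_right)
        then show ?thesis unfolding restrict_levels_def by simp
      qed (simp add: restrict_levels_def)
      have "T \<in> ?W" using T by blast
      then have "?\<Theta> T \<in> ?\<Theta> ` ?W" by (rule imageI)
      then obtain S where S: "S \<in> supp_on (words r n)" "?\<Theta> T = walg n ?u S"
        unfolding restrict_levels_gl_irrep[OF \<eta> len] by (elim imageE)
      \<comment> \<open>The image of \<open>S\<close> at words of weight \<open>\<mu>\<close> depends only on its values there.\<close>
      define S' where "S' = (\<lambda>w. if w \<in> ?X then S w else 0)"
      have S': "S' \<in> supp_on ?X" by (simp add: S'_def supp_on_def)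
      have "walg n ?u S' w = walg n ?u S w" for w
      proof (cases "w \<in> ?X")
        case True
        then show ?thesis unfolding walg_apply
          by (intro sum.cong) (simp_all add: S'_def words_of_weight_comp)
      next
        case False
        have "walg n ?u S' w = 0"
          by (rule supp_onD[OF walg_supp_on[OF S'] False])
        then show ?thesis using supp[OF False] S(2) by simp
      qed
      then have "?\<Theta> T = walg n ?u S'" unfolding S(2) by (intro ext) simp
      with S' show "?\<Theta> T \<in> walg n ?u ` supp_on ?X" by blast
    qed
    show "walg n ?u ` supp_on ?X \<subseteq> ?\<Theta> ` ?W\<mu>"
    proof (rule image_subsetI)
      fix S assume S: "S \<in> supp_on ?X"
      then have "S \<in> supp_on (words r n)" using words_of_weight_subset[of r n \<mu>] by (auto simp: supp_on_def)
      then have "walg n ?u S \<in> ?\<Theta> ` ?W" unfolding restrict_levels_gl_irrep[OF \<eta> len] by blast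
      then obtain T where T: "T \<in> ?W" "walg n ?u S = ?\<Theta> T" by blast
      have supp: "walg n ?u S \<in> supp_on ?X" by (rule walg_supp_on[OF S])
      have "gl_act_calV r 0 n (Emat p p) T = vscale (\<mu> p) T" if p: "p \<in> {1..r}" for p
      proof
        fix b
        show "gl_act_calV r 0 n (Emat p p) T b = vscale (\<mu> p) T b"
        proof (cases "T b = 0")
          case True
          show ?thesis
          proof (cases "b \<in> {1..n} \<rightarrow>\<^sub>E Vbasis r 0")
            case True then show ?thesis using \<open>T b = 0\<close> by (simp add: gl_act_diag)
          next
            case False then show ?thesis using \<open>T b = 0\<close> by (simp add: gl_act_calV_apply)
          qed
        next
          case False
          obtain \<sigma> w where w: "\<sigma> permutes {1..n}" "w \<in> words r n" "\<forall>t\<in>{1..n}. w t = fst (b (\<sigma> t))"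
            "?\<Theta> T w = of_int (sign \<sigma>) * T b" "b \<in> {1..n} \<rightarrow>\<^sub>E Vbasis r 0"
            by (rule level_orbit_restrict[OF subsetD[OF W_orb T(1)] False])
          have "?\<Theta> T w \<noteq> 0" using w(4) False by simp
          then have "w \<in> ?X" using supp T(2) by (auto simp: supp_on_def)
          then have "of_nat (count_of n w p) = \<mu> p" using p by (simp add: words_of_weight_def)
          then show ?thesis by (simp add: gl_act_diag[OF w(5)] count[OF w(1,3)])
        qed
      qed
      then show "walg n ?u S \<in> ?\<Theta> ` ?W\<mu>" using T by blast
    qed
  qed
  moreover have "cvec.subspace ?W\<mu>"
  proof -
    have "?W\<mu> = ?W \<inter> (\<Inter>p\<in>{1..r}. {T. gl_act_calV r 0 n (Emat p p) T - vscale (\<mu> p) T = 0})" by auto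
    moreover have "cvec.subspace {T. gl_act_calV r 0 n (Emat p p) T - vscale (\<mu> p) T = 0}" for p
    proof -
      interpret g: Vector_Spaces.linear vscale vscale "gl_act_calV r 0 n (Emat p p)"
        unfolding gl_act_calV_def by (rule clinear_gact)
      show ?thesis
        by (rule csubspaceI)
           (simp_all add: g.add g.scale cvec.scale_right_distrib mult.commute)
    qed
    ultimately show ?thesis
      using W_sub by (auto intro!: cvec.subspace_inter cvec.subspace_Int)
  qed
  moreover have "inj_on ?\<Theta> ?W\<mu>" by (rule inj_on_subset[OF inj]) blast
  ultimately have dim: "cvec.dim ?W\<mu> = cvec.dim (walg n ?u ` supp_on ?X)"
    using cpair.dim_linear_image_inj[OF clinear_restrict_levels, of ?W\<mu> r n ?f] by simp
  have k: "hook_prod \<eta> \<noteq> 0" and uu: "conv n ?u ?u = vscale (hook_prod \<eta>) ?u"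
    using tableau.young_norm_nonzero[OF tableau_of_partition[OF \<eta>]]
      tableau.reversed_young_square[OF tableau_of_partition[OF \<eta>]] by (simp_all add: n)
  have "hook_prod \<eta> * of_nat (cvec.dim (walg n ?u ` supp_on ?X)) = pairing n ?u (word_char r n \<mu>)"
    by (rule dim_walg_image[OF uu k])
  also have "\<dots> = pairing n (young_symmetrizer \<eta>) (word_char r n \<mu>)"
    unfolding young_symmetrizer_eq_young[OF n[symmetric]] young_def
    by (rule pairing_conv_commute) (rule wr.class_fun_character)
  also have "\<dots> = pairing n (word_char r n \<mu>) (young_symmetrizer \<eta>)"
    by (simp add: pairing_def mult.commute)
  finally show ?thesis using k by (simp add: ch_eq_dim dim field_simps)
qed

section \<open>Matrix units acting on antisymmetric tensors\<close>

definition alt_space :: "nat \<Rightarrow> (nat \<Rightarrow> 'a) set \<Rightarrow> (nat \<Rightarrow> 'a) vec set" where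
  "alt_space n D = {T \<in> supp_on D. antisym n T}"

lemma subspace_alt_space: "cvec.subspace (alt_space n D)"
  by (rule csubspaceI) (auto simp: alt_space_def supp_on_def antisym_def distrib_left mult_ac)

lemma altv_expand:
  assumes D: "finite D" and T: "T \<in> alt_space n D"
  shows "vscale (fact n) T = (\<Sum>b\<in>D. vscale (T b) (altv n b))"
proof
  fix b'
  have TD: "T \<in> supp_on D" and anti: "antisym n T" using T by (auto simp: alt_space_def)
  have "(\<Sum>b\<in>D. vscale (T b) (altv n b)) b'
      = (\<Sum>b\<in>D. \<Sum>\<sigma>\<in>Sn n. if b = b' \<circ> inv \<sigma> then of_int (sign \<sigma>) * T b else 0)"
    unfolding sum_fun_apply vscale_apply altv_def sum_distrib_left
  proof (intro sum.cong refl)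
    fix b \<sigma> assume "\<sigma> \<in> Sn n"
    then have "b' = b \<circ> \<sigma> \<longleftrightarrow> b = b' \<circ> inv \<sigma>" using comp_permutes_eq_iff(2)[of \<sigma> "{1..n}" b b'] by auto
    then show "T b * (if b' = b \<circ> \<sigma> then of_int (sign \<sigma>) else 0)
        = (if b = b' \<circ> inv \<sigma> then of_int (sign \<sigma>) * T b else 0)" by simp
  qed
  also have "\<dots> = (\<Sum>\<sigma>\<in>Sn n. \<Sum>b\<in>D. if b = b' \<circ> inv \<sigma> then of_int (sign \<sigma>) * T b else 0)"
    by (rule sum.swap)
  also have "\<dots> = (\<Sum>\<sigma>\<in>Sn n. T b')"
  proof (rule sum.cong)
    fix \<sigma> assume "\<sigma> \<in> Sn n"
    then have \<sigma>: "\<sigma> permutes {1..n}" by simp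
    have "(\<Sum>b\<in>D. if b = b' \<circ> inv \<sigma> then of_int (sign \<sigma>) * T b else 0) = of_int (sign \<sigma>) * T (b' \<circ> inv \<sigma>)"
      using D supp_onD[OF TD, of "b' \<circ> inv \<sigma>"] by (cases "b' \<circ> inv \<sigma> \<in> D") simp_all
    also have "\<dots> = T b'"
      by (simp add: antisymD[OF anti permutes_inv[OF \<sigma>]] permutes_sign_inv[OF \<sigma>])
    finally show "(\<Sum>b\<in>D. if b = b' \<circ> inv \<sigma> then of_int (sign \<sigma>) * T b else 0) = T b'" .
  qed simp
  also have "\<dots> = fact n * T b'" using card_permutations[of "{1..n}" n] by simp
  finally show "vscale (fact n) T b' = (\<Sum>b\<in>D. vscale (T b) (altv n b)) b'" by simp
qed

lemma antisym_noninjective_zero: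
  assumes T: "antisym n T" and b: "\<not> inj_on b {1..n}"
  shows "T b = 0"
proof -
  obtain s t where st: "s \<in> {1..n}" "t \<in> {1..n}" "s \<noteq> t" "b s = b t" using b unfolding inj_on_def by blast
  have "b \<circ> transpose s t = b" using st(4) by (auto simp: transpose_def fun_eq_iff)
  then have "T b = of_int (sign (transpose s t)) * T b"
    using antisymD[OF T permutes_swap_id[OF st(1,2)], of b] by simp
  then show ?thesis using st(3) by (simp add: sign_swap_id)
qed

lemma lagrange_polynomial:
  assumes "finite F" "v \<in> (F :: complex set)"
  obtains p :: "complex poly" where "\<And>u. u \<in> F \<Longrightarrow> poly p u = (if u = v then 1 else 0)"
proof
  let ?q = "\<Prod>u\<in>F - {v}. [:- u, 1:]"
  have q: "poly ?q x = (\<Prod>u\<in>F - {v}. x - u)" for x by (simp add: poly_prod)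
  have "poly ?q v \<noteq> 0" unfolding q using assms by simp
  moreover have "poly ?q u = 0" if "u \<in> F" "u \<noteq> v" for u
    unfolding q using assms that by (intro prod_zero) auto
  ultimately show "poly (smult (inverse (poly ?q v)) ?q) u = (if u = v then 1 else 0)" if "u \<in> F" for u
    using that by simp
qed

definition vmult :: "('x \<Rightarrow> complex) \<Rightarrow> 'x vec \<Rightarrow> 'x vec" where
  "vmult e T = (\<lambda>x. e x * T x)"

lemma clinear_vmult: "clinear (vmult e)"
  by (rule clinearI) (auto simp: vmult_def fun_eq_iff algebra_simps)

lemma vmult_stable_polynomial:
  assumes V: "cvec.subspace V" and e: "\<And>T. T \<in> V \<Longrightarrow> vmult e T \<in> V" and T: "T \<in> V"
  shows "vmult (\<lambda>x. poly p (e x)) T \<in> V"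
  using T
proof (induction p arbitrary: T)
  case 0
  then show ?case using cvec.subspace_0[OF V] by (simp add: vmult_def zero_fun_def)
next
  case (pCons a p)
  have "vmult (\<lambda>x. poly (pCons a p) (e x)) T = vscale a T + vmult e (vmult (\<lambda>x. poly p (e x)) T)"
    by (auto simp: vmult_def fun_eq_iff algebra_simps)
  also have "\<dots> \<in> V"
    by (rule cvec.subspace_add[OF V cvec.subspace_scale[OF V pCons.prems] e[OF pCons.IH[OF pCons.prems]]])
  finally show ?case .
qed

text \<open>
  A function of a diagonal operator with finitely many eigenvalues is a polynomial in it.
\<close>

lemma vmult_stable_comp:
  assumes V: "cvec.subspace V" and supp: "V \<subseteq> supp_on X" and F: "finite F" "e ` X \<subseteq> F"
    and e: "\<And>T. T \<in> V \<Longrightarrow> vmult e T \<in> V" and T: "T \<in> V"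
  shows "vmult (\<lambda>x. \<phi> (e x)) T \<in> V"
proof -
  have "\<exists>p. \<forall>u\<in>F. poly p u = (if u = v then 1 else 0)" if "v \<in> F" for v
    using lagrange_polynomial[OF F(1) that] by metis
  then obtain p where p: "\<And>u v. u \<in> F \<Longrightarrow> v \<in> F \<Longrightarrow> poly (p v) u = (if u = v then 1 else 0)" by metis
  have "vmult (\<lambda>x. \<phi> (e x)) T = (\<Sum>v\<in>F. vscale (\<phi> v) (vmult (\<lambda>x. poly (p v) (e x)) T))"
  proof
    fix x
    show "vmult (\<lambda>x. \<phi> (e x)) T x = (\<Sum>v\<in>F. vscale (\<phi> v) (vmult (\<lambda>x. poly (p v) (e x)) T)) x"
    proof (cases "x \<in> X")
      case True
      then have ex: "e x \<in> F" using F by auto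
      have "(\<Sum>v\<in>F. vscale (\<phi> v) (vmult (\<lambda>x. poly (p v) (e x)) T)) x = (\<Sum>v\<in>F. if v = e x then \<phi> v * T x else 0)"
        unfolding sum_fun_apply by (rule sum.cong) (auto simp: vmult_def p ex)
      then show ?thesis using F ex by (simp add: vmult_def)
    next
      case False
      then have "T x = 0" using T supp by (auto simp: supp_on_def)
      then show ?thesis by (simp add: sum_fun_apply vmult_def)
    qed
  qed
  also have "\<dots> \<in> V"
    by (intro cvec.subspace_sum[OF V] cvec.subspace_scale[OF V] vmult_stable_polynomial[OF V] e T)
  finally show ?thesis .
qed

definition levels_ge :: "nat \<Rightarrow> (nat \<Rightarrow> nat \<times> int) \<Rightarrow> int \<Rightarrow> nat" where
  "levels_ge n b s = card {t \<in> {1..n}. s \<le> snd (b t)}"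

definition level_sum :: "nat \<Rightarrow> (nat \<Rightarrow> nat \<times> int) \<Rightarrow> int" where
  "level_sum n b = (\<Sum>t=1..n. snd (b t))"

text \<open>
  The labels of degree \<open>i\<close> that lie above \<open>b\<^sub>0\<close>: the operators only raise levels, so that from every level on there
  remain at least as many labels as for \<open>b\<^sub>0\<close>.
\<close>

definition reachable :: "nat \<Rightarrow> nat \<Rightarrow> int \<Rightarrow> (nat \<Rightarrow> nat \<times> int) \<Rightarrow> int \<Rightarrow> (nat \<Rightarrow> nat \<times> int) set" where
  "reachable r n N b\<^sub>0 i = {b \<in> {1..n} \<rightarrow>\<^sub>E Vbasis r N.
     (\<forall>s. levels_ge n b\<^sub>0 s \<le> levels_ge n b s) \<and> level_sum n b = level_sum n b\<^sub>0 + i}"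

lemma finite_reachable:
  assumes b0: "\<And>t. t \<in> {1..n} \<Longrightarrow> s\<^sub>0 \<le> snd (b\<^sub>0 t)"
  shows "finite (reachable r n N b\<^sub>0 i)"
proof (rule finite_subset)
  show "reachable r n N b\<^sub>0 i \<subseteq> {1..n} \<rightarrow>\<^sub>E ({1..r} \<times> {s\<^sub>0..<N})"
  proof
    fix b assume b: "b \<in> reachable r n N b\<^sub>0 i"
    then have lab: "b \<in> {1..n} \<rightarrow>\<^sub>E Vbasis r N" by (simp add: reachable_def)
    have "{t \<in> {1..n}. s\<^sub>0 \<le> snd (b\<^sub>0 t)} = {1..n}" using b0 by blast
    then have "levels_ge n b\<^sub>0 s\<^sub>0 = n" by (simp add: levels_ge_def)
    moreover have "levels_ge n b\<^sub>0 s\<^sub>0 \<le> levels_ge n b s\<^sub>0" using b by (simp add: reachable_def)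
    ultimately have "card {1..n} \<le> card {t \<in> {1..n}. s\<^sub>0 \<le> snd (b t)}" by (simp add: levels_ge_def)
    then have "{t \<in> {1..n}. s\<^sub>0 \<le> snd (b t)} = {1..n}"
      by (intro card_seteq) auto
    then have lev: "s\<^sub>0 \<le> snd (b t)" if "t \<in> {1..n}" for t using that by blast
    show "b \<in> {1..n} \<rightarrow>\<^sub>E ({1..r} \<times> {s\<^sub>0..<N})"
    proof (rule PiE_I)
      fix t assume t: "t \<in> {1..n}"
      have "b t \<in> Vbasis r N" by (rule PiE_mem[OF lab t])
      then show "b t \<in> {1..r} \<times> {s\<^sub>0..<N}" using lev[OF t] by (auto simp: Vbasis_def mem_Times_iff)
    qed (rule PiE_arb[OF lab])
  qed
qed (rule finite_PiE, auto)

lemma gact_raises: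
  assumes T: "T \<in> alt_space n (reachable r n N b\<^sub>0 i)" and a: "a \<in> Gr_deg k"
  shows "gact r N n a T \<in> alt_space n (reachable r n N b\<^sub>0 (i + int k))"
proof -
  have "b \<in> reachable r n N b\<^sub>0 (i + int k)" if nz: "gact r N n a T b \<noteq> 0" for b
  proof -
    have lab: "b \<in> {1..n} \<rightarrow>\<^sub>E Vbasis r N" using nz by (auto simp: gact_def split: if_splits)
    have "\<exists>t\<in>{1..n}. \<exists>q. T (b(t := (q, snd (b t) - int k))) \<noteq> 0"
    proof (rule ccontr)
      assume no: "\<not> (\<exists>t\<in>{1..n}. \<exists>q. T (b(t := (q, snd (b t) - int k))) \<noteq> 0)"
      have kk: "k' = k" if "(k', l) \<in> gelt_supp a" for k' l using a that by (auto simp: Gr_deg_def)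
      have "gact r N n a T b = (\<Sum>t=1..n. \<Sum>(k, l)\<in>gelt_supp a. \<Sum>q=1..r. 0)"
        unfolding gact_def if_P[OF lab]
        using no kk by (intro sum.cong refl) (auto intro!: sum.neutral)
      then show False using nz by simp
    qed
    then obtain t q where t: "t \<in> {1..n}" "T (b(t := (q, snd (b t) - int k))) \<noteq> 0" by blast
    let ?b = "b(t := (q, snd (b t) - int k))"
    have b': "?b \<in> reachable r n N b\<^sub>0 i" using T t(2) by (auto simp: alt_space_def supp_on_def)
    have "levels_ge n ?b s \<le> levels_ge n b s" for s
      unfolding levels_ge_def by (rule card_mono) (auto split: if_splits)
    then have "\<forall>s. levels_ge n b\<^sub>0 s \<le> levels_ge n b s"
      using b' order_trans unfolding reachable_def by blast
    moreover have "level_sum n b = level_sum n ?b + int k"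
      using t(1) unfolding level_sum_def by (subst (1 2) sum.remove[of _ t]) auto
    ultimately show ?thesis using lab b' by (simp add: reachable_def)
  qed
  moreover have "antisym n (gact r N n a T)" using T by (simp add: alt_space_def antisym_gact)
  ultimately show ?thesis by (auto simp: alt_space_def supp_on_def)
qed

text \<open>
  By interpolation, the Lie algebra acts through every matrix unit that does not lower the level: a polynomial
  in \<open>\<Y>\<close> that is 1 at the level of \<open>c\<close> and 0 at the other levels which occur selects that level, \<open>\<X>\<^sup>k\<close> shifts it to the
  level of \<open>x\<close>, and the matrix in \<open>gl\<^sub>r\<close> changes the index.
\<close>

lemma matrix_unit_operator:
  assumes F: "finite F" and supp: "\<And>b t. T b \<noteq> 0 \<Longrightarrow> t \<in> {1..n} \<Longrightarrow> snd (b t) \<in> F"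
    and c: "snd c \<in> F" "fst c \<in> {1..r}" and le: "snd c \<le> snd x"
  shows "\<exists>a\<in>Gr_deg (nat (snd x - snd c)). \<forall>b\<in>{1..n} \<rightarrow>\<^sub>E Vbasis r N.
    gact r N n a T b = (\<Sum>t\<in>{1..n}. if b t = x then T (b(t := c)) else 0)"
proof -
  define k where "k = nat (snd x - snd c)"
  obtain p :: "complex poly" where p: "\<And>u. u \<in> of_int ` F \<Longrightarrow> poly p u = (if u = of_int (snd c) then 1 else 0)"
    using lagrange_polynomial[of "of_int ` F" "of_int (snd c)"] F c by auto
  define a :: gelt where "a = (\<lambda>k' l. if k' = k then (\<lambda>i j. coeff p l * Emat (fst x) (fst c) i j) else 0)"
  have supp_a: "gelt_supp a = (\<lambda>l. (k, l)) ` {l. coeff p l \<noteq> 0}"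
  proof -
    have "(\<lambda>i j. coeff p l * Emat (fst x) (fst c) i j) = 0 \<longleftrightarrow> coeff p l = 0" for l
      by (auto simp: fun_eq_iff Emat_def)
    then show ?thesis by (auto simp: gelt_supp_def a_def split: if_splits)
  qed
  have fin: "finite {l. coeff p l \<noteq> 0}"
    by (rule finite_subset[of _ "{..degree p}"]) (auto intro: le_degree)
  have "a \<in> Gr_deg k" using fin by (auto simp: Gr_deg_def Gr_def supp_a)
  moreover have "gact r N n a T b = (\<Sum>t\<in>{1..n}. if b t = x then T (b(t := c)) else 0)"
    if b: "b \<in> {1..n} \<rightarrow>\<^sub>E Vbasis r N" for b
    unfolding gact_def if_P[OF b]
  proof (rule sum.cong)
    fix t assume t: "t \<in> {1..n}"
    let ?i = "snd (b t) - int k" and ?T = "\<lambda>q. T (b(t := (q, snd (b t) - int k)))"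
    have "(\<Sum>(k, l)\<in>gelt_supp a. \<Sum>q=1..r. a k l (fst (b t)) q * of_int (snd (b t) - int k) ^ l
            * T (b(t := (q, snd (b t) - int k))))
        = (\<Sum>l\<in>{l. coeff p l \<noteq> 0}. \<Sum>q=1..r. coeff p l * Emat (fst x) (fst c) (fst (b t)) q * of_int ?i ^ l * ?T q)"
      unfolding supp_a by (subst sum.reindex) (auto simp: inj_on_def a_def)
    also have "\<dots> = (\<Sum>l\<in>{l. coeff p l \<noteq> 0}. coeff p l * of_int ?i ^ l *
        (if fst (b t) = fst x then ?T (fst c) else 0))"
    proof (rule sum.cong)
      fix l
      have "(\<Sum>q=1..r. coeff p l * Emat (fst x) (fst c) (fst (b t)) q * of_int ?i ^ l * ?T q)
          = (\<Sum>q=1..r. if q = fst c then coeff p l * of_int ?i ^ l * (if fst (b t) = fst x then ?T q else 0) else 0)"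
        by (rule sum.cong) (auto simp: Emat_def)
      also have "\<dots> = coeff p l * of_int ?i ^ l * (if fst (b t) = fst x then ?T (fst c) else 0)"
        using c(2) by (subst sum.delta) auto
      finally show "(\<Sum>q=1..r. coeff p l * Emat (fst x) (fst c) (fst (b t)) q * of_int ?i ^ l * ?T q)
          = coeff p l * of_int ?i ^ l * (if fst (b t) = fst x then ?T (fst c) else 0)" .
    qed simp
    also have "\<dots> = (\<Sum>l\<in>{l. coeff p l \<noteq> 0}. coeff p l * of_int ?i ^ l) * (if fst (b t) = fst x then ?T (fst c) else 0)"
      by (simp only: sum_distrib_right)
    also have "(\<Sum>l\<in>{l. coeff p l \<noteq> 0}. coeff p l * of_int ?i ^ l) = poly p (of_int ?i)"
      unfolding poly_altdef by (rule sum.mono_neutral_left) (auto intro: le_degree)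
    also have "poly p (of_int ?i) * (if fst (b t) = fst x then ?T (fst c) else 0)
        = (if b t = x then T (b(t := c)) else 0)"
    proof (cases "?T (fst c) = 0")
      case True
      have "b(t := (fst c, ?i)) = b(t := c)" if "b t = x"
        using that le by (simp add: k_def)
      then show ?thesis using True by auto
    next
      case False
      then have "?i \<in> F" using supp[OF False t] by simp
      then have "of_int ?i \<in> (of_int ` F :: complex set)" by (rule imageI)
      from p[OF this] have pi: "poly p (of_int ?i) = (if ?i = snd c then 1 else 0)"
        unfolding of_int_eq_iff .
      have "?i = snd c \<longleftrightarrow> snd (b t) = snd x" using le by (auto simp: k_def)
      moreover have "(fst c, ?i) = c" if "?i = snd c" using that by (metis prod.collapse)
      ultimately show ?thesis unfolding pi by (auto simp: prod_eq_iff)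
    qed
    finally show "(\<Sum>(k, l)\<in>gelt_supp a. \<Sum>q=1..r. a k l (fst (b t)) q * of_int (snd (b t) - int k) ^ l
            * T (b(t := (q, snd (b t) - int k)))) = (if b t = x then T (b(t := c)) else 0)" .
  qed simp
  ultimately show ?thesis unfolding k_def by blast
qed

text \<open>
  Replacing the label \<open>c\<close> by \<open>b t\<^sub>0\<close> in the wedge of \<open>b(t\<^sub>0 := c)\<close> gives the wedge of \<open>b\<close>, as \<open>c\<close> occurs only once.
\<close>

lemma replace_in_altv:
  assumes b: "b \<in> {1..n} \<rightarrow>\<^sub>E A" and t0: "t\<^sub>0 \<in> {1..n}"
    and c: "c \<notin> b ` {1..n}" and b2: "b\<^sub>2 \<in> {1..n} \<rightarrow>\<^sub>E A"
  shows "(\<Sum>t\<in>{1..n}. if b\<^sub>2 t = b t\<^sub>0 then altv n (b(t\<^sub>0 := c)) (b\<^sub>2(t := c)) else 0) = altv n b b\<^sub>2"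
proof -
  have iff: "b\<^sub>2 t = b t\<^sub>0 \<and> b\<^sub>2(t := c) = b(t\<^sub>0 := c) \<circ> \<sigma> \<longleftrightarrow> t = inv \<sigma> t\<^sub>0 \<and> b\<^sub>2 = b \<circ> \<sigma>"
    if \<sigma>: "\<sigma> permutes {1..n}" and t: "t \<in> {1..n}" for \<sigma> t
  proof
    assume L: "b\<^sub>2 t = b t\<^sub>0 \<and> b\<^sub>2(t := c) = b(t\<^sub>0 := c) \<circ> \<sigma>"
    then have eq: "(b\<^sub>2(t := c)) u = (b(t\<^sub>0 := c)) (\<sigma> u)" for u by (metis comp_apply)
    have st: "\<sigma> t = t\<^sub>0"
    proof (rule ccontr)
      assume "\<sigma> t \<noteq> t\<^sub>0"
      then have "c = b (\<sigma> t)" using eq[of t] by simp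
      then show False using c permutes_in[OF \<sigma> t] by blast
    qed
    then have 1: "t = inv \<sigma> t\<^sub>0" using permutes_inverses(2)[OF \<sigma>, of t] by simp
    have "b\<^sub>2 u = b (\<sigma> u)" for u
    proof (cases "u = t")
      case True then show ?thesis using L st by simp
    next
      case False
      then have "\<sigma> u \<noteq> t\<^sub>0" using st permutes_inj[OF \<sigma>] by (metis injD)
      then show ?thesis using eq[of u] False by simp
    qed
    then have "b\<^sub>2 = b \<circ> \<sigma>" by (simp add: fun_eq_iff)
    with 1 show "t = inv \<sigma> t\<^sub>0 \<and> b\<^sub>2 = b \<circ> \<sigma>" by simp
  next
    assume R: "t = inv \<sigma> t\<^sub>0 \<and> b\<^sub>2 = b \<circ> \<sigma>"
    then have st: "\<sigma> t = t\<^sub>0" using permutes_inverses(1)[OF \<sigma>] by simp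
    have "(b\<^sub>2(t := c)) u = (b(t\<^sub>0 := c) \<circ> \<sigma>) u" for u
    proof (cases "u = t")
      case False
      then have "\<sigma> u \<noteq> t\<^sub>0" using st permutes_inj[OF \<sigma>] by (metis injD)
      then show ?thesis using R False by simp
    qed (simp add: st)
    then have "b\<^sub>2(t := c) = b(t\<^sub>0 := c) \<circ> \<sigma>" by (rule ext)
    then show "b\<^sub>2 t = b t\<^sub>0 \<and> b\<^sub>2(t := c) = b(t\<^sub>0 := c) \<circ> \<sigma>" using R st by simp
  qed
  have "(\<Sum>t\<in>{1..n}. if b\<^sub>2 t = b t\<^sub>0 then altv n (b(t\<^sub>0 := c)) (b\<^sub>2(t := c)) else 0)
      = (\<Sum>t\<in>{1..n}. \<Sum>\<sigma>\<in>Sn n. if b\<^sub>2 t = b t\<^sub>0 \<and> b\<^sub>2(t := c) = b(t\<^sub>0 := c) \<circ> \<sigma> then of_int (sign \<sigma>) else 0)"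
    unfolding altv_def by (intro sum.cong refl) simp
  also have "\<dots> = (\<Sum>\<sigma>\<in>Sn n. \<Sum>t\<in>{1..n}. if b\<^sub>2 t = b t\<^sub>0 \<and> b\<^sub>2(t := c) = b(t\<^sub>0 := c) \<circ> \<sigma> then of_int (sign \<sigma>) else 0)"
    by (rule sum.swap)
  also have "\<dots> = (\<Sum>\<sigma>\<in>Sn n. if b\<^sub>2 = b \<circ> \<sigma> then of_int (sign \<sigma>) else 0)"
  proof (rule sum.cong)
    fix \<sigma> assume "\<sigma> \<in> Sn n"
    then have \<sigma>: "\<sigma> permutes {1..n}" by simp
    have "(\<Sum>t\<in>{1..n}. if b\<^sub>2 t = b t\<^sub>0 \<and> b\<^sub>2(t := c) = b(t\<^sub>0 := c) \<circ> \<sigma> then of_int (sign \<sigma>) else 0)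
        = (\<Sum>t\<in>{1..n}. if t = inv \<sigma> t\<^sub>0 then (if b\<^sub>2 = b \<circ> \<sigma> then of_int (sign \<sigma>) else 0) else (0 :: complex))"
      by (rule sum.cong) (simp_all add: iff[OF \<sigma>])
    also have "\<dots> = (if b\<^sub>2 = b \<circ> \<sigma> then of_int (sign \<sigma>) else 0)"
      using permutes_in[OF permutes_inv[OF \<sigma>] t0] by (subst sum.delta) simp_all
    finally show "(\<Sum>t\<in>{1..n}. if b\<^sub>2 t = b t\<^sub>0 \<and> b\<^sub>2(t := c) = b(t\<^sub>0 := c) \<circ> \<sigma> then of_int (sign \<sigma>) else 0)
        = (if b\<^sub>2 = b \<circ> \<sigma> then of_int (sign \<sigma>) else (0 :: complex))" .
  qed simp
  finally show ?thesis by (simp add: altv_def)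
qed

section \<open>Graded pieces of the cyclic module\<close>

lemma subspace_calV: "cvec.subspace (calV_deg r \<xi> N i)" "cvec.subspace (calV_filt r \<xi> N i)"
  by (simp_all add: calV_deg_def calV_filt_def)

lemma calV_deg_gact:
  assumes a: "a \<in> Gr_deg k" and T: "T \<in> calV_deg r \<xi> N i"
  shows "gact r N (sum_list \<xi>) a T \<in> calV_deg r \<xi> N (i + int k)"
proof -
  let ?g = "gact r N (sum_list \<xi>)" and ?v = "vxi r \<xi> N"
  let ?G = "\<lambda>i. {foldr ?g as ?v | as ks. list_all2 (\<lambda>a k. a \<in> Gr_deg k) as ks \<and> int (sum_list ks) = i}"
  interpret g: Vector_Spaces.linear vscale vscale "?g a" by (rule clinear_gact)
  have "?g a ` ?G i \<subseteq> ?G (i + int k)"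
  proof (rule image_subsetI)
    fix S assume "S \<in> ?G i"
    then obtain as ks where S: "S = foldr ?g as ?v" "list_all2 (\<lambda>a k. a \<in> Gr_deg k) as ks" "int (sum_list ks) = i"
      by blast
    have "?g a S = foldr ?g (a # as) ?v" by (simp add: S(1))
    moreover have "list_all2 (\<lambda>a k. a \<in> Gr_deg k) (a # as) (k # ks)" using S(2) a by simp
    moreover have "int (sum_list (k # ks)) = i + int k" using S(3) by simp
    ultimately show "?g a S \<in> ?G (i + int k)" by blast
  qed
  then have "cvec.span (?g a ` ?G i) \<subseteq> cvec.span (?G (i + int k))" by (rule cvec.span_mono)
  then show ?thesis using T unfolding calV_deg_def g.span_image by blast
qed

lemma calV_filt_gact:
  assumes a: "a \<in> Gr_filt k" and T: "T \<in> calV_filt r \<xi> N m"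
  shows "gact r N (sum_list \<xi>) a T \<in> calV_filt r \<xi> N (m + int k)"
proof -
  let ?g = "gact r N (sum_list \<xi>)" and ?v = "vxi r \<xi> N"
  let ?G = "\<lambda>m. {foldr ?g as ?v | as ks. list_all2 (\<lambda>a k. a \<in> Gr_filt k) as ks \<and> int (sum_list ks) \<le> m}"
  interpret g: Vector_Spaces.linear vscale vscale "?g a" by (rule clinear_gact)
  have "?g a ` ?G m \<subseteq> ?G (m + int k)"
  proof (rule image_subsetI)
    fix S assume "S \<in> ?G m"
    then obtain as ks where S: "S = foldr ?g as ?v" "list_all2 (\<lambda>a k. a \<in> Gr_filt k) as ks" "int (sum_list ks) \<le> m"
      by blast
    have "?g a S = foldr ?g (a # as) ?v" by (simp add: S(1))
    moreover have "list_all2 (\<lambda>a k. a \<in> Gr_filt k) (a # as) (k # ks)" using S(2) a by simp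
    moreover have "int (sum_list (k # ks)) \<le> m + int k" using S(3) by simp
    ultimately show "?g a S \<in> ?G (m + int k)" by blast
  qed
  then have "cvec.span (?g a ` ?G m) \<subseteq> cvec.span (?G (m + int k))" by (rule cvec.span_mono)
  then show ?thesis using T unfolding calV_filt_def g.span_image by blast
qed

lemma vxi_in_calV_deg: "vxi r \<xi> N \<in> calV_deg r \<xi> N 0"
  unfolding calV_deg_def
  by (rule cvec.span_base) (auto intro!: exI[of _ "[]"])

lemma part_le_sum_list: "part \<xi> j \<le> sum_list \<xi>"
  using member_le_sum_list[of "\<xi> ! (j - 1)" \<xi>] by (auto simp: part_def)

lemma vinit_apply:
  assumes "t \<in> {1..sum_list \<xi>}"
  shows "fst (vinit \<xi> N t) = tab_row \<xi> t"
    "snd (vinit \<xi> N t) = N - int (part \<xi> (tab_row \<xi> t)) + int (tab_col \<xi> t) - 1"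
  using assms by (simp_all add: vinit_def)

lemma vinit_level:
  assumes "t \<in> {1..sum_list \<xi>}"
  shows "N - int (sum_list \<xi>) \<le> snd (vinit \<xi> N t)" "snd (vinit \<xi> N t) < N"
  using tab_col_pos[OF assms] tab_col_le[OF assms] part_le_sum_list[of \<xi> "tab_row \<xi> t"]
  by (simp_all add: vinit_apply[OF assms])

lemma vinit_label:
  assumes "length \<xi> \<le> r"
  shows "vinit \<xi> N \<in> {1..sum_list \<xi>} \<rightarrow>\<^sub>E Vbasis r N"
proof (rule PiE_I)
  fix t assume t: "t \<in> {1..sum_list \<xi>}"
  show "vinit \<xi> N t \<in> Vbasis r N"
    using tab_row_pos[OF t] tab_row_le_length[OF t] vinit_level(2)[OF t, of N] vinit_apply(1)[OF t, of N] assms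
    by (simp add: Vbasis_def mem_Times_iff)
next
  fix t assume "t \<notin> {1..sum_list \<xi>}"
  then show "vinit \<xi> N t = undefined" unfolding vinit_def restrict_apply by (rule if_not_P)
qed

lemma inj_on_vinit: "inj_on (vinit \<xi> N) {1..sum_list \<xi>}"
proof (rule inj_onI)
  fix s t assume st: "s \<in> {1..sum_list \<xi>}" "t \<in> {1..sum_list \<xi>}" "vinit \<xi> N s = vinit \<xi> N t"
  have r: "tab_row \<xi> s = tab_row \<xi> t" using st vinit_apply(1)[OF st(1), of N] vinit_apply(1)[OF st(2), of N] by simp
  moreover have "tab_col \<xi> s = tab_col \<xi> t"
    using st r vinit_apply(2)[OF st(1), of N] vinit_apply(2)[OF st(2), of N] by simp
  ultimately show "s = t" using tab_decompose[OF st(1)] tab_decompose[OF st(2)] by simp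
qed

lemma levels_ge_image:
  assumes "inj_on b {1..n}"
  shows "levels_ge n b s = card {y \<in> b ` {1..n}. s \<le> snd y}"
proof -
  have "{y \<in> b ` {1..n}. s \<le> snd y} = b ` {t \<in> {1..n}. s \<le> snd (b t)}" by blast
  moreover have "inj_on b {t \<in> {1..n}. s \<le> snd (b t)}" by (rule inj_on_subset[OF assms]) blast
  ultimately show ?thesis unfolding levels_ge_def by (simp add: card_image)
qed

lemma card_Collect_split:
  assumes "finite A"
  shows "card {y \<in> A. P y} = card {y \<in> A \<inter> B. P y} + card {y \<in> A - B. P y}"
proof -
  have "{y \<in> A. P y} = {y \<in> A \<inter> B. P y} \<union> {y \<in> A - B. P y}" by blast
  moreover have "card ({y \<in> A \<inter> B. P y} \<union> {y \<in> A - B. P y}) = card {y \<in> A \<inter> B. P y} + card {y \<in> A - B. P y}"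
    by (rule card_Un_disjoint) (use assms in auto)
  ultimately show ?thesis by simp
qed

lemma ex_max_level:
  assumes "finite A" "A \<noteq> {}"
  shows "\<exists>x\<in>A. \<forall>y\<in>A. snd y \<le> (snd x :: int)"
proof -
  have "Max (snd ` A) \<in> snd ` A" using assms by (intro Max_in) auto
  then obtain x where x: "x \<in> A" "snd x = Max (snd ` A)" by auto
  have "snd y \<le> snd x" if "y \<in> A" for y unfolding x(2) using assms that by (intro Max_ge) auto
  with x(1) show ?thesis by blast
qed

text \<open>
  If \<open>S\<close> lies above \<open>S\<^sub>0\<close>, then so does the set obtained by exchanging the topmost element of \<open>S - S\<^sub>0\<close> for the topmost
  element of \<open>S\<^sub>0 - S\<close>. Since \<open>S \<inter> S\<^sub>0\<close> contributes equally to both counts, only the differences matter, and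
  the two topmost elements cancel.
\<close>

lemma exchange_step:
  fixes S S\<^sub>0 :: "('a \<times> int) set"
  assumes fin: "finite S" "finite S\<^sub>0" and card: "card S = card S\<^sub>0" and ne: "S\<^sub>0 - S \<noteq> {}"
    and dom: "\<And>s. card {y \<in> S\<^sub>0. s \<le> snd y} \<le> card {y \<in> S. s \<le> snd y}"
  obtains x c where "x \<in> S - S\<^sub>0" "c \<in> S\<^sub>0 - S" "snd c \<le> snd x"
    "\<And>s. card {y \<in> S\<^sub>0. s \<le> snd y} \<le> card {y \<in> insert c (S - {x}). s \<le> snd y}"
proof -
  have cI: "card (S - S\<^sub>0) = card (S\<^sub>0 - S)"
    using card_Diff_subset_Int[of S S\<^sub>0] card_Diff_subset_Int[of S\<^sub>0 S] fin card by (simp add: Int_commute)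
  then have ne': "S - S\<^sub>0 \<noteq> {}" using ne fin by (metis card_0_eq finite_Diff)
  obtain c where c: "c \<in> S\<^sub>0 - S" "\<And>y. y \<in> S\<^sub>0 - S \<Longrightarrow> snd y \<le> snd c"
    using ex_max_level[of "S\<^sub>0 - S"] fin ne by blast
  obtain x where x: "x \<in> S - S\<^sub>0" "\<And>y. y \<in> S - S\<^sub>0 \<Longrightarrow> snd y \<le> snd x"
    using ex_max_level[of "S - S\<^sub>0"] fin ne' by blast
  have dom': "card {y \<in> S\<^sub>0 - S. s \<le> snd y} \<le> card {y \<in> S - S\<^sub>0. s \<le> snd y}" for s
    using dom[of s] card_Collect_split[OF fin(1), of "\<lambda>y. s \<le> snd y" S\<^sub>0]
      card_Collect_split[OF fin(2), of "\<lambda>y. s \<le> snd y" S] by (simp add: Int_commute)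
  have le: "snd c \<le> snd x"
  proof -
    have "c \<in> {y \<in> S\<^sub>0 - S. snd c \<le> snd y}" using c by simp
    moreover have "finite {y \<in> S\<^sub>0 - S. snd c \<le> snd y}" using fin by simp
    ultimately have "card {y \<in> S\<^sub>0 - S. snd c \<le> snd y} \<noteq> 0" by (metis card_0_eq empty_iff)
    then have "card {y \<in> S - S\<^sub>0. snd c \<le> snd y} \<noteq> 0" using dom'[of "snd c"] by simp
    then have "{y \<in> S - S\<^sub>0. snd c \<le> snd y} \<noteq> {}" by (metis card.empty)
    then obtain y where "y \<in> S - S\<^sub>0" "snd c \<le> snd y" by blast
    then show ?thesis using x(2)[of y] by simp
  qed
  have "card {y \<in> S\<^sub>0. s \<le> snd y} \<le> card {y \<in> insert c (S - {x}). s \<le> snd y}" for s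
  proof (cases "s \<le> snd x")
    case False
    have "{y \<in> S. s \<le> snd y} \<subseteq> {y \<in> insert c (S - {x}). s \<le> snd y}" using False by auto
    then have "card {y \<in> S. s \<le> snd y} \<le> card {y \<in> insert c (S - {x}). s \<le> snd y}"
      by (rule card_mono[rotated]) (use fin in simp)
    then show ?thesis using dom[of s] by simp
  next
    case sx: True
    have rem: "card {y \<in> S. s \<le> snd y} = Suc (card ({y \<in> S. s \<le> snd y} - {x}))"
      using x(1) sx fin by (intro card.remove) auto
    have "{y \<in> S. s \<le> snd y} - {x} = {y \<in> S - {x}. s \<le> snd y}" by blast
    with rem have rem': "card {y \<in> S. s \<le> snd y} = Suc (card {y \<in> S - {x}. s \<le> snd y})" by simp
    show ?thesis
    proof (cases "s \<le> snd c")
      case True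
      have "{y \<in> insert c (S - {x}). s \<le> snd y} = insert c {y \<in> S - {x}. s \<le> snd y}" using True by blast
      moreover have "card (insert c {y \<in> S - {x}. s \<le> snd y}) = Suc (card {y \<in> S - {x}. s \<le> snd y})"
        using c(1) fin by (intro card_insert_disjoint) auto
      ultimately show ?thesis using dom[of s] rem' by simp
    next
      case False
      have "{y \<in> insert c (S - {x}). s \<le> snd y} = {y \<in> S - {x}. s \<le> snd y}" using False by blast
      moreover have "{y \<in> S\<^sub>0 - S. s \<le> snd y} = {}" using c(2) False by force
      moreover have "card {y \<in> S - S\<^sub>0. s \<le> snd y} \<noteq> 0"
      proof -
        have "x \<in> {y \<in> S - S\<^sub>0. s \<le> snd y}" using x(1) sx by simp
        moreover have "finite {y \<in> S - S\<^sub>0. s \<le> snd y}" using fin by simp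
        ultimately show ?thesis by (metis card_0_eq empty_iff)
      qed
      ultimately show ?thesis
        using rem' card_Collect_split[OF fin(1), of "\<lambda>y. s \<le> snd y" S\<^sub>0]
          card_Collect_split[OF fin(2), of "\<lambda>y. s \<le> snd y" S]
        unfolding Int_commute[of S\<^sub>0 S] by (simp only: card.empty)
    qed
  qed
  then show thesis using that[OF x(1) c(1) le] by blast
qed

lemma same_image_permutation:
  assumes b: "b \<in> {1..n} \<rightarrow>\<^sub>E A" "b\<^sub>0 \<in> {1..n} \<rightarrow>\<^sub>E A" and inj: "inj_on b {1..n}" "inj_on b\<^sub>0 {1..n}"
    and im: "b ` {1..n} = b\<^sub>0 ` {1..n}"
  obtains \<sigma> where "\<sigma> permutes {1..n}" "b = b\<^sub>0 \<circ> \<sigma>"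
proof -
  let ?g = "the_inv_into {1..n} b\<^sub>0"
  define \<sigma> where "\<sigma> t = (if t \<in> {1..n} then ?g (b t) else t)" for t
  have bij: "bij_betw (\<lambda>t. ?g (b t)) {1..n} {1..n}"
  proof -
    have "bij_betw b {1..n} (b\<^sub>0 ` {1..n})" using inj im by (simp add: bij_betw_def)
    moreover have "bij_betw ?g (b\<^sub>0 ` {1..n}) {1..n}" 
      by (rule bij_betw_the_inv_into) (simp add: bij_betw_def inj(2))
    ultimately have "bij_betw (?g \<circ> b) {1..n} {1..n}" by (rule bij_betw_trans)
    then show ?thesis by (simp add: comp_def)
  qed
  have "bij_betw \<sigma> {1..n} {1..n} \<longleftrightarrow> bij_betw (\<lambda>t. ?g (b t)) {1..n} {1..n}"
    by (rule bij_betw_cong) (simp only: \<sigma>_def if_True)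
  then have "\<sigma> permutes {1..n}" using bij by (intro bij_imp_permutes) (auto simp: \<sigma>_def)
  moreover have "b = b\<^sub>0 \<circ> \<sigma>"
  proof
    fix t
    show "b t = (b\<^sub>0 \<circ> \<sigma>) t"
    proof (cases "t \<in> {1..n}")
      case True
      then have "b t \<in> b\<^sub>0 ` {1..n}" using im by blast
      then show ?thesis using True f_the_inv_into_f[OF inj(2)] by (simp add: \<sigma>_def)
    next
      case False
      then show ?thesis using PiE_arb[OF b(1) False] PiE_arb[OF b(2) False]
        by (simp only: \<sigma>_def comp_apply if_False)
    qed
  qed
  ultimately show thesis using that by blast
qed

text \<open>
  Induction on the number of labels of the generating vector that are missing from \<open>b\<close>: by the exchange step, \<open>b\<close> is
  obtained by one matrix unit from labels that miss one fewer.
\<close>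

lemma altv_in_calV_deg:
  assumes len: "length \<xi> \<le> r" and n: "n = sum_list \<xi>"
    and b: "b \<in> reachable r n N (vinit \<xi> N) i" and inj: "inj_on b {1..n}"
  shows "altv n b \<in> calV_deg r \<xi> N i"
  using b inj
proof (induction "card (vinit \<xi> N ` {1..n} - b ` {1..n})" arbitrary: b i rule: less_induct)
  case less
  let ?init = "vinit \<xi> N"
  let ?I = "?init ` {1..n}" and ?S = "b ` {1..n}"
  have b0: "?init \<in> {1..n} \<rightarrow>\<^sub>E Vbasis r N" "inj_on ?init {1..n}"
    unfolding n by (rule vinit_label[OF len], rule inj_on_vinit)
  have lab: "b \<in> {1..n} \<rightarrow>\<^sub>E Vbasis r N" and dom: "levels_ge n ?init s \<le> levels_ge n b s"
    and deg: "level_sum n b = level_sum n ?init + i" for s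
    using less.prems(1) unfolding reachable_def by blast+
  have card: "card ?S = card ?I"
    by (rule trans[OF card_image[OF less.prems(2)] card_image[OF b0(2), symmetric]])
  show ?case
  proof (cases "?I - ?S = {}")
    case True
    then have sub: "vinit \<xi> N ` {1..n} \<subseteq> b ` {1..n}" by (simp only: Diff_eq_empty_iff)
    have "finite (b ` {1..n})" by simp
    from card_subset_eq[OF this sub card[symmetric]]
    have eq: "b ` {1..n} = vinit \<xi> N ` {1..n}" by (rule sym)
    from same_image_permutation[OF lab b0(1) less.prems(2) b0(2) eq]
    obtain \<sigma> where \<sigma>: "\<sigma> permutes {1..n}" "b = ?init \<circ> \<sigma>" .
    have "level_sum n b = level_sum n ?init"
      unfolding level_sum_def \<sigma>(2) using sum.permute[OF \<sigma>(1), of "\<lambda>t. snd (?init t)"] by (simp add: comp_def)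
    then have "i = 0" using deg by simp
    have "altv n b = vscale (of_int (sign \<sigma>)) (vxi r \<xi> N)"
      using altv_comp[OF \<sigma>(1), of ?init] by (simp only: \<sigma>(2) vxi_eq_altv[OF len] n)
    then show ?thesis
      unfolding \<open>i = 0\<close> using cvec.subspace_scale[OF subspace_calV(1) vxi_in_calV_deg] by simp
  next
    case False
    have "card {y \<in> ?I. s \<le> snd y} \<le> card {y \<in> ?S. s \<le> snd y}" for s
      using dom[of s] unfolding levels_ge_image[OF less.prems(2)] levels_ge_image[OF b0(2)] .
    from exchange_step[OF finite_imageI[OF finite_atLeastAtMost] finite_imageI[OF finite_atLeastAtMost] card False this]
    obtain x c where xc: "x \<in> ?S - ?I" "c \<in> ?I - ?S" "snd c \<le> snd x"
      "\<And>s. card {y \<in> ?I. s \<le> snd y} \<le> card {y \<in> insert c (?S - {x}). s \<le> snd y}"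
      by blast
    from xc(1) obtain t0 where t0: "t0 \<in> {1..n}" "b t0 = x" by blast
    \<comment> \<open>The predecessor: one step closer to the generating vector.\<close>
    define b' where "b' = b(t0 := c)"
    have cV: "c \<in> Vbasis r N" using xc(2) PiE_mem[OF b0(1)] by blast
    have lab': "b' \<in> {1..n} \<rightarrow>\<^sub>E Vbasis r N"
      unfolding b'_def using PiE_fun_upd[OF cV lab, of t0] t0(1) by (simp add: insert_absorb)
    have cS: "c \<notin> ?S" using xc(2) by blast
    have inj': "inj_on b' {1..n}"
      unfolding b'_def using less.prems(2) cS by (rule inj_on_fun_updI)
    have im': "b' ` {1..n} = insert c (?S - {x})"
    proof -
      have "b ` ({1..n} - {t0}) = ?S - {x}"
        using inj_on_image_set_diff[OF less.prems(2), of "{1..n}" "{t0}"] t0 by simp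
      moreover have "b' ` {1..n} = insert (b' t0) (b' ` ({1..n} - {t0}))" using t0(1) by blast
      moreover have "b' ` ({1..n} - {t0}) = b ` ({1..n} - {t0})"
        by (rule image_cong) (auto simp: b'_def)
      ultimately show ?thesis by (simp add: b'_def)
    qed
    have dom': "levels_ge n ?init s \<le> levels_ge n b' s" for s
      unfolding levels_ge_image[OF inj'] levels_ge_image[OF b0(2)] im' by (rule xc(4))
    define k where "k = nat (snd x - snd c)"
    have k: "int k = snd x - snd c" using xc(3) by (simp add: k_def)
    have deg': "level_sum n b' = level_sum n ?init + (i - int k)"
    proof -
      have "level_sum n b' = snd c + (\<Sum>t\<in>{1..n} - {t0}. snd (b' t))"
        unfolding level_sum_def using t0(1) by (subst sum.remove[of _ t0]) (simp_all add: b'_def)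
      also have "(\<Sum>t\<in>{1..n} - {t0}. snd (b' t)) = (\<Sum>t\<in>{1..n} - {t0}. snd (b t))"
        by (rule sum.cong) (auto simp: b'_def)
      also have "\<dots> = level_sum n b - snd x"
        unfolding level_sum_def using t0 by (subst sum.remove[of "{1..n}" t0]) simp_all
      finally show ?thesis using deg k by simp
    qed
    have reach': "b' \<in> reachable r n N ?init (i - int k)"
      using lab' dom' deg' by (simp add: reachable_def)
    have "?I - b' ` {1..n} \<subset> ?I - ?S"
      unfolding im' using xc(1,2) by blast
    then have "card (?I - b' ` {1..n}) < card (?I - ?S)" by (rule psubset_card_mono[rotated]) simp
    then have IH: "altv n b' \<in> calV_deg r \<xi> N (i - int k)" by (rule less.hyps[OF _ reach' inj'])
    have supp: "snd (d t) \<in> snd ` b' ` {1..n}" if d: "altv n b' d \<noteq> 0" and t: "t \<in> {1..n}" for d t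
    proof -
      obtain \<sigma> where \<sigma>: "\<sigma> permutes {1..n}" "d = b' \<circ> \<sigma>" using altv_nonzeroD[OF d] by blast
      then show ?thesis using permutes_in[OF \<sigma>(1) t] by simp
    qed
    have cF: "snd c \<in> snd ` b' ` {1..n}" unfolding im' by simp
    have c1: "fst c \<in> {1..r}" using cV by (auto simp: Vbasis_def)
    have finF: "finite (snd ` b' ` {1..n})" by simp
    have "\<exists>a\<in>Gr_deg (nat (snd x - snd c)). \<forall>d\<in>{1..n} \<rightarrow>\<^sub>E Vbasis r N.
        gact r N n a (altv n b') d = (\<Sum>t\<in>{1..n}. if d t = x then altv n b' (d(t := c)) else 0)"
      by (rule matrix_unit_operator[OF finF _ cF c1 xc(3)]) (rule supp)
    then obtain a where a: "a \<in> Gr_deg (nat (snd x - snd c))"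
      "\<And>d. d \<in> {1..n} \<rightarrow>\<^sub>E Vbasis r N \<Longrightarrow>
        gact r N n a (altv n b') d = (\<Sum>t\<in>{1..n}. if d t = x then altv n b' (d(t := c)) else 0)"
      by blast
    have "gact r N n a (altv n b') = altv n b"
    proof
      fix d
      show "gact r N n a (altv n b') d = altv n b d"
      proof (cases "d \<in> {1..n} \<rightarrow>\<^sub>E Vbasis r N")
        case True
        show ?thesis
          unfolding a(2)[OF True] unfolding b'_def t0(2)[symmetric]
          by (rule replace_in_altv[OF lab t0(1) cS True])
      next
        case False
        have "altv n b d = 0"
        proof (rule ccontr)
          assume "altv n b d \<noteq> 0"
          then obtain \<sigma> where "\<sigma> permutes {1..n}" "d = b \<circ> \<sigma>" by (rule altv_nonzeroD)
          then show False using False PiE_comp_permutes[OF lab] by blast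
        qed
        then show ?thesis unfolding gact_def using False by simp
      qed
    qed
    moreover have "gact r N n a (altv n b') \<in> calV_deg r \<xi> N (i - int k + int k)"
      unfolding n by (rule calV_deg_gact) (use a(1) IH n in \<open>simp_all add: k_def\<close>)
    ultimately show ?thesis by simp
  qed
qed

text \<open>
  The module is a Demazure module for the parabolic algebra of operators not lowering the level; as weight multiplicities
  in an exterior power are one, it is spanned by the wedges that it can reach.
\<close>

theorem calV_deg_eq_alt_space:
  assumes len: "length \<xi> \<le> r" and n: "n = sum_list \<xi>"
  shows "calV_deg r \<xi> N i = alt_space n (reachable r n N (vinit \<xi> N) i)"
proof
  let ?init = "vinit \<xi> N"
  have b0: "?init \<in> {1..n} \<rightarrow>\<^sub>E Vbasis r N" using vinit_label[OF len] n by simp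
  have fin: "finite (reachable r n N ?init i)"
    by (rule finite_reachable[of _ "N - int n"]) (use vinit_level n in auto)
  have "foldr (gact r N n) as (vxi r \<xi> N) \<in> alt_space n (reachable r n N ?init (int (sum_list ks)))"
    if "list_all2 (\<lambda>a k. a \<in> Gr_deg k) as ks" for as ks
    using that
  proof (induction rule: list_all2_induct)
    case Nil
    have "altv n ?init \<in> alt_space n (reachable r n N ?init 0)"
    proof -
      have "d \<in> reachable r n N ?init 0" if nz: "altv n ?init d \<noteq> 0" for d
      proof -
        obtain \<sigma> where \<sigma>: "\<sigma> permutes {1..n}" "d = ?init \<circ> \<sigma>" using nz by (rule altv_nonzeroD)
        have "levels_ge n d s = levels_ge n ?init s" for s
          unfolding levels_ge_def \<sigma>(2) comp_apply by (rule card_permutes_Collect[OF \<sigma>(1)])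
        moreover have "level_sum n d = level_sum n ?init"
          unfolding level_sum_def \<sigma>(2) using sum.permute[OF \<sigma>(1), of "\<lambda>t. snd (?init t)"] by (simp add: comp_def)
        moreover have "d \<in> {1..n} \<rightarrow>\<^sub>E Vbasis r N" unfolding \<sigma>(2) by (rule PiE_comp_permutes[OF b0 \<sigma>(1)])
        ultimately show ?thesis by (simp add: reachable_def)
      qed
      then show ?thesis by (auto simp: alt_space_def supp_on_def antisym_altv)
    qed
    then show ?case by (simp add: vxi_eq_altv[OF len] n)
  next
    case (Cons a as k ks)
    then show ?case using gact_raises[OF Cons.IH Cons.hyps(1)] by (simp add: add.commute)
  qed
  then show "calV_deg r \<xi> N i \<subseteq> alt_space n (reachable r n N ?init i)"
    unfolding calV_deg_def n[symmetric] by (intro cvec.span_minimal subspace_alt_space) blast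
  show "alt_space n (reachable r n N ?init i) \<subseteq> calV_deg r \<xi> N i"
  proof
    fix T assume T: "T \<in> alt_space n (reachable r n N ?init i)"
    have "vscale (fact n) T = (\<Sum>b\<in>reachable r n N ?init i. vscale (T b) (altv n b))"
      by (rule altv_expand[OF fin T])
    also have "\<dots> \<in> calV_deg r \<xi> N i"
    proof (rule cvec.subspace_sum[OF subspace_calV(1)])
      fix b assume b: "b \<in> reachable r n N ?init i"
      show "vscale (T b) (altv n b) \<in> calV_deg r \<xi> N i"
      proof (cases "inj_on b {1..n}")
        case True
        then show ?thesis
          by (intro cvec.subspace_scale[OF subspace_calV(1)] altv_in_calV_deg[OF len n b])
      next
        case False
        then have "T b = 0" using T by (intro antisym_noninjective_zero) (auto simp: alt_space_def)
        then show ?thesis using cvec.subspace_0[OF subspace_calV(1)] by (simp only: cvec.scale_zero_left)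
      qed
    qed
    finally have "vscale (inverse (fact n)) (vscale (fact n) T) \<in> calV_deg r \<xi> N i"
      by (rule cvec.subspace_scale[OF subspace_calV(1)])
    then show "T \<in> calV_deg r \<xi> N i" by simp
  qed
qed

section \<open>The specialization at y = 1\<close>

abbreviation labels :: "nat \<Rightarrow> nat \<Rightarrow> int \<Rightarrow> (nat \<Rightarrow> nat \<times> int) set" where
  "labels r n N \<equiv> {1..n} \<rightarrow>\<^sub>E Vbasis r N"

definition has_weight :: "nat \<Rightarrow> (nat \<Rightarrow> complex) \<Rightarrow> nat set \<Rightarrow> (nat \<Rightarrow> nat \<times> int) \<Rightarrow> bool" where
  "has_weight n \<mu> Q b \<longleftrightarrow> (\<forall>p\<in>Q. of_nat (count_of n (fst \<circ> b) p) = \<mu> p)"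

definition weight_part :: "nat \<Rightarrow> nat \<Rightarrow> (nat \<Rightarrow> complex) \<Rightarrow> tens set \<Rightarrow> tens set" where
  "weight_part r n \<mu> W = {T \<in> W. \<forall>b. T b \<noteq> 0 \<longrightarrow> has_weight n \<mu> {1..r} b}"

text \<open>
  Stability under the diagonal matrix units, which is all that weight decompositions require.
\<close>

definition diag_stable :: "nat \<Rightarrow> nat \<Rightarrow> int \<Rightarrow> tens set \<Rightarrow> bool" where
  "diag_stable r n N W \<longleftrightarrow> cvec.subspace W \<and> W \<subseteq> supp_on (labels r n N) \<and>
     (\<forall>p\<in>{1..r}. \<forall>T\<in>W. gl_act_calV r N n (Emat p p) T \<in> W)"

lemma diag_stableD:
  assumes "diag_stable r n N W"
  shows "cvec.subspace W" "W \<subseteq> supp_on (labels r n N)"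
    "p \<in> {1..r} \<Longrightarrow> T \<in> W \<Longrightarrow> gl_act_calV r N n (Emat p p) T \<in> W"
  using assms unfolding diag_stable_def by blast+

lemma gl_act_diag_vmult:
  assumes "T \<in> supp_on (labels r n N)"
  shows "gl_act_calV r N n (Emat p p) T = vmult (\<lambda>b. of_nat (count_of n (fst \<circ> b) p)) T"
proof
  fix b
  show "gl_act_calV r N n (Emat p p) T b = vmult (\<lambda>b. of_nat (count_of n (fst \<circ> b) p)) T b"
  proof (cases "b \<in> labels r n N")
    case True
    then show ?thesis by (simp only: gl_act_diag vmult_def)
  next
    case False
    then show ?thesis using supp_onD[OF assms False] by (simp add: gl_act_calV_apply vmult_def)
  qed
qed

lemma diag_stable_vmult:
  fixes \<phi> :: "complex \<Rightarrow> complex"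
  assumes W: "diag_stable r n N W" and p: "p \<in> {1..r}" and T: "T \<in> W"
  shows "vmult (\<lambda>b. \<phi> (of_nat (count_of n (fst \<circ> b) p))) T \<in> W"
proof (rule vmult_stable_comp[where e = "\<lambda>b. of_nat (count_of n (fst \<circ> b) p)" and F = "of_nat ` {..n}",
      OF diag_stableD(1,2)[OF W] _ _ _ T])
  have "count_of n (fst \<circ> b) p \<le> n" for b :: "nat \<Rightarrow> nat \<times> int"
  proof -
    have "card {t \<in> {1..n}. (fst \<circ> b) t = p} \<le> card {1..n}" by (rule card_mono) auto
    then show ?thesis by (simp add: count_of_def)
  qed
  then show "(\<lambda>b. of_nat (count_of n (fst \<circ> b) p)) ` labels r n N \<subseteq> of_nat ` {..n}" by blast
  fix S assume S: "S \<in> W"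
  then have "S \<in> supp_on (labels r n N)" using diag_stableD(2)[OF W] by blast
  then show "vmult (\<lambda>b. of_nat (count_of n (fst \<circ> b) p)) S \<in> W"
    using diag_stableD(3)[OF W p S] by (simp only: gl_act_diag_vmult)
qed simp

definition proj :: "nat \<Rightarrow> (nat \<Rightarrow> complex) \<Rightarrow> nat set \<Rightarrow> tens \<Rightarrow> tens" where
  "proj n \<mu> Q = vmult (\<lambda>b. if has_weight n \<mu> Q b then 1 else 0)"

lemma proj_insert:
  "proj n \<mu> (insert p Q) T = vmult (\<lambda>b. (\<lambda>x. if x = \<mu> p then 1 else 0) (of_nat (count_of n (fst \<circ> b) p))) (proj n \<mu> Q T)"
  by (simp add: proj_def vmult_def fun_eq_iff has_weight_def)

lemma diag_stable_proj:
  assumes W: "diag_stable r n N W" and Q: "finite Q" "Q \<subseteq> {1..r}" and T: "T \<in> W"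
  shows "proj n \<mu> Q T \<in> W"
  using Q
proof (induction Q rule: finite_induct)
  case empty
  have "proj n \<mu> {} T = T" by (simp add: proj_def vmult_def has_weight_def)
  then show ?case using T by simp
next
  case (insert p Q)
  then have "p \<in> {1..r}" "proj n \<mu> Q T \<in> W" by blast+
  then show ?case unfolding proj_insert by (rule diag_stable_vmult[OF W])
qed

lemma proj_image:
  assumes W: "diag_stable r n N W"
  shows "proj n \<mu> {1..r} ` W = weight_part r n \<mu> W"
proof
  show "proj n \<mu> {1..r} ` W \<subseteq> weight_part r n \<mu> W"
    using diag_stable_proj[OF W _ subset_refl]
    by (auto simp: weight_part_def proj_def vmult_def split: if_splits)
  show "weight_part r n \<mu> W \<subseteq> proj n \<mu> {1..r} ` W"
  proof
    fix T assume T: "T \<in> weight_part r n \<mu> W"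
    then have "proj n \<mu> {1..r} T = T"
      by (intro ext) (auto simp: weight_part_def proj_def vmult_def)
    then show "T \<in> proj n \<mu> {1..r} ` W" using T by (auto simp: weight_part_def intro: rev_image_eqI)
  qed
qed

text \<open>
  On the part of \<open>T\<close> where the weight differs from \<open>\<mu>\<close> in the coordinate \<open>p\<close>, the operator \<open>E\<^sub>p\<^sub>p - \<mu>\<^sub>p\<close> is invertible, and
  its inverse is a function of \<open>E\<^sub>p\<^sub>p\<close> and preserves \<open>W'\<close>; so this part lies in \<open>W'\<close>.
\<close>

lemma weight_vector_mod:
  assumes W: "diag_stable r n N W" and W': "diag_stable r n N W'"
    and T: "T \<in> W" and wt: "\<And>p. p \<in> {1..r} \<Longrightarrow> gl_act_calV r N n (Emat p p) T - vscale (\<mu> p) T \<in> W'"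
    and Q: "finite Q" "Q \<subseteq> {1..r}"
  shows "T - proj n \<mu> Q T \<in> W'"
  using Q
proof (induction Q rule: finite_induct)
  case empty
  have "T - proj n \<mu> {} T = 0" by (simp add: proj_def vmult_def has_weight_def)
  then show ?case using cvec.subspace_0[OF diag_stableD(1)[OF W']] by (simp only:)
next
  case (insert p Q)
  then have p: "p \<in> {1..r}" and Q: "finite Q" "Q \<subseteq> {1..r}" and IH: "T - proj n \<mu> Q T \<in> W'" by blast+
  let ?c = "\<lambda>b. of_nat (count_of n (fst \<circ> b) p) :: complex"
  let ?D = "gl_act_calV r N n (Emat p p) T - vscale (\<mu> p) T"
  let ?\<phi> = "\<lambda>x. if x = \<mu> p then 0 else inverse (x - \<mu> p)"
  have "T \<in> supp_on (labels r n N)" using T diag_stableD(2)[OF W] by blast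
  then have D: "?D = vmult (\<lambda>b. ?c b - \<mu> p) T"
    by (simp add: gl_act_diag_vmult vmult_def fun_eq_iff algebra_simps)
  have "T - proj n \<mu> (insert p Q) T = (T - proj n \<mu> Q T) + proj n \<mu> Q (vmult (\<lambda>b. ?\<phi> (?c b)) ?D)"
    unfolding D by (auto simp: proj_def vmult_def fun_eq_iff has_weight_def)
  also have "\<dots> \<in> W'"
    by (intro cvec.subspace_add[OF diag_stableD(1)[OF W'] IH] diag_stable_proj[OF W' Q]
        diag_stable_vmult[OF W' p] wt p)
  finally show ?case .
qed

text \<open>
  The preimage of the weight space of \<open>W / W'\<close> is the sum of \<open>W'\<close> and the weight space of \<open>W\<close>; the projection to the
  weight \<open>\<mu>\<close> has the same kernel on it and on \<open>W'\<close>.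
\<close>

lemma ch_quot_eq_dim_diff:
  assumes W: "diag_stable r n N W" and W': "diag_stable r n N W'" and sub: "W' \<subseteq> W"
    and fin: "finite D" "W \<subseteq> supp_on D"
  shows "ch_quot r (gl_act_calV r N n) W W' \<mu>
    = int (cvec.dim (weight_part r n \<mu> W)) - int (cvec.dim (weight_part r n \<mu> W'))"
proof -
  let ?K = "{T \<in> W. \<forall>p\<in>{1..r}. gl_act_calV r N n (Emat p p) T - vscale (\<mu> p) T \<in> W'}"
  let ?\<pi> = "proj n \<mu> {1..r}" and ?Z = "{T. proj n \<mu> {1..r} T = 0}"
  have lin: "clinear ?\<pi>" unfolding proj_def by (rule clinear_vmult)
  have subW: "cvec.subspace W" and subW': "cvec.subspace W'" using W W' by (auto dest: diag_stableD)
  have supW: "T \<in> supp_on (labels r n N)" if "T \<in> W" for T using that diag_stableD(2)[OF W] by blast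
  have K: "cvec.subspace ?K"
  proof (rule csubspaceI)
    have "gl_act_calV r N n (Emat p p) 0 - vscale (\<mu> p) 0 = 0" for p
    proof -
      interpret g: Vector_Spaces.linear vscale vscale "gl_act_calV r N n (Emat p p)"
        unfolding gl_act_calV_def by (rule clinear_gact)
      show ?thesis by (simp only: g.zero cvec.scale_zero_right diff_self)
    qed
    then show "0 \<in> ?K"
      using cvec.subspace_0[OF subW] cvec.subspace_0[OF subW'] by (simp only: mem_Collect_eq) blast
  next
    fix S T assume "S \<in> ?K" "T \<in> ?K"
    moreover have "gl_act_calV r N n (Emat p p) (S + T) - vscale (\<mu> p) (S + T)
        = (gl_act_calV r N n (Emat p p) S - vscale (\<mu> p) S) + (gl_act_calV r N n (Emat p p) T - vscale (\<mu> p) T)" for p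
    proof -
      interpret g: Vector_Spaces.linear vscale vscale "gl_act_calV r N n (Emat p p)"
        unfolding gl_act_calV_def by (rule clinear_gact)
      show ?thesis by (simp add: g.add cvec.scale_right_distrib)
    qed
    ultimately show "S + T \<in> ?K" by (auto simp del: plus_fun_apply intro: cvec.subspace_add[OF subW] cvec.subspace_add[OF subW'])
  next
    fix k T assume "T \<in> ?K"
    moreover have "gl_act_calV r N n (Emat p p) (vscale k T) - vscale (\<mu> p) (vscale k T)
        = vscale k (gl_act_calV r N n (Emat p p) T - vscale (\<mu> p) T)" for p
    proof -
      interpret g: Vector_Spaces.linear vscale vscale "gl_act_calV r N n (Emat p p)"
        unfolding gl_act_calV_def by (rule clinear_gact)
      show ?thesis by (simp add: g.scale cvec.scale_right_diff_distrib mult.commute)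
    qed
    ultimately show "vscale k T \<in> ?K" by (auto intro: cvec.subspace_scale[OF subW] cvec.subspace_scale[OF subW'])
  qed
  have W'K: "W' \<subseteq> ?K"
  proof
    fix T assume T: "T \<in> W'"
    have "gl_act_calV r N n (Emat p p) T - vscale (\<mu> p) T \<in> W'" if p: "p \<in> {1..r}" for p
      by (intro cvec.subspace_diff[OF subW'] cvec.subspace_scale[OF subW'] diag_stableD(3)[OF W' p] T)
    then show "T \<in> ?K" using T sub by blast
  qed
  have mod: "T - ?\<pi> T \<in> W'" if "T \<in> ?K" for T
    by (rule weight_vector_mod[OF W W' _ _ finite_atLeastAtMost subset_refl]) (use that in blast)+
  have im_K: "?\<pi> ` ?K = weight_part r n \<mu> W"
  proof
    show "?\<pi> ` ?K \<subseteq> weight_part r n \<mu> W" using proj_image[OF W, of \<mu>] by blast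
    show "weight_part r n \<mu> W \<subseteq> ?\<pi> ` ?K"
    proof
      fix T assume T: "T \<in> weight_part r n \<mu> W"
      then have TW: "T \<in> W" and wt: "T b \<noteq> 0 \<Longrightarrow> has_weight n \<mu> {1..r} b" for b
        unfolding weight_part_def by blast+
      have "gl_act_calV r N n (Emat p p) T - vscale (\<mu> p) T = 0" if p: "p \<in> {1..r}" for p
      proof
        fix b
        have "of_nat (count_of n (fst \<circ> b) p) = \<mu> p" if "T b \<noteq> 0"
          using wt[OF that] p unfolding has_weight_def by blast
        then show "(gl_act_calV r N n (Emat p p) T - vscale (\<mu> p) T) b = 0 b"
          unfolding gl_act_diag_vmult[OF supW[OF TW]] by (cases "T b = 0") (simp_all add: vmult_def)
      qed
      then have "\<forall>p\<in>{1..r}. gl_act_calV r N n (Emat p p) T - vscale (\<mu> p) T \<in> W'"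
        using cvec.subspace_0[OF subW'] by metis
      then have TK: "T \<in> ?K" using TW by blast
      have "T = ?\<pi> T"
      proof
        fix b show "T b = ?\<pi> T b" using wt[of b] by (cases "T b = 0") (simp_all add: proj_def vmult_def)
      qed
      then show "T \<in> ?\<pi> ` ?K" using TK by (rule image_eqI)
    qed
  qed
  have ker: "?K \<inter> ?Z = W' \<inter> ?Z"
  proof
    show "?K \<inter> ?Z \<subseteq> W' \<inter> ?Z"
    proof
      fix T assume T: "T \<in> ?K \<inter> ?Z"
      then have "T - ?\<pi> T \<in> W'" using mod by blast
      moreover have "?\<pi> T = 0" using T by blast
      ultimately show "T \<in> W' \<inter> ?Z" by simp
    qed
    show "W' \<inter> ?Z \<subseteq> ?K \<inter> ?Z" using W'K by blast
  qed
  have span: "W \<subseteq> cvec.span (unit_vec ` D)" using fin(2) supp_on_span[OF fin(1)] by blast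
  have finD: "finite (unit_vec ` D)" using fin(1) by simp
  have "cvec.dim ?K = cvec.dim (weight_part r n \<mu> W) + cvec.dim (W' \<inter> ?Z)"
    unfolding im_K[symmetric] ker[symmetric]
    by (rule cpair.rank_nullity_subspace[OF lin K finD]) (use span in blast)
  moreover have "cvec.dim W' = cvec.dim (weight_part r n \<mu> W') + cvec.dim (W' \<inter> ?Z)"
    unfolding proj_image[OF W', symmetric]
    by (rule cpair.rank_nullity_subspace[OF lin subW' finD]) (use span sub in blast)
  ultimately show ?thesis by (simp add: ch_quot_def)
qed

lemma calV_filt_mono: "m \<le> m' \<Longrightarrow> calV_filt r \<xi> N m \<subseteq> calV_filt r \<xi> N m'"
  unfolding calV_filt_def by (rule cvec.span_mono) force

lemma calV_filt_negative: "m < 0 \<Longrightarrow> calV_filt r \<xi> N m = {0}"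
proof -
  assume "m < 0"
  then have "\<not> int (sum_list ms) \<le> m" for ms by (simp add: not_le order.strict_trans2)
  then have "{foldr (gact r N (sum_list \<xi>)) as (vxi r \<xi> N) | as ms.
      list_all2 (\<lambda>a k. a \<in> Gr_filt k) as ms \<and> int (sum_list ms) \<le> m} = {}" by blast
  then show ?thesis unfolding calV_filt_def by (simp only: cvec.span_empty)
qed

lemma Emat_degree: "gelt_of g 0 0 \<in> Gr_deg 0" "gelt_of g 0 0 \<in> Gr_filt 0"
proof -
  have "gelt_supp (gelt_of g 0 0) \<subseteq> {(0, 0)}" by (auto simp: gelt_supp_def gelt_of_def split: if_splits)
  then show "gelt_of g 0 0 \<in> Gr_deg 0" "gelt_of g 0 0 \<in> Gr_filt 0"
    by (auto simp: Gr_deg_def Gr_filt_def Gr_def intro: finite_subset)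
qed

lemma Gr_deg_filt:
  assumes "a \<in> Gr_deg k"
  shows "\<exists>m. a \<in> Gr_filt m"
proof -
  have "finite (gelt_supp a)" using assms by (simp add: Gr_deg_def Gr_def)
  then have "\<forall>(k, l)\<in>gelt_supp a. l \<le> Max (snd ` gelt_supp a)" by (auto intro!: Max_ge image_eqI[of _ snd])
  then show ?thesis using assms by (auto simp: Gr_filt_def Gr_deg_def)
qed

lemma calV_deg_in_filt:
  assumes "T \<in> calV_deg r \<xi> N i"
  shows "\<exists>m. T \<in> calV_filt r \<xi> N m"
  using assms unfolding calV_deg_def
proof (induction rule: cvec.span_induct_alt)
  case base
  show ?case using cvec.subspace_0[OF subspace_calV(2)] by blast
next
  case (step c x y)
  then obtain as ks where x: "x = foldr (gact r N (sum_list \<xi>)) as (vxi r \<xi> N)"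
    "list_all2 (\<lambda>a k. a \<in> Gr_deg k) as ks" by blast
  have "\<exists>ms. list_all2 (\<lambda>a k. a \<in> Gr_filt k) as ms" using x(2)
  proof (induction rule: list_all2_induct)
    case Nil then show ?case by blast
  next
    case (Cons a as k ks)
    then show ?case using Gr_deg_filt list_all2_Cons[THEN iffD2] by metis
  qed
  then obtain ms where ms: "list_all2 (\<lambda>a k. a \<in> Gr_filt k) as ms" by blast
  have x: "x \<in> calV_filt r \<xi> N (int (sum_list ms))"
    unfolding calV_filt_def x(1) by (rule cvec.span_base) (use ms in blast)
  obtain m where y: "y \<in> calV_filt r \<xi> N m" using step by blast
  let ?m = "max (int (sum_list ms)) m"
  have "x \<in> calV_filt r \<xi> N ?m" "y \<in> calV_filt r \<xi> N ?m"
    using x y calV_filt_mono[of "int (sum_list ms)" ?m r \<xi> N] calV_filt_mono[of m ?m r \<xi> N] by auto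
  then have "vscale c x + y \<in> calV_filt r \<xi> N ?m"
    by (intro cvec.subspace_add[OF subspace_calV(2)] cvec.subspace_scale[OF subspace_calV(2)])
  then show ?case by blast
qed

lemma calV_deg_subset_filt:
  assumes fin: "finite F" "calV_deg r \<xi> N i \<subseteq> cvec.span F"
  shows "\<exists>M\<ge>0. calV_deg r \<xi> N i \<subseteq> calV_filt r \<xi> N M"
proof -
  let ?V = "calV_deg r \<xi> N i"
  obtain B where B: "B \<subseteq> ?V" "cvec.independent B" "?V \<subseteq> cvec.span B" "card B = cvec.dim ?V"
    by (rule cvec.basis_exists)
  have "finite B"
    by (rule conjunct1[OF cvec.independent_span_bound[OF fin(1) B(2) order_trans[OF B(1) fin(2)]]])
  have "\<forall>b\<in>B. \<exists>m. b \<in> calV_filt r \<xi> N m"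
    by (rule ballI) (rule calV_deg_in_filt[OF subsetD[OF B(1)]])
  from bchoice[OF this] obtain m where m': "\<forall>b\<in>B. b \<in> calV_filt r \<xi> N (m b)" by (elim exE)
  have m: "b \<in> calV_filt r \<xi> N (m b)" if "b \<in> B" for b using m' that by (rule bspec)
  let ?M = "Max (insert 0 (m ` B))"
  have "B \<subseteq> calV_filt r \<xi> N ?M"
  proof
    fix b assume b: "b \<in> B"
    then have "m b \<le> ?M" using \<open>finite B\<close> by (intro Max_ge) auto
    then show "b \<in> calV_filt r \<xi> N ?M" by (rule subsetD[OF calV_filt_mono m[OF b]])
  qed
  then have "cvec.span B \<subseteq> calV_filt r \<xi> N ?M" by (rule cvec.span_minimal) (rule subspace_calV)
  then have "?V \<subseteq> calV_filt r \<xi> N ?M" using B(3) by (rule order_trans[rotated])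
  moreover have "0 \<le> ?M" using \<open>finite B\<close> by (intro Max_ge) auto
  ultimately show ?thesis by (intro exI[of _ ?M] conjI)
qed

lemma Sum_any_telescope:
  fixes d :: "int \<Rightarrow> int"
  assumes neg: "\<And>j. j < 0 \<Longrightarrow> d j = 0" and const: "\<And>j. M \<le> j \<Longrightarrow> d j = d M" and M: "0 \<le> M"
  shows "Sum_any (\<lambda>j. d j - d (j - 1)) = d M"
proof -
  have "{j. d j - d (j - 1) \<noteq> 0} \<subseteq> {0..M}"
  proof
    fix j assume j: "j \<in> {j. d j - d (j - 1) \<noteq> 0}"
    have "\<not> j < 0" using j neg[of j] neg[of "j - 1"] by auto
    moreover have "\<not> M < j" using j const[of j] const[of "j - 1"] by auto
    ultimately show "j \<in> {0..M}" by simp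
  qed
  then have "Sum_any (\<lambda>j. d j - d (j - 1)) = (\<Sum>j\<in>{0..M}. d j - d (j - 1))"
    by (intro Sum_any.expand_superset) auto
  also have "\<dots> = d M" using M
  proof (induction M rule: int_ge_induct)
    case base
    then show ?case using neg[of "-1"] by simp
  next
    case (step M)
    have "{0..M + 1} = insert (M + 1) {0..M}" using step.hyps by auto
    then show ?case using step.IH by simp
  qed
  finally show ?thesis .
qed

text \<open>
  At \<open>y = 1\<close> the characters of the layers of the filtration add up to the character of the whole graded piece:
  the sum telescopes, since the filtration starts at 0 and exhausts the finite-dimensional piece.
\<close>

theorem ch_x_eq_dim:
  assumes len: "length \<xi> \<le> r" and n: "n = sum_list \<xi>"
  shows "ch_x r \<xi> N i \<mu> = int (cvec.dim (weight_part r n \<mu> (calV_deg r \<xi> N i)))"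
proof -
  let ?V = "calV_deg r \<xi> N i" and ?R = "reachable r n N (vinit \<xi> N) i"
  let ?W = "\<lambda>j. calV_bi r \<xi> N i j"
  have V: "?V = alt_space n ?R" by (rule calV_deg_eq_alt_space[OF len n])
  have finR: "finite ?R"
    by (rule finite_reachable[of _ "N - int n"]) (use vinit_level n in auto)
  have VR: "?V \<subseteq> supp_on ?R" unfolding V by (auto simp: alt_space_def)
  have "supp_on ?R \<subseteq> supp_on (labels r n N)" by (auto simp: supp_on_def reachable_def)
  then have VL: "?V \<subseteq> supp_on (labels r n N)" using VR by blast
  have stable: "diag_stable r n N (?W j)" for j
    unfolding diag_stable_def
  proof (intro conjI ballI)
    show "cvec.subspace (?W j)" unfolding calV_bi_def by (rule cvec.subspace_inter[OF subspace_calV])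
    show "?W j \<subseteq> supp_on (labels r n N)" using VL by (auto simp: calV_bi_def)
    fix p T assume "T \<in> ?W j"
    then have T: "T \<in> ?V" "T \<in> calV_filt r \<xi> N j" by (auto simp: calV_bi_def)
    show "gl_act_calV r N n (Emat p p) T \<in> ?W j"
      using calV_deg_gact[OF Emat_degree(1) T(1)] calV_filt_gact[OF Emat_degree(2) T(2)]
      by (simp add: gl_act_calV_def n calV_bi_def)
  qed
  define d where "d j = int (cvec.dim (weight_part r n \<mu> (?W j)))" for j
  have "ch_xy r \<xi> N i j \<mu> = d j - d (j - 1)" for j
    unfolding ch_xy_def d_def n[symmetric]
  proof (rule ch_quot_eq_dim_diff[OF stable stable _ finR])
    show "?W (j - 1) \<subseteq> ?W j" using calV_filt_mono[of "j - 1" j r \<xi> N] by (auto simp: calV_bi_def)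
    show "?W j \<subseteq> supp_on ?R" using VR by (auto simp: calV_bi_def)
  qed
  then have "ch_x r \<xi> N i \<mu> = Sum_any (\<lambda>j. d j - d (j - 1))" by (simp add: ch_x_def)
  also have "?V \<subseteq> cvec.span (unit_vec ` ?R)" using VR supp_on_span[OF finR] by blast
  then obtain M where M: "0 \<le> M" "?V \<subseteq> calV_filt r \<xi> N M"
    using calV_deg_subset_filt[of "unit_vec ` ?R" r \<xi> N i] finR by blast
  have top: "?W j = ?V" if "M \<le> j" for j
    using M(2) calV_filt_mono[OF that, of r \<xi> N] by (auto simp: calV_bi_def)
  have bot: "weight_part r n \<mu> (?W j) = {0}" if "j < 0" for j
    using cvec.subspace_0[OF subspace_calV(1), of r \<xi> N i]
    by (auto simp: calV_bi_def calV_filt_negative[OF that] weight_part_def)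
  have "Sum_any (\<lambda>j. d j - d (j - 1)) = d M"
    by (rule Sum_any_telescope[OF _ _ M(1)]) (simp_all add: d_def top bot cvec_dim_zero)
  finally show ?thesis by (simp add: d_def top)
qed

section \<open>Levels and parking functions\<close>

text \<open>
  The parts of \<open>\<rho>\<close> in increasing order are the case where \<open>c j\<close> is the \<open>j\<close>-th part of the transposed partition.
\<close>

definition ascending :: "(nat \<Rightarrow> nat) \<Rightarrow> nat \<Rightarrow> nat list" where
  "ascending c m = concat (map (\<lambda>j. replicate (c j) j) [1..<Suc m])"

lemma ascending_Suc: "ascending c (Suc m) = ascending c m @ replicate (c (Suc m)) (Suc m)"
  by (simp add: ascending_def)

lemma set_ascending: "set (ascending c m) \<subseteq> {1..m}"
  by (auto simp: ascending_def)

lemma sorted_ascending: "sorted (ascending c m)"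
proof (induction m)
  case 0 then show ?case by (simp add: ascending_def)
next
  case (Suc m)
  have "x \<le> Suc m" if "x \<in> set (ascending c m)" for x
    using subsetD[OF set_ascending that] by simp
  then show ?case using Suc by (simp add: ascending_Suc sorted_append)
qed

lemma filter_ascending: "length (filter P (ascending c m)) = (\<Sum>j=1..m. if P j then c j else 0)"
  by (induction m) (simp_all add: ascending_def filter_replicate)

lemma sum_list_ascending: "sum_list (ascending c m) = (\<Sum>j=1..m. j * c j)"
  by (induction m) (simp_all add: ascending_def sum_list_replicate mult.commute)

text \<open>
  The conditions at the entries of \<open>L\<close> are those at the jumps of the counting function of \<open>L\<close>, and between jumps
  nothing changes on the left.
\<close>

lemma sorted_order_statistic:
  fixes L :: "nat list" and F :: "nat \<Rightarrow> nat"
  assumes L: "sorted L" and F: "mono F"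
  shows "(\<forall>s\<in>{1..length L}. s \<le> F (L ! (s - 1))) \<longleftrightarrow> (\<forall>v. length (filter (\<lambda>x. x \<le> v) L) \<le> F v)"
proof (intro iffI allI ballI)
  fix v assume H: "\<forall>s\<in>{1..length L}. s \<le> F (L ! (s - 1))"
  let ?k = "length (filter (\<lambda>x. x \<le> v) L)"
  show "?k \<le> F v"
  proof (cases "?k = 0")
    case False
    have le: "?k \<le> length L" by simp
    have "L ! (?k - 1) \<le> v"
    proof (rule ccontr)
      assume gt: "\<not> L ! (?k - 1) \<le> v"
      have "{i. i < length L \<and> L ! i \<le> v} \<subseteq> {..<?k - 1}"
      proof
        fix i assume i: "i \<in> {i. i < length L \<and> L ! i \<le> v}"
        have "\<not> ?k - 1 \<le> i"
        proof
          assume "?k - 1 \<le> i"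
          then have "L ! (?k - 1) \<le> L ! i" using L i by (intro sorted_nth_mono) auto
          then show False using gt i by simp
        qed
        then show "i \<in> {..<?k - 1}" by simp
      qed
      then have "card {i. i < length L \<and> L ! i \<le> v} \<le> card {..<?k - 1}" by (rule card_mono[rotated]) simp
      moreover have "?k = card {i. i < length L \<and> L ! i \<le> v}" by (rule length_filter_conv_card)
      ultimately have "?k \<le> ?k - 1" by (simp only: card_lessThan)
      then show False using False by linarith
    qed
    moreover have "?k \<le> F (L ! (?k - 1))" 
    proof (rule H[rule_format])
      have "1 \<le> ?k" using False by linarith
      then show "?k \<in> {1..length L}" using le by simp
    qed
    ultimately show ?thesis using F by (meson monoD order_trans)
  qed simp
next
  fix s assume H: "\<forall>v. length (filter (\<lambda>x. x \<le> v) L) \<le> F v" and s: "s \<in> {1..length L}"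
  let ?v = "L ! (s - 1)"
  have "{..<s} \<subseteq> {i. i < length L \<and> L ! i \<le> ?v}"
  proof
    fix i assume "i \<in> {..<s}"
    then have "i < length L" "L ! i \<le> ?v" using L s by (auto intro!: sorted_nth_mono)
    then show "i \<in> {i. i < length L \<and> L ! i \<le> ?v}" by simp
  qed
  then have "card {..<s} \<le> card {i. i < length L \<and> L ! i \<le> ?v}" by (rule card_mono[rotated]) simp
  then have "s \<le> length (filter (\<lambda>x. x \<le> ?v) L)" by (simp add: length_filter_conv_card)
  then show "s \<le> F ?v" using H order_trans by blast
qed

text \<open>
  The distance from the top: the generating vector has the level \<open>N - depth t\<close> at position \<open>t\<close>. As a function to
  \<open>1, \<dots>, n\<close> it is an extremal parking function, with fibres of sizes given by the transposed partition.
\<close>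

definition depth :: "nat list \<Rightarrow> nat \<Rightarrow> nat" where
  "depth \<xi> t = part \<xi> (tab_row \<xi> t) + 1 - tab_col \<xi> t"

lemma depth_range:
  assumes "t \<in> {1..sum_list \<xi>}"
  shows "depth \<xi> t \<in> {1..sum_list \<xi>}"
proof -
  have "1 \<le> depth \<xi> t" "depth \<xi> t \<le> part \<xi> (tab_row \<xi> t)"
    using tab_col_pos[OF assms] tab_col_le[OF assms] by (simp_all add: depth_def)
  then show ?thesis using part_le_sum_list[of \<xi> "tab_row \<xi> t"] by simp
qed

lemma snd_vinit_depth:
  assumes "t \<in> {1..sum_list \<xi>}"
  shows "snd (vinit \<xi> N t) = N - int (depth \<xi> t)"
  using tab_col_le[OF assms] by (simp add: vinit_apply[OF assms] depth_def)

text \<open>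
  Every row of length at least \<open>j\<close> has exactly one cell at depth \<open>j\<close>.
\<close>

lemma card_depth:
  assumes j: "1 \<le> j"
  shows "card {t \<in> {1..sum_list \<xi>}. depth \<xi> t = j} = transposed_part \<xi> j"
proof -
  let ?n = "sum_list \<xi>"
  let ?A = "{t \<in> {1..?n}. depth \<xi> t = j}" and ?B = "{i \<in> {1..length \<xi>}. j \<le> part \<xi> i}"
  \<comment> \<open>The cell at depth \<open>j\<close> in row \<open>i\<close>, counted from the right end of the row.\<close>
  let ?cell = "\<lambda>i. rows_len \<xi> (i - 1) + (part \<xi> i + 1 - j)"
  have "bij_betw (tab_row \<xi>) ?A ?B"
  proof (rule bij_betw_byWitness[where f' = ?cell])
    show "\<forall>t\<in>?A. ?cell (tab_row \<xi> t) = t"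
    proof
      fix t assume t: "t \<in> ?A"
      then have t': "t \<in> {1..?n}" by simp
      have "part \<xi> (tab_row \<xi> t) + 1 - j = tab_col \<xi> t"
        using t tab_col_pos[OF t'] tab_col_le[OF t'] by (auto simp: depth_def)
      then show "?cell (tab_row \<xi> t) = t" using tab_decompose[OF t'] by simp
    qed
    have cell: "?cell i \<in> {1..?n}" "tab_row \<xi> (?cell i) = i" "tab_col \<xi> (?cell i) = part \<xi> i + 1 - j" if "i \<in> ?B" for i
    proof -
      have "1 \<le> i" "1 \<le> part \<xi> i + 1 - j" "part \<xi> i + 1 - j \<le> part \<xi> i" using that j by auto
      from cell_in_range[OF this] tab_row_cell[OF this] tab_col_cell[OF this]
      show "?cell i \<in> {1..?n}" "tab_row \<xi> (?cell i) = i" "tab_col \<xi> (?cell i) = part \<xi> i + 1 - j" .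
    qed
    show "\<forall>i\<in>?B. tab_row \<xi> (?cell i) = i" using cell(2) by blast
    show "tab_row \<xi> ` ?A \<subseteq> ?B"
    proof (rule image_subsetI)
      fix t assume t: "t \<in> ?A"
      then have t': "t \<in> {1..?n}" by simp
      have "j \<le> part \<xi> (tab_row \<xi> t)" using t tab_col_pos[OF t'] by (auto simp: depth_def)
      then show "tab_row \<xi> t \<in> ?B" using tab_row_pos[OF t'] tab_row_le_length[OF t'] by simp
    qed
    show "?cell ` ?B \<subseteq> ?A"
    proof (rule image_subsetI)
      fix i assume i: "i \<in> ?B"
      have "depth \<xi> (?cell i) = j" unfolding depth_def cell(2,3)[OF i] using i by simp
      then show "?cell i \<in> ?A" using cell(1)[OF i] by simp
    qed
  qed
  then show ?thesis unfolding transposed_part_def by (rule bij_betw_same_card)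
qed

lemma rho_of_ascending: "rho_of \<xi> = rev (ascending (transposed_part \<xi>) (sum_list \<xi>))"
  by (simp add: rho_of_def ascending_def)

lemma filter_ascending_depth:
  "length (filter P (ascending (transposed_part \<xi>) (sum_list \<xi>))) = card {t \<in> {1..sum_list \<xi>}. P (depth \<xi> t)}"
proof -
  let ?n = "sum_list \<xi>"
  have "card {t \<in> {1..?n}. P (depth \<xi> t)} = (\<Sum>j\<in>{1..?n}. card {t \<in> {t \<in> {1..?n}. P (depth \<xi> t)}. depth \<xi> t = j})"
    by (rule card_by_fibers) (use depth_range in auto)
  also have "\<dots> = (\<Sum>j=1..?n. if P j then transposed_part \<xi> j else 0)"
  proof (rule sum.cong)
    fix j assume j: "j \<in> {1..?n}"
    have "{t \<in> {t \<in> {1..?n}. P (depth \<xi> t)}. depth \<xi> t = j} = (if P j then {t \<in> {1..?n}. depth \<xi> t = j} else {})"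
      by auto
    then show "card {t \<in> {t \<in> {1..?n}. P (depth \<xi> t)}. depth \<xi> t = j} = (if P j then transposed_part \<xi> j else 0)"
      using j card_depth[of j \<xi>] by simp
  qed simp
  finally show ?thesis by (simp add: filter_ascending)
qed

lemma length_rho_of: "length (rho_of \<xi>) = sum_list \<xi>"
proof -
  have "{t \<in> {1..sum_list \<xi>}. True} = {1..sum_list \<xi>}" by blast
  then have "card {t \<in> {1..sum_list \<xi>}. True} = sum_list \<xi>" by (simp only: card_atLeastAtMost diff_add_inverse2 Suc_eq_plus1)
  then show ?thesis using filter_ascending_depth[of "\<lambda>_. True" \<xi>] by (simp only: rho_of_ascending length_rev filter_True) simp
qed

lemma sum_list_rho_of: "sum_list (rho_of \<xi>) = (\<Sum>t=1..sum_list \<xi>. depth \<xi> t)"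
proof -
  let ?n = "sum_list \<xi>"
  have "(\<Sum>t=1..?n. depth \<xi> t) = (\<Sum>j\<in>{1..?n}. \<Sum>t\<in>{t \<in> {1..?n}. depth \<xi> t = j}. depth \<xi> t)"
    by (rule sum.group[symmetric]) (use depth_range in auto)
  also have "\<dots> = (\<Sum>j=1..?n. j * transposed_part \<xi> j)"
    by (rule sum.cong) (simp_all add: card_depth[symmetric] mult.commute)
  finally show ?thesis by (simp add: rho_of_ascending sum_list_ascending sum_list_rev)
qed

text \<open>
  A parking function is a function whose counting function dominates that of the depth.
\<close>

lemma PF_iff:
  assumes f: "f \<in> {1..n} \<rightarrow>\<^sub>E {1..n}" and n: "n = sum_list \<xi>"
  shows "f \<in> PF n (rho_of \<xi>) \<longleftrightarrow>
    (\<forall>v. card {t \<in> {1..n}. depth \<xi> t \<le> v} \<le> card {t \<in> {1..n}. f t \<le> v})"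
proof -
  let ?L = "ascending (transposed_part \<xi>) n" and ?\<rho> = "rho_of \<xi>"
  define F where "F v = card {t \<in> {1..n}. f t \<le> v}" for v
  have len: "length ?L = n" "length ?\<rho> = n" using length_rho_of[of \<xi>] n by (simp_all add: rho_of_ascending)
  have pt: "part ?\<rho> (length ?\<rho> - s + 1) = ?L ! (s - 1)" if "s \<in> {1..n}" for s
  proof -
    have "length ?L - Suc (length ?L - s) = s - 1" "n - s < length ?L" "1 \<le> n - s + 1" "n - s + 1 \<le> n"
      using that len by auto
    then show ?thesis
      using len n by (simp add: part_def rho_of_ascending rev_nth One_nat_def)
  qed
  have F: "card {i \<in> {1..n}. f i \<in> {1..v}} = F v" for v
  proof -
    have "{i \<in> {1..n}. f i \<in> {1..v}} = {t \<in> {1..n}. f t \<le> v}" using PiE_mem[OF f] by auto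
    then show ?thesis by (simp add: F_def)
  qed
  have "mono F" unfolding F_def by (intro monoI card_mono) auto
  have "f \<in> PF n ?\<rho> \<longleftrightarrow> (\<forall>s\<in>{1..n}. s \<le> F (?L ! (s - 1)))"
    using f len(2) pt unfolding PF_def by (simp only: mem_Collect_eq F) auto
  also have "\<dots> \<longleftrightarrow> (\<forall>v. length (filter (\<lambda>x. x \<le> v) ?L) \<le> F v)"
    using sorted_order_statistic[OF sorted_ascending \<open>mono F\<close>, of "transposed_part \<xi>" n] len by simp
  finally show ?thesis
    unfolding n filter_ascending_depth F_def .
qed

text \<open>
  A parking function becomes a function of levels by \<open>i = N - f\<close>; this identifies the labels of
  \<open>V\<^sub>r\<^sup>\<otimes>\<^sup>n \<otimes> \<complex>PF\<close> with those of the reachable wedges.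
\<close>

definition label_of :: "nat \<Rightarrow> int \<Rightarrow> (nat \<Rightarrow> nat) \<times> (nat \<Rightarrow> nat) \<Rightarrow> nat \<Rightarrow> nat \<times> int" where
  "label_of n N = (\<lambda>(w, f). \<lambda>t\<in>{1..n}. (w t, N - int (f t)))"

lemma label_of_apply:
  "t \<in> {1..n} \<Longrightarrow> label_of n N (w, f) t = (w t, N - int (f t))"
  "t \<notin> {1..n} \<Longrightarrow> label_of n N (w, f) t = undefined"
  unfolding label_of_def case_prod_conv restrict_apply by (rule if_P if_not_P, assumption)+

text \<open>
  Under \<open>i = N - f\<close> the reachability condition becomes the parking condition, and the degree in \<open>\<X>\<close> becomes
  \<open>|\<rho>| - \<Sum> f\<close>.
\<close>

lemma reachable_label_of:
  assumes f: "f \<in> {1..n} \<rightarrow>\<^sub>E {1..n}" and w: "w \<in> words r n" and n: "n = sum_list \<xi>"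
  shows "label_of n N (w, f) \<in> reachable r n N (vinit \<xi> N) i \<longleftrightarrow> f \<in> PFm n (rho_of \<xi>) i"
proof -
  let ?b = "label_of n N (w, f)"
  have lab: "?b \<in> labels r n N"
  proof (rule PiE_I)
    fix t assume t: "t \<in> {1..n}"
    then show "?b t \<in> Vbasis r N"
      using PiE_mem[OF f t] PiE_mem[OF w t] by (simp add: label_of_apply Vbasis_def)
  qed (rule label_of_apply)
  have lev: "levels_ge n ?b (N - int v) = card {t \<in> {1..n}. f t \<le> v}" for v
    unfolding levels_ge_def by (intro arg_cong[of _ _ card] Collect_cong) (auto simp: label_of_apply)
  have lev0: "levels_ge n (vinit \<xi> N) (N - int v) = card {t \<in> {1..n}. depth \<xi> t \<le> v}" for v
    unfolding levels_ge_def n by (intro arg_cong[of _ _ card] Collect_cong) (auto simp: snd_vinit_depth)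
  have high: "levels_ge n (vinit \<xi> N) s = 0" if "N < s" for s
  proof -
    have "{t \<in> {1..n}. s \<le> snd (vinit \<xi> N t)} = {}" using that by (auto simp: snd_vinit_depth n)
    then show ?thesis by (simp add: levels_ge_def)
  qed
  have dom: "(\<forall>s. levels_ge n (vinit \<xi> N) s \<le> levels_ge n ?b s) \<longleftrightarrow> f \<in> PF n (rho_of \<xi>)"
  proof -
    have "(\<forall>s. levels_ge n (vinit \<xi> N) s \<le> levels_ge n ?b s) \<longleftrightarrow>
        (\<forall>v. levels_ge n (vinit \<xi> N) (N - int v) \<le> levels_ge n ?b (N - int v))"
    proof (intro iffI allI)
      fix s assume H: "\<forall>v. levels_ge n (vinit \<xi> N) (N - int v) \<le> levels_ge n ?b (N - int v)"
      show "levels_ge n (vinit \<xi> N) s \<le> levels_ge n ?b s"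
      proof (cases "N < s")
        case True then show ?thesis by (simp add: high)
      next
        case False
        then have "s = N - int (nat (N - s))" by simp
        then show ?thesis using H by metis
      qed
    qed blast
    then show ?thesis unfolding lev lev0 PF_iff[OF f n] .
  qed
  have "level_sum n ?b = (\<Sum>t=1..n. N - int (f t))"
    unfolding level_sum_def by (rule sum.cong) (simp_all add: label_of_apply)
  moreover have "level_sum n (vinit \<xi> N) = (\<Sum>t=1..n. N - int (depth \<xi> t))"
    unfolding level_sum_def n by (rule sum.cong) (simp_all add: snd_vinit_depth)
  ultimately have "level_sum n ?b = level_sum n (vinit \<xi> N) + i \<longleftrightarrow>
      int (\<Sum>t=1..n. depth \<xi> t) - int (\<Sum>t=1..n. f t) = i"
    by (simp add: sum_subtractf) linarith
  then have "level_sum n ?b = level_sum n (vinit \<xi> N) + i \<longleftrightarrow> pf_deg n (rho_of \<xi>) f = i"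
    by (simp only: pf_deg_def sum_list_rho_of n)
  then show ?thesis using lab dom by (simp add: reachable_def PFm_def)
qed

lemma bij_label_of:
  assumes len: "length \<xi> \<le> r" and n: "n = sum_list \<xi>"
  shows "bij_betw (label_of n N) (words_of_weight r n \<mu> \<times> PFm n (rho_of \<xi>) i)
    {b \<in> reachable r n N (vinit \<xi> N) i. has_weight n \<mu> {1..r} b}" (is "bij_betw _ ?X ?D")
proof -
  let ?inv = "\<lambda>b. (\<lambda>t\<in>{1..n}. fst (b t), \<lambda>t\<in>{1..n}. nat (N - snd (b t)))"
  have count: "count_of n (fst \<circ> label_of n N (w, f)) p = count_of n w p" for w f p
    unfolding count_of_def by (intro arg_cong[of _ _ card] Collect_cong) (auto simp: label_of_apply)
  have to: "label_of n N x \<in> ?D" if x: "x \<in> ?X" for x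
  proof -
    obtain w f where wf: "x = (w, f)" "w \<in> words_of_weight r n \<mu>" "f \<in> PFm n (rho_of \<xi>) i" using x by auto
    have w: "w \<in> words r n" using wf(2) words_of_weight_subset by blast
    have f: "f \<in> {1..n} \<rightarrow>\<^sub>E {1..n}" using wf(3) by (simp add: PFm_def PF_def)
    have "label_of n N (w, f) \<in> reachable r n N (vinit \<xi> N) i"
      using reachable_label_of[OF f w n] wf(3) by simp
    moreover have "has_weight n \<mu> {1..r} (label_of n N (w, f))"
      using wf(2) unfolding has_weight_def count words_of_weight_def by blast
    ultimately show ?thesis by (simp add: wf(1))
  qed
  have inv_right: "?inv b \<in> ?X \<and> label_of n N (?inv b) = b" if b: "b \<in> ?D" for b
  proof -
    have lab: "b \<in> labels r n N" and reach: "b \<in> reachable r n N (vinit \<xi> N) i" using b by (auto simp: reachable_def)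
    have up: "fst (b t) \<in> {1..r}" "snd (b t) < N" if "t \<in> {1..n}" for t
      using PiE_mem[OF lab that] by (auto simp: Vbasis_def mem_Times_iff)
    have low: "N - int n \<le> snd (b t)" if t: "t \<in> {1..n}" for t
    proof -
      have "levels_ge n (vinit \<xi> N) (N - int n) = n"
      proof -
        have "{t \<in> {1..n}. N - int n \<le> snd (vinit \<xi> N t)} = {1..n}" using vinit_level(1) n by blast
        then show ?thesis by (simp add: levels_ge_def)
      qed
      moreover have "levels_ge n (vinit \<xi> N) (N - int n) \<le> levels_ge n b (N - int n)"
        using reach unfolding reachable_def by blast
      ultimately have "card {1..n} \<le> card {t \<in> {1..n}. N - int n \<le> snd (b t)}"
        by (simp add: levels_ge_def)
      then have "{t \<in> {1..n}. N - int n \<le> snd (b t)} = {1..n}" by (intro card_seteq) auto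
      then show ?thesis using t by blast
    qed
    let ?w = "\<lambda>t\<in>{1..n}. fst (b t)" and ?f = "\<lambda>t\<in>{1..n}. nat (N - snd (b t))"
    have w: "?w \<in> words r n" by (rule restrict_PiE_iff[THEN iffD2]) (use up in blast)
    have f: "?f \<in> {1..n} \<rightarrow>\<^sub>E {1..n}"
    proof (rule restrict_PiE_iff[THEN iffD2], rule ballI)
      fix t assume t: "t \<in> {1..n}"
      have "1 \<le> N - snd (b t)" "N - snd (b t) \<le> int n" using up(2)[OF t] low[OF t] by simp_all
      then show "nat (N - snd (b t)) \<in> {1..n}" by (simp add: nat_le_iff le_nat_iff)
    qed
    have eq: "label_of n N (?w, ?f) = b"
    proof
      fix t
      show "label_of n N (?w, ?f) t = b t"
      proof (cases "t \<in> {1..n}")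
        case True
        then show ?thesis using up(2)[OF True] by (simp add: label_of_apply)
      next
        case False
        then show ?thesis using PiE_arb[OF lab False] label_of_apply(2)[OF False] by simp
      qed
    qed
    have "?f \<in> PFm n (rho_of \<xi>) i" using reachable_label_of[OF f w n, of N i] reach by (simp only: eq)
    moreover have "?w \<in> words_of_weight r n \<mu>"
      using b w count[of ?w ?f] unfolding eq words_of_weight_def has_weight_def by simp
    ultimately show ?thesis using eq by blast
  qed
  have inv_left: "?inv (label_of n N x) = x" if x: "x \<in> ?X" for x
  proof -
    obtain w f where wf: "x = (w, f)" "w \<in> words_of_weight r n \<mu>" "f \<in> PFm n (rho_of \<xi>) i" using x by auto
    have w: "w \<in> words r n" using wf(2) words_of_weight_subset by blast
    have f: "f \<in> {1..n} \<rightarrow>\<^sub>E {1..n}" using wf(3) by (simp add: PFm_def PF_def)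
    have "(\<lambda>t\<in>{1..n}. fst (label_of n N (w, f) t)) = w"
      using PiE_arb[OF w] by (intro ext) (simp add: label_of_apply restrict_def)
    moreover have "(\<lambda>t\<in>{1..n}. nat (N - snd (label_of n N (w, f) t))) = f"
      using PiE_arb[OF f] by (intro ext) (simp add: label_of_apply restrict_def)
    ultimately show ?thesis by (simp add: wf(1))
  qed
  show ?thesis
    by (rule bij_betw_byWitness[where f' = ?inv]) (use to inv_right inv_left in blast)+
qed

lemma label_of_comp:
  assumes "\<sigma> permutes {1..n}"
  shows "label_of n N (w \<circ> \<sigma>, f \<circ> \<sigma>) = label_of n N (w, f) \<circ> \<sigma>"
proof
  fix t
  show "label_of n N (w \<circ> \<sigma>, f \<circ> \<sigma>) t = (label_of n N (w, f) \<circ> \<sigma>) t"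
  proof (cases "t \<in> {1..n}")
    case True
    then show ?thesis using permutes_in[OF assms True] by (simp add: label_of_apply)
  next
    case False
    then show ?thesis
      by (simp only: permutes_not_in[OF assms False] label_of_apply(2)[OF False] comp_apply)
  qed
qed

lemma reachable_comp:
  assumes \<sigma>: "\<sigma> permutes {1..n}" and b: "b \<in> reachable r n N b\<^sub>0 i"
  shows "b \<circ> \<sigma> \<in> reachable r n N b\<^sub>0 i"
proof -
  have "levels_ge n (b \<circ> \<sigma>) s = levels_ge n b s" for s
    unfolding levels_ge_def comp_apply by (rule card_permutes_Collect[OF \<sigma>])
  moreover have "level_sum n (b \<circ> \<sigma>) = level_sum n b"
    unfolding level_sum_def using sum.permute[OF \<sigma>, of "\<lambda>t. snd (b t)"] by (simp add: comp_def)
  ultimately show ?thesis using b PiE_comp_permutes[OF _ \<sigma>, of b] by (simp add: reachable_def)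
qed

section \<open>Comparison of the characters\<close>

text \<open>
  Antisymmetric tensors are the invariants of a monomial representation twisted by the sign, on a basis that is
  equivariantly identified with pairs of a word and a parking function.
\<close>

theorem ch_x_character:
  assumes len: "length \<xi> \<le> r" and n: "n = sum_list \<xi>"
  shows "fact n * of_int (ch_x r \<xi> N i \<mu>) = pairing n (word_char r n \<mu>) (pf_char n (rho_of \<xi>) i)"
proof -
  let ?R = "reachable r n N (vinit \<xi> N) i"
  let ?D = "{b \<in> ?R. has_weight n \<mu> {1..r} b}"
  let ?X = "words_of_weight r n \<mu> \<times> PFm n (rho_of \<xi>) i"
  have finR: "finite ?R"
    by (rule finite_reachable[of _ "N - int n"]) (use vinit_level n in auto)
  have D_comp: "b \<circ> \<sigma> \<in> ?D" if b: "b \<in> ?D" and \<sigma>: "\<sigma> permutes {1..n}" for b \<sigma>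
  proof -
    have "count_of n (fst \<circ> (b \<circ> \<sigma>)) p = count_of n (fst \<circ> b) p" for p
      using count_of_comp[OF \<sigma>, of "fst \<circ> b" p] by (simp only: comp_assoc)
    then show ?thesis using b reachable_comp[OF \<sigma>] by (simp add: has_weight_def)
  qed
  interpret br: monomial_rep n ?D "\<lambda>b \<sigma>. b \<circ> \<sigma>" "\<lambda>\<sigma>. of_int (sign \<sigma>)"
  proof
    show "finite ?D" using finR by simp
  qed (use D_comp in \<open>simp_all only: sign_character comp_assoc comp_id\<close>)
  have inv: "br.invs = weight_part r n \<mu> (calV_deg r \<xi> N i)"
  proof -
    have anti: "(\<forall>\<sigma>. \<sigma> permutes {1..n} \<longrightarrow> br.act \<sigma> T = T) \<longleftrightarrow> antisym n T" for T :: tens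
    proof
      assume H: "\<forall>\<sigma>. \<sigma> permutes {1..n} \<longrightarrow> br.act \<sigma> T = T"
      show "antisym n T"
        unfolding antisym_def
      proof (intro allI impI)
        fix \<sigma> and b :: "nat \<Rightarrow> nat \<times> int" assume "\<sigma> permutes {1..n}"
        then have "br.act \<sigma> T b = T b" using H by simp
        then show "T (b \<circ> \<sigma>) = of_int (sign \<sigma>) * T b"
          unfolding br.act_def by (metis of_int_sign_square)
      qed
    next
      assume "antisym n T"
      then show "\<forall>\<sigma>. \<sigma> permutes {1..n} \<longrightarrow> br.act \<sigma> T = T"
        by (auto simp: br.act_def fun_eq_iff antisymD)
    qed
    show ?thesis
      unfolding br.invs_def anti weight_part_def calV_deg_eq_alt_space[OF len n] alt_space_def
      by (auto simp: supp_on_def)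
  qed
  have "fact n * of_int (ch_x r \<xi> N i \<mu>) = (\<Sum>\<sigma>\<in>Sn n. br.character \<sigma>)"
    using br.dim_invs unfolding inv ch_x_eq_dim[OF len n] by simp
  also have "\<dots> = pairing n (word_char r n \<mu>) (pf_char n (rho_of \<xi>) i)"
    unfolding pairing_def
  proof (rule sum.cong)
    fix \<sigma> assume "\<sigma> \<in> Sn n"
    then have \<sigma>: "\<sigma> permutes {1..n}" by simp
    let ?A = "{w \<in> words_of_weight r n \<mu>. w \<circ> \<sigma> = w} \<times> {f \<in> PFm n (rho_of \<xi>) i. f \<circ> \<sigma> = f}"
    note bij = bij_label_of[OF len n, of N \<mu> i]
    have "label_of n N ` ?A = {b \<in> ?D. b \<circ> \<sigma> = b}"
    proof
      show "label_of n N ` ?A \<subseteq> {b \<in> ?D. b \<circ> \<sigma> = b}"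
      proof (rule image_subsetI)
        fix x assume x: "x \<in> ?A"
        then obtain w f where wf: "x = (w, f)" "w \<circ> \<sigma> = w" "f \<circ> \<sigma> = f" by blast
        have "x \<in> ?X" using x by blast
        then have "label_of n N x \<in> ?D" by (rule bspec[OF bij_betwE[OF bij]])
        moreover have "label_of n N x \<circ> \<sigma> = label_of n N x"
          using label_of_comp[OF \<sigma>, of N w f] by (simp only: wf)
        ultimately show "label_of n N x \<in> {b \<in> ?D. b \<circ> \<sigma> = b}" by blast
      qed
      show "{b \<in> ?D. b \<circ> \<sigma> = b} \<subseteq> label_of n N ` ?A"
      proof
        fix b assume b: "b \<in> {b \<in> ?D. b \<circ> \<sigma> = b}"
        then have "b \<in> ?D" by blast
        then have "b \<in> label_of n N ` ?X" by (simp only: bij_betw_imp_surj_on[OF bij])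
        then obtain w f where wf: "(w, f) \<in> ?X" "b = label_of n N (w, f)" by blast
        have X: "(w \<circ> \<sigma>, f \<circ> \<sigma>) \<in> ?X" using wf(1) words_of_weight_comp[OF _ \<sigma>] PFm_comp[OF _ \<sigma>] by blast
        have "label_of n N (w \<circ> \<sigma>, f \<circ> \<sigma>) = label_of n N (w, f)"
          using b wf(2) label_of_comp[OF \<sigma>, of N w f] by simp
        then have "(w \<circ> \<sigma>, f \<circ> \<sigma>) = (w, f)"
          by (rule inj_onD[OF bij_betw_imp_inj_on[OF bij] _ X wf(1)])
        then show "b \<in> label_of n N ` ?A" using wf by blast
      qed
    qed
    moreover have "card (label_of n N ` ?A) = card ?A"
      by (rule card_image[OF inj_on_subset[OF bij_betw_imp_inj_on[OF bij]]]) blast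
    ultimately have "card {b \<in> ?D. b \<circ> \<sigma> = b} = card ?A" by (simp only:)
    then show "br.character \<sigma> = word_char r n \<mu> \<sigma> * pf_char n (rho_of \<xi>) i \<sigma>"
      unfolding br.character_def wr.character_def pr.character_def by (simp add: card_cartesian_product)
  qed simp
  finally show ?thesis .
qed

text \<open>
  The multiplicity of \<open>\<pi>\<^sub>\<eta>\<close> and the weight multiplicity of \<open>\<pi>\<^sup>\<eta>\<close> are both normalized pairings with the Young
  symmetrizer of \<open>\<eta>\<close>, and the sum of their products over \<open>\<eta>\<close> is evaluated by the Parseval identity. For \<open>\<eta>\<close> with
  more than \<open>r\<close> rows, where the Frobenius map is 0, the second factor vanishes by itself.
\<close>

theorem ch_class_character:
  "fact n * of_int (ch_class r n (frobenius r (sym_class n pf_sign_act (CPFm n \<rho> m))) \<mu>)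
    = pairing n (word_char r n \<mu>) (pf_char n \<rho> m)"
proof -
  let ?P = "partitions_of n"
  have "of_int (ch_class r n (frobenius r (sym_class n pf_sign_act (CPFm n \<rho> m))) \<mu>)
      = (\<Sum>\<eta>\<in>?P. (pairing n (word_char r n \<mu>) (young_symmetrizer \<eta>) / hook_prod \<eta>)
          * (pairing n (pf_char n \<rho> m) (young_symmetrizer \<eta>) / hook_prod \<eta>))"
    unfolding ch_class_def of_int_sum
  proof (rule sum.cong)
    fix \<eta> assume \<eta>: "\<eta> \<in> ?P"
    show "of_int (frobenius r (sym_class n pf_sign_act (CPFm n \<rho> m)) \<eta> * ch r (gl_act_calV r 0 n) (gl_irrep r \<eta>) \<mu>)
        = (pairing n (word_char r n \<mu>) (young_symmetrizer \<eta>) / hook_prod \<eta>)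
          * (pairing n (pf_char n \<rho> m) (young_symmetrizer \<eta>) / hook_prod \<eta>)"
    proof (cases "part \<eta> (r + 1) = 0")
      case True
      show ?thesis
        unfolding frobenius_def if_P[OF True] of_int_mult dim_sym_class_pf[OF \<eta>] ch_gl_irrep[OF \<eta> True]
        by (rule mult.commute)
    next
      case False
      then show ?thesis by (simp add: frobenius_def word_char_young_zero[OF \<eta>])
    qed
  qed simp
  then show ?thesis
    using young_parseval[OF wr.class_fun_character pr.class_fun_character pr.character_inv, of n r \<mu> \<rho> m] by simp
qed

theorem theorem4:
  fixes r n :: nat and \<xi> \<rho> :: "nat list" and N :: int
  assumes "length \<xi> = r" and "sorted_wrt (\<ge>) \<xi>"
    and "n = sum_list \<xi>" and "\<rho> = rho_of \<xi>"
  shows "(ch_x r \<xi> N =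
           (\<lambda>m. ch r (tensor_gl_act r n) (invariants n tensor_sign_act (tensor_CPFm r n \<rho> m))))
       \<and> (ch_x r \<xi> N =
           (\<lambda>m. ch_class r n (frobenius r (sym_class n pf_sign_act (CPFm n \<rho> m)))))"
proof (intro conjI ext)
  fix m \<mu>
  have cancel: "x = y" if "fact n * of_int x = (fact n * of_int y :: complex)" for x y :: int
    using that by simp
  have x: "fact n * of_int (ch_x r \<xi> N m \<mu>) = pairing n (word_char r n \<mu>) (pf_char n \<rho> m)"
    unfolding assms(4) by (rule ch_x_character) (use assms in simp_all)
  show "ch_x r \<xi> N m \<mu> = ch r (tensor_gl_act r n) (invariants n tensor_sign_act (tensor_CPFm r n \<rho> m)) \<mu>"
    by (rule cancel) (simp only: x ch_tensor_invariants)
  show "ch_x r \<xi> N m \<mu> = ch_class r n (frobenius r (sym_class n pf_sign_act (CPFm n \<rho> m))) \<mu>"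
    by (rule cancel) (simp only: x ch_class_character)
qed

end
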